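(* Let $E=\bigwedge V$ be the exterior algebra of a finite-dimensional vector space $V$ over a field $K$, and let $\mathbf F$ be a free or injective resolution of a finitely generated $E$-module. Then the linear part $\operatorname{lin}(\mathbf F)$ of $\mathbf F$ is eventually exact; that is, $\operatorname{lin}(\mathbf F)$ is exact at all terms sufficiently far from the start of the resolution (in cohomological degree $-i$ for all $i\gg0$ for a free resolution $\cdots\to F^{-1}\to F^0$, and in cohomological degree $i$ for all $i\gg 0$ for an injective resolution $F^0\to F^1\to\cdots$).
   Context: $E=\bigwedge V$ is graded with $\bigwedge^jV$ in degree $-j$; its maximal ideal is generated by $V$. Over $E$ the notions of free, projective and injective module coincide. A free complex over $E$ is minimal if its differentials can be represented by matrices with entries in the maximal ideal. For a matrix $A$ over $E$ with entries in the maximal ideal, its linear part $\operatorname{lin}(A)$ is obtained by erasing from each entry all terms of (absolute) degree $>1$, i.e. keeping only the component of each entry in $\bigwedge^1V=V$. If $\mathbf F$ is a minimal free complex, $\operatorname{lin}(\mathbf F)$ is the complex with the same free modules and with each differential $d$ replaced by $\operatorname{lin}(d)$. For an arbitrary free complex $\mathbf F$, $\operatorname{lin}(\mathbf F)$ is defined to be the linear part of a minimal free complex homotopy equivalent to $\mathbf F$. *)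

theory Defs
  imports "HOL-Algebra.QuotRing" "HOL-Algebra.Module" "HOL.Vector_Spaces"
begin

section \<open>The exterior algebra of a vector space\<close>

text \<open>
  The free associative \<open>K\<close>-algebra on the underlying set of \<open>V\<close>: finitely supported functions
  on words in the elements of \<open>V\<close>, with concatenation product.
\<close>

definition word_algebra :: "('v list \<Rightarrow> 'k::field) ring" where
  "word_algebra =
    \<lparr>carrier = {f. finite {w. f w \<noteq> 0}},
     mult = (\<lambda>f g w. \<Sum>i\<le>length w. f (take i w) * g (drop i w)),
     one = (\<lambda>w. if w = [] then 1 else 0),
     zero = (\<lambda>w. 0),
     add = (\<lambda>f g w. f w + g w)\<rparr>"

definition word :: "'v list \<Rightarrow> 'v list \<Rightarrow> 'k::field" where
  "word u = (\<lambda>w. if w = u then 1 else 0)"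

text \<open>
  The first two families of relations turn the free algebra on the set \<open>V\<close> into the tensor
  algebra \<open>T(V)\<close>; the third one passes from \<open>T(V)\<close> to \<open>T(V) / (v \<otimes> v)\<close>.
\<close>

definition exterior_relations ::
    "('k::field \<Rightarrow> 'v::ab_group_add \<Rightarrow> 'v) \<Rightarrow> ('v list \<Rightarrow> 'k) set" where
  "exterior_relations scale =
     {(\<lambda>w. word [x + y] w - word [x] w - word [y] w) | x y. True}
   \<union> {(\<lambda>w. word [scale c x] w - c * word [x] w) | c x. True}
   \<union> {word [x, x] | x. True}"

definition exterior_ideal ::
    "('k::field \<Rightarrow> 'v::ab_group_add \<Rightarrow> 'v) \<Rightarrow> ('v list \<Rightarrow> 'k) set" where
  "exterior_ideal scale = Idl\<^bsub>word_algebra\<^esub> (exterior_relations scale)"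

definition exterior_algebra ::
    "('k::field \<Rightarrow> 'v::ab_group_add \<Rightarrow> 'v) \<Rightarrow> ('v list \<Rightarrow> 'k) set ring" where
  "exterior_algebra scale = word_algebra Quot (exterior_ideal scale)"

definition exterior_class ::
    "('k::field \<Rightarrow> 'v::ab_group_add \<Rightarrow> 'v) \<Rightarrow> ('v list \<Rightarrow> 'k) \<Rightarrow> ('v list \<Rightarrow> 'k) set" where
  "exterior_class scale f = exterior_ideal scale +>\<^bsub>word_algebra\<^esub> f"

definition exterior_max_ideal ::
    "('k::field \<Rightarrow> 'v::ab_group_add \<Rightarrow> 'v) \<Rightarrow> ('v list \<Rightarrow> 'k) set set" where
  "exterior_max_ideal scale =
     Idl\<^bsub>exterior_algebra scale\<^esub> (range (\<lambda>v. exterior_class scale (word [v])))"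

text \<open>
  The component of \<open>a\<close> in \<open>\<And>\<^sup>j V\<close>, as the class of the degree-\<open>j\<close> part of a
  representative of \<open>a\<close>. All relations are homogeneous for word length, so the choice of the
  representative is immaterial.
\<close>

definition exterior_component ::
    "('k::field \<Rightarrow> 'v::ab_group_add \<Rightarrow> 'v) \<Rightarrow> nat \<Rightarrow> ('v list \<Rightarrow> 'k) set \<Rightarrow> ('v list \<Rightarrow> 'k) set"
  where
  "exterior_component scale j a =
     exterior_class scale (\<lambda>w. if length w = j then (SOME f. f \<in> a) w else 0)"


section \<open>Modules over a noncommutative ring\<close>

text \<open>The locale \<open>module\<close> of \<open>HOL-Algebra\<close> requires a commutative ring; only its record type is
  used here. Modules are left modules.\<close>

locale left_module = R?: ring R + M?: abelian_group M
  for R :: "('r, 'x) ring_scheme" (structure) and M :: "('r, 'm, 'y) module_scheme" (structure) +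
  assumes smult_closed:
      "\<lbrakk>a \<in> carrier R; x \<in> carrier M\<rbrakk> \<Longrightarrow> a \<odot>\<^bsub>M\<^esub> x \<in> carrier M"
    and smult_l_distr:
      "\<lbrakk>a \<in> carrier R; b \<in> carrier R; x \<in> carrier M\<rbrakk> \<Longrightarrow>
        (a \<oplus> b) \<odot>\<^bsub>M\<^esub> x = a \<odot>\<^bsub>M\<^esub> x \<oplus>\<^bsub>M\<^esub> b \<odot>\<^bsub>M\<^esub> x"
    and smult_r_distr:
      "\<lbrakk>a \<in> carrier R; x \<in> carrier M; y \<in> carrier M\<rbrakk> \<Longrightarrow>
        a \<odot>\<^bsub>M\<^esub> (x \<oplus>\<^bsub>M\<^esub> y) = a \<odot>\<^bsub>M\<^esub> x \<oplus>\<^bsub>M\<^esub> a \<odot>\<^bsub>M\<^esub> y"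
    and smult_assoc1:
      "\<lbrakk>a \<in> carrier R; b \<in> carrier R; x \<in> carrier M\<rbrakk> \<Longrightarrow>
        (a \<otimes> b) \<odot>\<^bsub>M\<^esub> x = a \<odot>\<^bsub>M\<^esub> (b \<odot>\<^bsub>M\<^esub> x)"
    and smult_one:
      "x \<in> carrier M \<Longrightarrow> \<one> \<odot>\<^bsub>M\<^esub> x = x"

definition left_module_hom ::
    "('r, 'x) ring_scheme \<Rightarrow> ('r, 'm, 'y) module_scheme \<Rightarrow> ('r, 'n, 'z) module_scheme \<Rightarrow> ('m \<Rightarrow> 'n) set"
  where
  "left_module_hom R M N =
    {f. f \<in> carrier M \<rightarrow> carrier N \<and>
        (\<forall>x\<in>carrier M. \<forall>y\<in>carrier M. f (x \<oplus>\<^bsub>M\<^esub> y) = f x \<oplus>\<^bsub>N\<^esub> f y) \<and>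
        (\<forall>a\<in>carrier R. \<forall>x\<in>carrier M. f (a \<odot>\<^bsub>M\<^esub> x) = a \<odot>\<^bsub>N\<^esub> f x)}"

definition finite_coeffs :: "('r, 'x) ring_scheme \<Rightarrow> 'm set \<Rightarrow> ('m \<Rightarrow> 'r) set" where
  "finite_coeffs R B =
    {c. c \<in> B \<rightarrow> carrier R \<and> (\<forall>b. b \<notin> B \<longrightarrow> c b = \<zero>\<^bsub>R\<^esub>) \<and> finite {b. c b \<noteq> \<zero>\<^bsub>R\<^esub>}}"

definition lin_comb ::
    "('r, 'x) ring_scheme \<Rightarrow> ('r, 'm, 'y) module_scheme \<Rightarrow> ('m \<Rightarrow> 'r) \<Rightarrow> 'm" where
  "lin_comb R M c = (\<Oplus>\<^bsub>M\<^esub>b\<in>{b. c b \<noteq> \<zero>\<^bsub>R\<^esub>}. c b \<odot>\<^bsub>M\<^esub> b)"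

definition fin_gen_module ::
    "('r, 'x) ring_scheme \<Rightarrow> ('r, 'm, 'y) module_scheme \<Rightarrow> bool" where
  "fin_gen_module R M \<longleftrightarrow> left_module R M \<and>
    (\<exists>S. finite S \<and> S \<subseteq> carrier M \<and> carrier M = lin_comb R M ` finite_coeffs R S)"

definition is_basis ::
    "('r, 'x) ring_scheme \<Rightarrow> ('r, 'm, 'y) module_scheme \<Rightarrow> 'm set \<Rightarrow> bool" where
  "is_basis R M B \<longleftrightarrow> B \<subseteq> carrier M \<and>
    (\<forall>x\<in>carrier M. \<exists>!c. c \<in> finite_coeffs R B \<and> lin_comb R M c = x)"

definition free_module ::
    "('r, 'x) ring_scheme \<Rightarrow> ('r, 'm, 'y) module_scheme \<Rightarrow> bool" where
  "free_module R M \<longleftrightarrow> left_module R M \<and> (\<exists>B. is_basis R M B)"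

text \<open>
  The test modules \<open>A\<close>, \<open>B\<close> range over all left \<open>R\<close>-modules whose elements are of the same type
  as those of \<open>R\<close>. These include \<open>R\<close> and all its left ideals, so by Baer's criterion this is
  injectivity with respect to all left \<open>R\<close>-modules.
\<close>

definition injective_module ::
    "('r, 'x) ring_scheme \<Rightarrow> ('r, 'm, 'y) module_scheme \<Rightarrow> bool" where
  "injective_module R J \<longleftrightarrow> left_module R J \<and>
    (\<forall>(A :: ('r, 'r) module) (B :: ('r, 'r) module) i f.
       left_module R A \<and> left_module R B \<and>
       i \<in> left_module_hom R A B \<and> inj_on i (carrier A) \<and> f \<in> left_module_hom R A J \<longrightarrow>
       (\<exists>g\<in>left_module_hom R B J. \<forall>x\<in>carrier A. g (i x) = f x))"


section \<open>Complexes and resolutions\<close>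

text \<open>Cohomological indexing by all integers: \<open>diff C i\<close> maps \<open>obj C i\<close> to \<open>obj C (i + 1)\<close>.
  Maps of modules matter only on carriers.\<close>

record ('r, 'm) cochain =
  obj :: "int \<Rightarrow> ('r, 'm) module"
  diff :: "int \<Rightarrow> 'm \<Rightarrow> 'm"

definition is_cochain :: "('r, 'x) ring_scheme \<Rightarrow> ('r, 'm) cochain \<Rightarrow> bool" where
  "is_cochain R C \<longleftrightarrow>
    (\<forall>i. left_module R (obj C i)) \<and>
    (\<forall>i. diff C i \<in> left_module_hom R (obj C i) (obj C (i + 1))) \<and>
    (\<forall>i. \<forall>x\<in>carrier (obj C i). diff C (i + 1) (diff C i x) = \<zero>\<^bsub>obj C (i + 2)\<^esub>)"

definition cocycles :: "('r, 'm) cochain \<Rightarrow> int \<Rightarrow> 'm set" where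
  "cocycles C i = {x \<in> carrier (obj C i). diff C i x = \<zero>\<^bsub>obj C (i + 1)\<^esub>}"

definition coboundaries :: "('r, 'm) cochain \<Rightarrow> int \<Rightarrow> 'm set" where
  "coboundaries C i = diff C (i - 1) ` carrier (obj C (i - 1))"

definition exact_at :: "('r, 'm) cochain \<Rightarrow> int \<Rightarrow> bool" where
  "exact_at C i \<longleftrightarrow> cocycles C i = coboundaries C i"

definition free_resolution ::
    "('r, 'x) ring_scheme \<Rightarrow> ('r, 'a, 'y) module_scheme \<Rightarrow> ('r, 'm) cochain \<Rightarrow> bool" where
  "free_resolution R M F \<longleftrightarrow> is_cochain R F \<and>
    (\<forall>i. free_module R (obj F i)) \<and>
    (\<forall>i>0. carrier (obj F i) = {\<zero>\<^bsub>obj F i\<^esub>}) \<and>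
    (\<forall>i<0. exact_at F i) \<and>
    (\<exists>\<epsilon>\<in>left_module_hom R (obj F 0) M.
       \<epsilon> ` carrier (obj F 0) = carrier M \<and>
       {x \<in> carrier (obj F 0). \<epsilon> x = \<zero>\<^bsub>M\<^esub>} = coboundaries F 0)"

definition injective_resolution ::
    "('r, 'x) ring_scheme \<Rightarrow> ('r, 'a, 'y) module_scheme \<Rightarrow> ('r, 'm) cochain \<Rightarrow> bool" where
  "injective_resolution R M F \<longleftrightarrow> is_cochain R F \<and>
    (\<forall>i. injective_module R (obj F i)) \<and>
    (\<forall>i<0. carrier (obj F i) = {\<zero>\<^bsub>obj F i\<^esub>}) \<and>
    (\<forall>i>0. exact_at F i) \<and>
    (\<exists>\<eta>\<in>left_module_hom R M (obj F 0).
       inj_on \<eta> (carrier M) \<and> \<eta> ` carrier M = cocycles F 0)"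

definition chain_map ::
    "('r, 'x) ring_scheme \<Rightarrow> ('r, 'm) cochain \<Rightarrow> ('r, 'n) cochain \<Rightarrow> (int \<Rightarrow> 'm \<Rightarrow> 'n) \<Rightarrow> bool" where
  "chain_map R C D f \<longleftrightarrow>
    (\<forall>i. f i \<in> left_module_hom R (obj C i) (obj D i)) \<and>
    (\<forall>i. \<forall>x\<in>carrier (obj C i). f (i + 1) (diff C i x) = diff D i (f i x))"

definition homotopic_to_id ::
    "('r, 'x) ring_scheme \<Rightarrow> ('r, 'm) cochain \<Rightarrow> (int \<Rightarrow> 'm \<Rightarrow> 'm) \<Rightarrow> bool" where
  "homotopic_to_id R C f \<longleftrightarrow>
    (\<exists>h. (\<forall>i. h i \<in> left_module_hom R (obj C i) (obj C (i - 1))) \<and>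
         (\<forall>i. \<forall>x\<in>carrier (obj C i).
            f i x = x \<oplus>\<^bsub>obj C i\<^esub> (diff C (i - 1) (h i x) \<oplus>\<^bsub>obj C i\<^esub> h (i + 1) (diff C i x))))"

definition homotopy_equivalent ::
    "('r, 'x) ring_scheme \<Rightarrow> ('r, 'm) cochain \<Rightarrow> ('r, 'n) cochain \<Rightarrow> bool" where
  "homotopy_equivalent R C D \<longleftrightarrow>
    (\<exists>f g. chain_map R C D f \<and> chain_map R D C g \<and>
       homotopic_to_id R C (\<lambda>i. g i \<circ> f i) \<and> homotopic_to_id R D (\<lambda>i. f i \<circ> g i))"


section \<open>Matrices and linear parts\<close>

definition coord ::
    "('r, 'x) ring_scheme \<Rightarrow> ('r, 'm, 'y) module_scheme \<Rightarrow> 'm set \<Rightarrow> 'm \<Rightarrow> 'm \<Rightarrow> 'r" where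
  "coord R M B x = (THE c. c \<in> finite_coeffs R B \<and> lin_comb R M c = x)"

text \<open>
  Row convention, as appropriate for left modules: the entry \<open>A b b'\<close> of the matrix of \<open>f\<close> is the
  coefficient of \<open>b'\<close> in \<open>f b\<close>, so that \<open>f (\<Sum> x\<^sub>b b) = \<Sum> x\<^sub>b A\<^sub>b\<^sub>b\<^sub>' b'\<close>.
\<close>

definition matrix_of ::
    "('r, 'x) ring_scheme \<Rightarrow> ('r, 'n, 'z) module_scheme \<Rightarrow> 'n set \<Rightarrow> ('m \<Rightarrow> 'n) \<Rightarrow> 'm \<Rightarrow> 'n \<Rightarrow> 'r"
  where
  "matrix_of R N B' f b b' = coord R N B' (f b) b'"

definition map_of_matrix ::
    "('r, 'x) ring_scheme \<Rightarrow> ('r, 'm, 'y) module_scheme \<Rightarrow> 'm set \<Rightarrow> ('r, 'n, 'z) module_scheme \<Rightarrow>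
      ('m \<Rightarrow> 'n \<Rightarrow> 'r) \<Rightarrow> 'm \<Rightarrow> 'n" where
  "map_of_matrix R M B N A x =
    (\<Oplus>\<^bsub>N\<^esub>b\<in>{b. coord R M B x b \<noteq> \<zero>\<^bsub>R\<^esub>}. coord R M B x b \<odot>\<^bsub>N\<^esub> lin_comb R N (A b))"

text \<open>\<open>G\<close> is a free complex over \<open>\<And> V\<close> with chosen bases \<open>B i\<close> exhibiting its minimality.\<close>

definition minimal_free_wrt ::
    "('k::field \<Rightarrow> 'v::ab_group_add \<Rightarrow> 'v) \<Rightarrow> (('v list \<Rightarrow> 'k) set, 'm) cochain \<Rightarrow>
      (int \<Rightarrow> 'm set) \<Rightarrow> bool" where
  "minimal_free_wrt scale G B \<longleftrightarrow>
    is_cochain (exterior_algebra scale) G \<and>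
    (\<forall>i. is_basis (exterior_algebra scale) (obj G i) (B i)) \<and>
    (\<forall>i. \<forall>b\<in>B i. \<forall>b'\<in>B (i + 1).
       matrix_of (exterior_algebra scale) (obj G (i + 1)) (B (i + 1)) (diff G i) b b'
         \<in> exterior_max_ideal scale)"

definition lin_wrt ::
    "('k::field \<Rightarrow> 'v::ab_group_add \<Rightarrow> 'v) \<Rightarrow> (int \<Rightarrow> 'm set) \<Rightarrow>
      (('v list \<Rightarrow> 'k) set, 'm) cochain \<Rightarrow> (('v list \<Rightarrow> 'k) set, 'm) cochain" where
  "lin_wrt scale B G =
    \<lparr>obj = obj G,
     diff = (\<lambda>i. map_of_matrix (exterior_algebra scale) (obj G i) (B i) (obj G (i + 1))
       (\<lambda>b b'. exterior_component scale 1
          (matrix_of (exterior_algebra scale) (obj G (i + 1)) (B (i + 1)) (diff G i) b b')))\<rparr>"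

text \<open>
  The linear part of \<open>F\<close> is determined only up to isomorphism of complexes: it depends on a minimal
  free complex \<open>G\<close> homotopy equivalent to \<open>F\<close> and on bases of its terms. Hence a relation: \<open>L\<close> is
  a linear part of \<open>F\<close>.
\<close>

definition is_linear_part ::
    "('k::field \<Rightarrow> 'v::ab_group_add \<Rightarrow> 'v) \<Rightarrow> (('v list \<Rightarrow> 'k) set, 'm) cochain \<Rightarrow>
      (('v list \<Rightarrow> 'k) set, 'n) cochain \<Rightarrow> bool" where
  "is_linear_part scale F L \<longleftrightarrow>
    (\<exists>G B. minimal_free_wrt scale G B \<and>
       homotopy_equivalent (exterior_algebra scale) F G \<and> L = lin_wrt scale B G)"

end

(*
A minimal free complex over E has terms E (x) H^i, and the linear part of its differential is
sum_j e_j (x) x_j for commuting operators x_j : H^i -> H^(i+1), so that lin(F) is a Koszul complex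
of the graded module H over S = K[x_1, ..., x_n]. The homology of lin(F) vanishes eventually as soon
as every graded submodule of E (x) H is eventually generated in the next lower degree: S acts by zero
on the homology of a Koszul complex (contraction is the null homotopy), so the cocycles Z satisfy
Z^(i+1) = sum_j x_j Z^i, which consists of coboundaries.

This finiteness is obtained by induction on the number of variables. The commutators T_j = [c_j, d] of
the differential with the contractions lift the x_j. If Q_m is the subcomplex annihilated by
e_1, ..., e_m, then T_(m+1) is the connecting map of 0 -> Q_(m+1) -> Q_m -> Q_(m+1) -> 0, so
H(Q_(m+1)) modulo T_(m+1) embeds into H(Q_m), and Hilbert's basis argument applies. It starts with
Q_0 = F, whose cohomology vanishes eventually, and ends with Q_n, the socle, on which d = 0.

For injective resolutions the submodules are generated upwards; for free resolutions all arrows are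
reversed, with the quotients F / (e_1, ..., e_m)F in place of Q_m. In both cases a minimal complex
homotopy equivalent to the resolution vanishes on one side and has terms of finite rank.
*)

theory Submission
  imports Defs "HOL-Library.Function_Algebras"
begin

section \<open>Noetherian and Artinian graded subquotients\<close>

text \<open>Two obstacles shape the argument. The operators \<open>T j\<close> commute only up to a
  homotopy, so they generate a commutative action on homology alone. Finiteness is therefore stated
  for pairs of subspaces, with operators that preserve both members and commute modulo the smaller
  one; neither quotients nor a polynomial ring are formed. As all terms are finite-dimensional,
  finite generation becomes the condition that high degrees are generated from the degree just
  below. The second obstacle is that exactness is known for d but wanted for its linear part l. The
  two are compared only where their difference is invisible: on the socle Q_n, respectively modulo
  the maximal ideal, the commutators of d and of l with the contractions agree. Finiteness for d is
  pushed to that end of the filtration, exchanged there for finiteness for l, and carried back to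
  the full complex layer by layer. On the way back only the operators obtained from l occur, which
  anticommute with the \<open>e m\<close> and so respect the layers.\<close>

context vector_space
begin

section \<open>Stabilisation of chains of finite-dimensional subspaces\<close>

definition finite_dim :: "'b set \<Rightarrow> bool" where
  "finite_dim V \<longleftrightarrow> (\<exists>S. finite S \<and> V \<subseteq> span S)"

lemma finite_dim_subset: "finite_dim V \<Longrightarrow> U \<subseteq> V \<Longrightarrow> finite_dim U"
  unfolding finite_dim_def by blast

lemma finite_dim_basis:
  assumes "finite_dim V"
  obtains B where "finite B" "B \<subseteq> V" "independent B" "V \<subseteq> span B" "card B = dim V"
proof -
  obtain S where S: "finite S" "V \<subseteq> span S" using assms unfolding finite_dim_def by blast
  obtain B where B: "B \<subseteq> V" "independent B" "V \<subseteq> span B" "card B = dim V"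
    using basis_exists by blast
  have "finite B" using independent_span_bound[OF S(1) B(2)] B(1) S(2) by blast
  with B show ?thesis using that by blast
qed

text \<open>A basis of U must span V: a vector of V outside its span would enlarge it to an
  independent set with more elements than a basis of V. Finiteness is asked of V and not of the
  ambient space, which later is a space of families containing all terms of a complex.\<close>

lemma subspace_eq_of_dim_le:
  assumes "subspace U" "U \<subseteq> V" "finite_dim V" "dim V \<le> dim U"
  shows "U = V"
proof -
  have "finite_dim U" using assms finite_dim_subset by blast
  then obtain B where B: "finite B" "B \<subseteq> U" "independent B" "U \<subseteq> span B" "card B = dim U"
    using finite_dim_basis by blast
  obtain C where C: "finite C" "C \<subseteq> V" "independent C" "V \<subseteq> span C" "card C = dim V"
    using finite_dim_basis[OF assms(3)] by blast
  have "v \<in> span B" if v: "v \<in> V" for v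
  proof (rule ccontr)
    assume nv: "v \<notin> span B"
    then have ind: "independent (insert v B)" using B(3) independent_insert by simp
    have "v \<notin> B" using nv span_base by blast
    then have "card (insert v B) = Suc (card B)" using B(1) by simp
    moreover have "insert v B \<subseteq> span C" using v B(2) assms(2) C(4) by blast
    ultimately have "Suc (card B) \<le> card C" using independent_span_bound[OF C(1) ind] by simp
    then show False using B(5) C(5) assms(4) by simp
  qed
  moreover have "span B \<subseteq> U" using span_minimal[OF B(2) assms(1)] .
  ultimately show ?thesis using assms(2) by blast
qed

lemma dim_mono_finite_dim: "finite_dim V \<Longrightarrow> U \<subseteq> V \<Longrightarrow> dim U \<le> dim V"
  by (metis dim_le_card finite_dim_basis order_trans)

lemma finite_dim_incseq_stable:
  fixes U :: "nat \<Rightarrow> 'b set"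
  assumes sub: "\<And>r. subspace (U r)" and le: "\<And>r. U r \<subseteq> U (Suc r)"
    and V: "finite_dim V" and UV: "\<And>r. U r \<subseteq> V"
  shows "\<exists>R. \<forall>r\<ge>R. U r = U R"
proof -
  have mono: "r \<le> r' \<Longrightarrow> U r \<subseteq> U r'" for r r' using le by (rule lift_Suc_mono_le)
  have "dim (U r) \<le> dim V" for r using dim_mono_finite_dim V UV by blast
  then have "dim (U r) < Suc (dim V)" for r by (simp add: le_imp_less_Suc)
  then obtain R where R: "\<forall>r. dim (U r) \<le> dim (U R)"
    using ex_has_greatest_nat[of "\<lambda>_. True" 0 "\<lambda>r. dim (U r)" "Suc (dim V)"] by blast
  have "U R = U r" if "r \<ge> R" for r
    using subspace_eq_of_dim_le[OF sub mono[OF that]] finite_dim_subset[OF V UV] R by blast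
  then show ?thesis by blast
qed

lemma finite_dim_decseq_stable:
  fixes U :: "nat \<Rightarrow> 'b set"
  assumes sub: "\<And>r. subspace (U r)" and le: "\<And>r. U (Suc r) \<subseteq> U r"
    and V: "finite_dim V" and UV: "\<And>r. U r \<subseteq> V"
  shows "\<exists>R. \<forall>r\<ge>R. U r = U R"
proof -
  have mono: "r \<le> r' \<Longrightarrow> U r' \<subseteq> U r" for r r' using le by (rule lift_Suc_antimono_le)
  obtain R where R: "\<forall>r. dim (U R) \<le> dim (U r)"
    using ex_has_least_nat[of "\<lambda>_. True" 0 "\<lambda>r. dim (U r)"] by blast
  have "U r = U R" if "r \<ge> R" for r
    using subspace_eq_of_dim_le[OF sub mono[OF that]] finite_dim_subset[OF V UV] R by blast
  then show ?thesis by blast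
qed

text \<open>Subquotients \<open>Z / B\<close> of graded vector spaces are handled as pairs. The operators \<open>T 0, \<dots>, T (m - 1)\<close>
  raise the degree by one in \<open>noetherian_pair\<close> and lower it by one in \<open>artinian_pair\<close>; the two
  notions are dual to each other.\<close>

definition noetherian_pair ::
    "nat \<Rightarrow> (nat \<Rightarrow> 'b \<Rightarrow> 'b) \<Rightarrow> (nat \<Rightarrow> 'b set) \<Rightarrow> (nat \<Rightarrow> 'b set) \<Rightarrow> bool" where
  "noetherian_pair m T Z B \<longleftrightarrow>
    (\<forall>U. (\<forall>k. subspace (U k)) \<and> (\<forall>k. \<forall>j<m. \<forall>u\<in>U k. T j u \<in> U (Suc k)) \<and>
         (\<forall>k. B k \<subseteq> U k \<and> U k \<subseteq> Z k) \<longrightarrow>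
      (\<exists>N. \<forall>k\<ge>N. \<forall>u\<in>U (Suc k). \<exists>b\<in>B (Suc k). \<exists>v. (\<forall>j<m. v j \<in> U k) \<and> u = b + (\<Sum>j<m. T j (v j))))"

definition artinian_pair ::
    "nat \<Rightarrow> (nat \<Rightarrow> 'b \<Rightarrow> 'b) \<Rightarrow> (nat \<Rightarrow> 'b set) \<Rightarrow> (nat \<Rightarrow> 'b set) \<Rightarrow> bool" where
  "artinian_pair m T Z B \<longleftrightarrow>
    (\<forall>U. (\<forall>k. subspace (U k)) \<and> (\<forall>k. \<forall>j<m. \<forall>u\<in>U (Suc k). T j u \<in> U k) \<and>
         (\<forall>k. B k \<subseteq> U k \<and> U k \<subseteq> Z k) \<longrightarrow>
      (\<exists>N. \<forall>k\<ge>N. \<forall>z\<in>Z (Suc k). (\<forall>j<m. T j z \<in> U k) \<longrightarrow> z \<in> U (Suc k)))"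

lemma noetherian_pairD:
  assumes "noetherian_pair m T Z B" "\<And>k. subspace (U k)"
    "\<And>k j u. j < m \<Longrightarrow> u \<in> U k \<Longrightarrow> T j u \<in> U (Suc k)"
    "\<And>k. B k \<subseteq> U k" "\<And>k. U k \<subseteq> Z k"
  obtains N where "\<And>k u. N \<le> k \<Longrightarrow> u \<in> U (Suc k) \<Longrightarrow>
    \<exists>b\<in>B (Suc k). \<exists>v. (\<forall>j<m. v j \<in> U k) \<and> u = b + (\<Sum>j<m. T j (v j))"
  using assms(1)[unfolded noetherian_pair_def, rule_format, of U] assms(2-) by blast

lemma artinian_pairD:
  assumes "artinian_pair m T Z B" "\<And>k. subspace (U k)"
    "\<And>k j u. j < m \<Longrightarrow> u \<in> U (Suc k) \<Longrightarrow> T j u \<in> U k"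
    "\<And>k. B k \<subseteq> U k" "\<And>k. U k \<subseteq> Z k"
  obtains N where "\<And>k z. N \<le> k \<Longrightarrow> z \<in> Z (Suc k) \<Longrightarrow> (\<And>j. j < m \<Longrightarrow> T j z \<in> U k) \<Longrightarrow> z \<in> U (Suc k)"
  using assms(1)[unfolded artinian_pair_def, rule_format, of U] assms(2-) by blast

text \<open>Serves three constructions of the form f(A) + C: the multiples of an operator modulo
  boundaries, the ideals \<open>ideal_part\<close>, and the boundaries of a complex modulo such an
  ideal.\<close>

lemma subspace_plus_image:
  assumes "subspace A" "subspace C" "module_hom scale scale f"
  shows "subspace {f w + b | w b. w \<in> A \<and> b \<in> C}"
proof -
  interpret f: module_hom scale scale f by fact
  have "subspace (f ` A)" using f.subspace_image assms(1) .
  from subspace_sums[OF this assms(2)]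
  have "subspace {x + y |x y. x \<in> f ` A \<and> y \<in> C}" .
  also have "{x + y |x y. x \<in> f ` A \<and> y \<in> C} = {f w + b | w b. w \<in> A \<and> b \<in> C}" by blast
  finally show ?thesis .
qed

lemma finite_uniform_bound:
  assumes "\<And>k::nat. k \<le> N \<Longrightarrow> \<exists>R::nat. \<forall>r\<ge>R. P k r"
  shows "\<exists>R. \<forall>k\<le>N. \<forall>r\<ge>R. P k r"
proof -
  obtain f where f: "\<And>k r. k \<le> N \<Longrightarrow> r \<ge> f k \<Longrightarrow> P k r" using assms by metis
  have "\<forall>k\<le>N. \<forall>r\<ge>Max (f ` {..N}). P k r" using f by (auto intro!: f)
  then show ?thesis by blast
qed

text \<open>As in Hilbert's basis theorem, for \<open>x = T m\<close> the set \<open>L r\<close> in the proof consists of the leading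
  coefficients modulo \<open>Y\<close> of those elements of \<open>U\<close> that are divisible by \<open>x ^ r\<close>; these sets increase
  with \<open>r\<close> and stabilise uniformly in the degree.\<close>

lemma noetherian_pair_Suc:
  fixes m :: nat and T :: "nat \<Rightarrow> 'b \<Rightarrow> 'b"
  assumes lin: "\<And>j. j \<le> m \<Longrightarrow> module_hom scale scale (T j)"
    and subW: "\<And>k. subspace (W k)" and subB: "\<And>k. subspace (B k)"
    and BW: "\<And>k. B k \<subseteq> W k"
    and TW: "\<And>j k w. j \<le> m \<Longrightarrow> w \<in> W k \<Longrightarrow> T j w \<in> W (Suc k)"
    and TB: "\<And>j k w. j \<le> m \<Longrightarrow> w \<in> B k \<Longrightarrow> T j w \<in> B (Suc k)"
    and comm: "\<And>j k w. j < m \<Longrightarrow> w \<in> W k \<Longrightarrow> T j (T m w) - T m (T j w) \<in> B (Suc (Suc k))"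
    and fd: "\<And>k. finite_dim (W k)"
    and Y0: "Y 0 = B 0" and YS: "\<And>k. Y (Suc k) = {T m w + b | w b. w \<in> W k \<and> b \<in> B (Suc k)}"
    and noeth: "noetherian_pair m T W Y"
  shows "noetherian_pair (Suc m) T W B"
  unfolding noetherian_pair_def
proof (intro allI impI, elim conjE)
  fix U :: "nat \<Rightarrow> 'b set"
  assume subU: "\<forall>k. subspace (U k)" and TU0: "\<forall>k. \<forall>j<Suc m. \<forall>u\<in>U k. T j u \<in> U (Suc k)"
    and BUW: "\<forall>k. B k \<subseteq> U k \<and> U k \<subseteq> W k"
  have TU: "\<And>j k u. j \<le> m \<Longrightarrow> u \<in> U k \<Longrightarrow> T j u \<in> U (Suc k)" using TU0 by (simp add: less_Suc_eq_le)
  have BU: "\<And>k b. b \<in> B k \<Longrightarrow> b \<in> U k" and UW: "\<And>k u. u \<in> U k \<Longrightarrow> u \<in> W k" using BUW by blast+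
  define x where "x = T m"
  interpret x: module_hom scale scale x unfolding x_def using lin by simp
  have Th: "module_hom scale scale (T j)" if "j < m" for j using lin that by simp
  have Tadd: "T j (a + c) = T j a + T j c" and Tzero: "T j 0 = 0" if "j < Suc m" for j a c
    using module_hom.add[OF lin] module_hom.zero[OF lin] that by (simp_all add: less_Suc_eq_le)
  have xpow: "module_hom scale scale (x ^^ r)" for r
  proof (induction r)
    case 0 show ?case by unfold_locales simp_all
  next
    case (Suc r) show ?case unfolding funpow.simps by (rule module_hom_compose[OF Suc x.module_hom_axioms])
  qed
  have xpW: "w \<in> W k \<Longrightarrow> (x ^^ r) w \<in> W (k + r)" for w k r
    by (induction r) (auto simp: x_def TW)
  have xpU: "w \<in> U k \<Longrightarrow> (x ^^ r) w \<in> U (k + r)" for w k r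
    by (induction r) (auto simp: x_def TU)
  have xpB: "w \<in> B k \<Longrightarrow> (x ^^ r) w \<in> B (k + r)" for w k r
    by (induction r) (auto simp: x_def TB)
  \<comment> \<open>A single commutator is only known to lie in \<open>B\<close>. As
    \<open>B\<close> is stable under x, every power of x still commutes with \<open>T j\<close> up
    to \<open>B\<close>, and these errors are harmless because \<open>B\<close> is contained in
    \<open>U\<close>.\<close>
  have xcomm: "(x ^^ r) (T j w) - T j ((x ^^ r) w) \<in> B (Suc (k + r))" if j: "j < m" and w: "w \<in> W k" for r j w k
  proof (induction r)
    case 0 then show ?case using subspace_0[OF subB] by simp
  next
    case (Suc r)
    let ?w = "(x ^^ r) w"
    have "x ((x ^^ r) (T j w) - T j ?w) \<in> B (Suc (Suc (k + r)))"
      using TB[OF order_refl Suc] by (simp add: x_def)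
    moreover have "T j (x ?w) - x (T j ?w) \<in> B (Suc (Suc (k + r)))"
      unfolding x_def[of ] using comm[OF j xpW[OF w, of r]] by (simp add: x_def)
    ultimately have "x ((x ^^ r) (T j w) - T j ?w) - (T j (x ?w) - x (T j ?w)) \<in> B (Suc (Suc (k + r)))"
      using subspace_diff subB by blast
    then show ?case by (simp add: x.diff)
  qed
  \<comment> \<open>\<open>Y\<close> is x W + B, shifted to the right degree, so
    \<open>W / Y\<close> is the quotient of \<open>W / B\<close> by x; \<open>noeth\<close> speaks
    of the remaining operators on this quotient.\<close>
  have subY: "subspace (Y k)" for k
  proof (cases k)
    case (Suc k')
    then show ?thesis using subspace_plus_image[OF subW subB lin[OF order_refl]] YS by simp
  qed (simp add: Y0 subB)
  have YE: "b \<in> B 0" if "b \<in> Y 0" for b using that Y0 by simp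
  have BY: "b \<in> Y k" if "b \<in> B k" for b k
  proof (cases k)
    case (Suc k')
    have "b = T m 0 + b" using x.zero by (simp add: x_def)
    then show ?thesis using that Suc YS subspace_0[OF subW] by blast
  qed (use that Y0 in simp)
  have YW: "Y k \<subseteq> W k" for k
  proof (cases k)
    case (Suc k')
    show ?thesis
    proof
      fix y assume "y \<in> Y k"
      then obtain w b where "w \<in> W k'" "b \<in> B (Suc k')" "y = T m w + b" using YS Suc by blast
      then show "y \<in> W k" using Suc BW TW[of m w k'] subspace_add[OF subW] by blast
    qed
  qed (simp add: Y0 BW)
  have TY: "T j y \<in> Y (Suc k)" if j: "j < m" and y: "y \<in> Y k" for j y k
  proof (cases k)
    case 0
    then show ?thesis using BY TB j y Y0 by simp
  next
    case (Suc k')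
    then obtain w b where w: "w \<in> W k'" "b \<in> B k" "y = T m w + b" using y YS by blast
    interpret T: module_hom scale scale "T j" using Th j .
    have "T j y = T m (T j w) + ((T j (T m w) - T m (T j w)) + T j b)" using w T.add by simp
    moreover have "(T j (T m w) - T m (T j w)) + T j b \<in> B (Suc k)"
      using comm[OF j w(1)] TB[OF _ w(2), of j] j Suc subspace_add[OF subB] by simp
    moreover have "T j w \<in> W k" using TW w(1) j Suc by simp
    ultimately show ?thesis using YS by blast
  qed
  \<comment> \<open>The correction y makes w count only modulo \<open>Y\<close>: up to
    \<open>B\<close>, changing w by a multiple of x changes \<open>(x ^^ r) w\<close> by a multiple
    of \<open>x ^^ Suc r\<close>, that is, by terms treated in a later round.\<close>
  define L where "L r k = {w \<in> W k. \<exists>y\<in>Y k. (x ^^ r) (w - y) \<in> U (k + r)}" for r k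
  have subL: "subspace (L r k)" for r k
  proof -
    interpret xr: module_hom scale scale "x ^^ r" by (rule xpow)
    show ?thesis
    proof (rule subspaceI)
      show "0 \<in> L r k" unfolding L_def using subspace_0 subW subY subU xr.zero by force
    next
      fix a b assume "a \<in> L r k" "b \<in> L r k"
      then obtain y z where *: "a \<in> W k" "b \<in> W k" "y \<in> Y k" "z \<in> Y k"
        "(x ^^ r) (a - y) \<in> U (k + r)" "(x ^^ r) (b - z) \<in> U (k + r)" unfolding L_def by blast
      have "(x ^^ r) ((a + b) - (y + z)) = (x ^^ r) (a - y) + (x ^^ r) (b - z)"
        by (simp add: xr.add[symmetric] algebra_simps)
      then have "(x ^^ r) ((a + b) - (y + z)) \<in> U (k + r)" using * subspace_add subU by simp
      then show "a + b \<in> L r k" unfolding L_def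
        using subspace_add[OF subW *(1,2)] subspace_add[OF subY *(3,4)] by blast
    next
      fix c a assume "a \<in> L r k"
      then obtain y where *: "a \<in> W k" "y \<in> Y k" "(x ^^ r) (a - y) \<in> U (k + r)" unfolding L_def by blast
      have "(x ^^ r) (c *s a - c *s y) = c *s (x ^^ r) (a - y)"
        by (simp add: xr.scale[symmetric] scale_right_diff_distrib)
      then have "(x ^^ r) (c *s a - c *s y) \<in> U (k + r)" using * subspace_scale subU by simp
      then show "c *s a \<in> L r k" unfolding L_def
        using subspace_scale[OF subW *(1), of c] subspace_scale[OF subY *(2), of c] by blast
    qed
  qed
  have LW: "L r k \<subseteq> W k" for r k unfolding L_def by blast
  have YL: "Y k \<subseteq> L r k" for r k
  proof
    fix y assume y: "y \<in> Y k"
    interpret xr: module_hom scale scale "x ^^ r" by (rule xpow)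
    have "(x ^^ r) (y - y) \<in> U (k + r)" using subspace_0 subU by simp
    then show "y \<in> L r k" unfolding L_def using y YW by blast
  qed
  have TL: "T j w \<in> L r (Suc k)" if j: "j < m" and w: "w \<in> L r k" for j w r k
  proof -
    obtain y where y: "w \<in> W k" "y \<in> Y k" "(x ^^ r) (w - y) \<in> U (k + r)" using w unfolding L_def by blast
    interpret T: module_hom scale scale "T j" using Th j .
    have wy: "w - y \<in> W k" using y YW subspace_diff subW by blast
    have "(x ^^ r) (T j (w - y)) - T j ((x ^^ r) (w - y)) \<in> U (Suc (k + r))"
      using xcomm[OF j wy] BU by blast
    moreover have "T j ((x ^^ r) (w - y)) \<in> U (Suc (k + r))" using TU[of j] j y(3) by simp
    ultimately have "(x ^^ r) (T j (w - y)) \<in> U (Suc k + r)"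
      using subspace_add subU by fastforce
    then have "(x ^^ r) (T j w - T j y) \<in> U (Suc k + r)" by (simp add: T.diff)
    then show ?thesis unfolding L_def using TY[OF j y(2)] TW[of j] j y(1) by auto
  qed
  have Lmono: "L r k \<subseteq> L (Suc r) k" for r k
  proof
    fix w assume "w \<in> L r k"
    then obtain y where y: "w \<in> W k" "y \<in> Y k" "(x ^^ r) (w - y) \<in> U (k + r)" unfolding L_def by blast
    then have "(x ^^ Suc r) (w - y) \<in> U (k + Suc r)" using TU[OF order_refl y(3)] by (simp add: x_def)
    then show "w \<in> L (Suc r) k" unfolding L_def using y by blast
  qed
  then have Lmono': "r \<le> r' \<Longrightarrow> L r k \<subseteq> L r' k" for r r' k
    by (rule lift_Suc_mono_le[of "\<lambda>r. L r k"])
  have Lstab: "\<exists>R. \<forall>r\<ge>R. L r k = L R k" for k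
    by (rule finite_dim_incseq_stable[of "\<lambda>r. L r k" "W k"]) (use subL Lmono fd LW in blast)+
  define Li where "Li k = (\<Union>r. L r k)" for k
  have Li: "\<exists>R. \<forall>r\<ge>R. L r k = Li k" for k
  proof -
    obtain R where R: "\<forall>r\<ge>R. L r k = L R k" using Lstab by blast
    have "L r k \<subseteq> L R k" for r using R Lmono'[of r "max r R"] by (metis max.cobounded1 max.cobounded2)
    then have "Li k = L R k" unfolding Li_def by blast
    then show ?thesis using R by blast
  qed
  have subLi: "subspace (Li k)" for k using Li subL by (metis order_refl)
  have decomp: "\<exists>y\<in>Y (Suc k). \<exists>v. (\<forall>j<m. v j \<in> L r k) \<and> w = y + (\<Sum>j<m. T j (v j))
      \<Longrightarrow> w \<in> L r (Suc k)" for w r k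
  proof -
    assume "\<exists>y\<in>Y (Suc k). \<exists>v. (\<forall>j<m. v j \<in> L r k) \<and> w = y + (\<Sum>j<m. T j (v j))"
    then obtain y v where yv: "y \<in> Y (Suc k)" "\<And>j. j < m \<Longrightarrow> v j \<in> L r k" "w = y + (\<Sum>j<m. T j (v j))" by blast
    have "(\<Sum>j<m. T j (v j)) \<in> L r (Suc k)" using TL yv(2) by (intro subspace_sum[OF subL]) simp
    then show "w \<in> L r (Suc k)" using subspace_add[OF subL, of y] yv(1,3) YL by blast
  qed
  \<comment> \<open>Beyond degree N the limit is generated from the degree below modulo
    \<open>Y\<close>, so equality \<open>L r = Li\<close> propagates upwards from degree N. Together
    with stabilisation in the finitely many degrees up to N this yields one exponent R for all
    degrees.\<close>
  obtain N where N: "\<And>k u. N \<le> k \<Longrightarrow> u \<in> Li (Suc k) \<Longrightarrow>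
    \<exists>b\<in>Y (Suc k). \<exists>v. (\<forall>j<m. v j \<in> Li k) \<and> u = b + (\<Sum>j<m. T j (v j))"
  proof (rule noetherian_pairD[OF noeth subLi])
    show "\<And>k j u. j < m \<Longrightarrow> u \<in> Li k \<Longrightarrow> T j u \<in> Li (Suc k)" unfolding Li_def using TL by blast
    show "\<And>k. Y k \<subseteq> Li k" unfolding Li_def using YL by blast
    show "\<And>k. Li k \<subseteq> W k" unfolding Li_def using LW by blast
  qed blast
  obtain R where R: "\<forall>k\<le>N. \<forall>r\<ge>R. L r k = Li k"
    using finite_uniform_bound[of N "\<lambda>k r. L r k = Li k"] Li by blast
  have LR: "L r k = Li k" if r: "r \<ge> R" for r k
  proof (induction k)
    case 0 then show ?case using R r by simp
  next
    case (Suc k)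
    show ?case
    proof (cases "Suc k \<le> N")
      case True then show ?thesis using R r by blast
    next
      case False
      then have "Li (Suc k) \<subseteq> L r (Suc k)" using N[of k] decomp[of k r] Suc by (metis not_less_eq_eq subsetI)
      then show ?thesis unfolding Li_def by blast
    qed
  qed
  have "\<exists>N. \<forall>k\<ge>N. \<forall>u. u \<in> L r (Suc k) \<longrightarrow> (\<exists>b\<in>Y (Suc k). \<exists>v. (\<forall>j<m. v j \<in> L r k) \<and> u = b + (\<Sum>j<m. T j (v j)))" for r
    by (rule noetherian_pairD[of m T W Y "L r", OF noeth subL TL YL LW]) blast+
  then obtain N' where N': "\<And>r k u. r \<le> R \<Longrightarrow> k \<ge> N' \<Longrightarrow> u \<in> L r (Suc k) \<Longrightarrow>
      \<exists>b\<in>Y (Suc k). \<exists>v. (\<forall>j<m. v j \<in> L r k) \<and> u = b + (\<Sum>j<m. T j (v j))"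
    using finite_uniform_bound[of R "\<lambda>r k. \<forall>u. u \<in> L r (Suc k) \<longrightarrow> (\<exists>b\<in>Y (Suc k). \<exists>v. (\<forall>j<m. v j \<in> L r k) \<and> u = b + (\<Sum>j<m. T j (v j)))"]
    by blast
  have "\<exists>b\<in>B (Suc K). \<exists>v. (\<forall>j<Suc m. v j \<in> U K) \<and> u = b + (\<Sum>j<Suc m. T j (v j))"
    if K: "K \<ge> N' + R" and u: "u \<in> U (Suc K)" for K u
  proof -
    \<comment> \<open>These are the elements generated from degree K. As \<open>S\<close> is closed
      under addition, it suffices to split summands in \<open>S\<close> off u until nothing
      remains.\<close>
    define S where "S = {u. \<exists>b\<in>B (Suc K). \<exists>v. (\<forall>j<Suc m. v j \<in> U K) \<and> u = b + (\<Sum>j<Suc m. T j (v j))}"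
    have S_add: "a + c \<in> S" if ac: "a \<in> S" "c \<in> S" for a c
    proof -
      obtain b v where 1: "b \<in> B (Suc K)" "\<forall>j<Suc m. v j \<in> U K" "a = b + (\<Sum>j<Suc m. T j (v j))"
        using ac(1) unfolding S_def by blast
      obtain b' v' where 2: "b' \<in> B (Suc K)" "\<forall>j<Suc m. v' j \<in> U K" "c = b' + (\<Sum>j<Suc m. T j (v' j))"
        using ac(2) unfolding S_def by blast
      have "(\<Sum>j<Suc m. T j (v j + v' j)) = (\<Sum>j<Suc m. T j (v j)) + (\<Sum>j<Suc m. T j (v' j))"
        unfolding sum.distrib[symmetric] using Tadd by (intro sum.cong) simp_all
      then have "a + c = (b + b') + (\<Sum>j<Suc m. T j (v j + v' j))" using 1 2 by (simp add: algebra_simps)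
      moreover have "\<forall>j<Suc m. v j + v' j \<in> U K" using 1 2 subspace_add subU by blast
      ultimately show ?thesis unfolding S_def using subspace_add[OF subB 1(1) 2(1)]
        by (intro CollectI bexI[of _ "b + b'"] exI[of _ "\<lambda>j. v j + v' j"]) blast+
    qed
    have SB: "b \<in> S" if "b \<in> B (Suc K)" for b
    proof -
      have "(\<Sum>j<Suc m. T j 0) = 0" using Tzero by (intro sum.neutral) simp
      then have "b = b + (\<Sum>j<Suc m. T j 0)" by simp
      moreover have "\<forall>j<Suc m. 0 \<in> U K" using subspace_0 subU by blast
      ultimately show ?thesis unfolding S_def using that by (intro CollectI bexI[of _ b] exI[of _ "\<lambda>_. 0"]) blast+
    qed
    have ST: "T j w \<in> S" if "j \<le> m" "w \<in> U K" for j w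
    proof -
      have "T i (if i = j then w else 0) = (if i = j then T i w else 0)" if "i < Suc m" for i
        using Tzero that by simp
      then have "(\<Sum>i<Suc m. T i (if i = j then w else 0)) = (\<Sum>i<Suc m. if i = j then T i w else 0)" by simp
      also have "\<dots> = T j w" using that by simp
      finally have "T j w = 0 + (\<Sum>i<Suc m. T i (if i = j then w else 0))" by simp
      moreover have "\<forall>i<Suc m. (if i = j then w else 0) \<in> U K" using that(2) subspace_0 subU by simp
      ultimately show ?thesis unfolding S_def using subspace_0[OF subB]
        by (intro CollectI bexI[of _ 0] exI[of _ "\<lambda>i. if i = j then w else 0"]) blast+
    qed
    have SU: "s \<in> U (Suc K)" if s: "s \<in> S" for s
    proof -
      obtain b v where 1: "b \<in> B (Suc K)" "\<forall>j<Suc m. v j \<in> U K" "s = b + (\<Sum>j<Suc m. T j (v j))"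
        using s unfolding S_def by blast
      have "(\<Sum>j<Suc m. T j (v j)) \<in> U (Suc K)"
        by (rule subspace_sum) (use 1(2) TU subU in auto)
      then show ?thesis using BU[OF 1(1)] 1(3) subspace_add subU by blast
    qed
    have Ssum: "sum f A \<in> S" if "\<And>i. i \<in> A \<Longrightarrow> f i \<in> S" for f and A :: "nat set"
    proof -
      have "0 \<in> S" using SB subspace_0 subB by blast
      then show ?thesis using that by (induction A rule: infinite_finite_induct) (auto intro: S_add)
    qed
    \<comment> \<open>Invariant of the elimination: modulo \<open>S\<close>, u is a multiple of
      \<open>x ^^ r\<close>. The cofactor w loses one degree in each round, so r cannot pass Suc K
      and u ends in \<open>S\<close>.\<close>
    have "u \<in> S \<or> (r \<le> Suc K \<and> (\<exists>w\<in>W (Suc K - r). u - (x ^^ r) w \<in> S))" for r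
    proof (induction r)
      case 0
      have "u - (x ^^ 0) u \<in> S" using SB subspace_0 subB by simp
      moreover have "u \<in> W (Suc K - 0)" using u UW by simp
      ultimately show ?case by blast
    next
      case (Suc r)
      show ?case
      proof (cases "u \<in> S")
        case False
        then obtain w where r: "r \<le> Suc K" and w: "w \<in> W (Suc K - r)" "u - (x ^^ r) w \<in> S" using Suc by blast
        interpret xr: module_hom scale scale "x ^^ r" by (rule xpow)
        obtain k where k: "k = Suc K - r" by simp
        have kr: "k + r = Suc K" using k r by simp
        have xw: "(x ^^ r) w \<in> U (k + r)"
          using subspace_diff[OF _ u SU[OF w(2)]] subU kr by simp
        have wL: "w \<in> L r k" unfolding L_def using w(1) xw subspace_0[OF subY, of k] k by (auto intro!: bexI[of _ 0])
        \<comment> \<open>Once \<open>(x ^^ r) (w - y)\<close> is split off, what remains is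
          \<open>(x ^^ r) y\<close>, and y in \<open>Y\<close> supplies one more factor x up to
          \<open>B\<close>. In degree 0, y itself lies in \<open>B\<close> and the elimination is
          finished.\<close>
        have fin: ?thesis if y: "y \<in> Y k" and wy: "(x ^^ r) (w - y) \<in> S" for y
        proof -
          have uy: "u - (x ^^ r) y \<in> S" using S_add[OF w(2) wy] by (simp add: xr.diff)
          show ?thesis
          proof (cases k)
            case 0
            then have "(x ^^ r) y \<in> B (Suc K)" using y Y0 xpB[of y 0 r] kr by simp
            then have "u \<in> S" using S_add[OF uy SB[of "(x ^^ r) y"]] by simp
            then show ?thesis ..
          next
            case (Suc k')
            then obtain w' b where w': "w' \<in> W k'" "b \<in> B k" "y = T m w' + b" using y YS by blast
            have "(x ^^ r) b \<in> B (Suc K)" using w'(2) xpB[of b k r] kr by simp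
            then have "u - (x ^^ r) (T m w') \<in> S" using S_add[OF uy SB[of "(x ^^ r) b"]] w'(3) by (simp add: xr.add algebra_simps)
            then have "u - (x ^^ Suc r) w' \<in> S" by (simp add: x_def funpow_swap1)
            moreover have "Suc K - Suc r = k'" using Suc k by simp
            then have "w' \<in> W (Suc K - Suc r)" using w'(1) by simp
            ultimately show ?thesis using Suc kr by auto
          qed
        qed
        show ?thesis
        proof (cases "r \<le> R")
          case True
          \<comment> \<open>Degree count: k is Suc K - r, with r at most R and K at least N' + R. So
            k - 1 lies in the range where \<open>L r\<close> is generated from below modulo
            \<open>Y\<close>.\<close>
          have "k = Suc (k - 1)" "k - 1 \<ge> N'" using True K k by auto
          then obtain k' where k': "k = Suc k'" "k' \<ge> N'" by blast
          obtain y v where yv: "y \<in> Y k" "\<forall>j<m. v j \<in> L r k'" "w = y + (\<Sum>j<m. T j (v j))"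
            using N'[OF True k'(2), of w] wL k'(1) by blast
          have "\<forall>j<m. \<exists>z\<in>Y k'. (x ^^ r) (v j - z) \<in> U (k' + r)" using yv(2) unfolding L_def by blast
          then obtain z where z: "\<And>j. j < m \<Longrightarrow> z j \<in> Y k'" "\<And>j. j < m \<Longrightarrow> (x ^^ r) (v j - z j) \<in> U (k' + r)"
            by metis
          have vz: "v j - z j \<in> W k'" if "j < m" for j
            using that yv(2) LW z(1) YW subspace_diff[OF subW] by blast
          define y' where "y' = y + (\<Sum>j<m. T j (z j))"
          have y': "y' \<in> Y k" unfolding y'_def
            using yv(1) z(1) TY k'(1) by (auto intro!: subspace_add[OF subY] subspace_sum[OF subY])
          have "w - y' = (\<Sum>j<m. T j (v j - z j))"
            unfolding y'_def yv(3) using module_hom.diff[OF Th] by (simp add: sum_subtractf)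
          then have "(x ^^ r) (w - y') = (\<Sum>j<m. (x ^^ r) (T j (v j - z j)))" by (simp add: xr.sum)
          moreover have "(x ^^ r) (T j (v j - z j)) \<in> S" if j: "j < m" for j
          proof -
            have "Suc (k' + r) = Suc K" using kr k'(1) by simp
            then have "(x ^^ r) (T j (v j - z j)) - T j ((x ^^ r) (v j - z j)) \<in> S"
              using SB xcomm[OF j vz[OF j], of r] by simp
            moreover have "T j ((x ^^ r) (v j - z j)) \<in> S" using ST[of j] j z(2)[OF j] kr k'(1) by simp
            ultimately show ?thesis using S_add by fastforce
          qed
          ultimately have "(x ^^ r) (w - y') \<in> S" using Ssum[of "{..<m}" "\<lambda>j. (x ^^ r) (T j (v j - z j))"] by simp
          then show ?thesis using fin y' by blast
        next
          case False
          \<comment> \<open>For r > R the leading coefficient w already occurs at exponent R. Of the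
            r - R spare factors x, all but one keep the element inside \<open>U\<close> up to degree
            K; the last one puts it into \<open>S\<close>.\<close>
          then have "w \<in> L R k" using wL LR by simp
          then obtain y where y: "y \<in> Y k" "(x ^^ R) (w - y) \<in> U (k + R)" unfolding L_def by blast
          obtain q where q: "r = Suc (q + R)" using False using less_imp_Suc_add[of R r] by (auto simp: add.commute)
          have "k + R + q = K" using kr q by simp
          then have "(x ^^ q) ((x ^^ R) (w - y)) \<in> U K" using xpU[OF y(2), of q] by simp
          then have "T m ((x ^^ q) ((x ^^ R) (w - y))) \<in> S" using ST by blast
          then have "(x ^^ r) (w - y) \<in> S" by (simp add: q funpow_add x_def)
          then show ?thesis using fin y(1) by blast
        qed
      qed simp
    qed
    from this[of "Suc (Suc K)"] have "u \<in> S" by simp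
    then show ?thesis unfolding S_def by blast
  qed
  then show "\<exists>N. \<forall>k\<ge>N. \<forall>u\<in>U (Suc k). \<exists>b\<in>B (Suc k). \<exists>v. (\<forall>j<Suc m. v j \<in> U k) \<and> u = b + (\<Sum>j<Suc m. T j (v j))"
    by blast
qed

text \<open>Dually, \<open>L r\<close> is now the set of those elements of the kernel \<open>Y\<close> of \<open>x = T m\<close> that are \<open>x ^ r\<close>-multiples
  of elements of \<open>U\<close>, which decreases with \<open>r\<close>.\<close>

lemma artinian_pair_Suc:
  fixes m :: nat and T :: "nat \<Rightarrow> 'b \<Rightarrow> 'b"
  assumes lin: "\<And>j. j \<le> m \<Longrightarrow> module_hom scale scale (T j)"
    and subW: "\<And>k. subspace (W k)" and subB: "\<And>k. subspace (B k)"
    and BW: "\<And>k. B k \<subseteq> W k"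
    and T0: "\<And>j w. j \<le> m \<Longrightarrow> w \<in> W 0 \<Longrightarrow> T j w = 0"
    and TW: "\<And>j k w. j \<le> m \<Longrightarrow> w \<in> W (Suc k) \<Longrightarrow> T j w \<in> W k"
    and TB: "\<And>j k w. j \<le> m \<Longrightarrow> w \<in> B (Suc k) \<Longrightarrow> T j w \<in> B k"
    and comm: "\<And>j k w. j < m \<Longrightarrow> w \<in> W (Suc (Suc k)) \<Longrightarrow> T j (T m w) - T m (T j w) \<in> B k"
    and fd: "\<And>k. finite_dim (W k)"
    and Y0: "Y 0 = W 0" and YS: "\<And>k. Y (Suc k) = {w \<in> W (Suc k). T m w \<in> B k}"
    and art: "artinian_pair m T Y B"
  shows "artinian_pair (Suc m) T W B"
  unfolding artinian_pair_def
proof (intro allI impI, elim conjE)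
  fix U :: "nat \<Rightarrow> 'b set"
  assume subU: "\<forall>k. subspace (U k)" and TU0: "\<forall>k. \<forall>j<Suc m. \<forall>u\<in>U (Suc k). T j u \<in> U k"
    and BUW: "\<forall>k. B k \<subseteq> U k \<and> U k \<subseteq> W k"
  have TU: "\<And>j k u. j \<le> m \<Longrightarrow> u \<in> U (Suc k) \<Longrightarrow> T j u \<in> U k" using TU0 by (simp add: less_Suc_eq_le)
  have BU: "\<And>k b. b \<in> B k \<Longrightarrow> b \<in> U k" and UW: "\<And>k u. u \<in> U k \<Longrightarrow> u \<in> W k" using BUW by blast+
  define x where "x = T m"
  interpret x: module_hom scale scale x unfolding x_def using lin by simp
  have Th: "module_hom scale scale (T j)" if "j < m" for j using lin that by simp
  have xpow: "module_hom scale scale (x ^^ r)" for r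
  proof (induction r)
    case 0 show ?case by unfold_locales simp_all
  next
    case (Suc r) show ?case unfolding funpow.simps by (rule module_hom_compose[OF Suc x.module_hom_axioms])
  qed
  have xpW: "w \<in> W (k + r) \<Longrightarrow> (x ^^ r) w \<in> W k" for w k r
    by (induction r arbitrary: k) (auto simp: x_def TW)
  have xpU: "w \<in> U (k + r) \<Longrightarrow> (x ^^ r) w \<in> U k" for w k r
    by (induction r arbitrary: k) (auto simp: x_def TU)
  have xpB: "w \<in> B (k + r) \<Longrightarrow> (x ^^ r) w \<in> B k" for w k r
    by (induction r arbitrary: k) (auto simp: x_def TB)
  have xcomm: "(x ^^ r) (T j w) - T j ((x ^^ r) w) \<in> B k" if j: "j < m" and w: "w \<in> W (Suc (k + r))" for r j w k
    using w
  proof (induction r arbitrary: k)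
    case 0 then show ?case using subspace_0[OF subB] by simp
  next
    case (Suc r)
    let ?w = "(x ^^ r) w"
    have "x ((x ^^ r) (T j w) - T j ?w) \<in> B k"
      using TB[OF order_refl Suc.IH[of "Suc k"]] Suc.prems by (simp add: x_def)
    moreover have "T j (x ?w) - x (T j ?w) \<in> B k"
      using comm[OF j xpW[of w "Suc (Suc k)" r]] Suc.prems by (simp add: x_def)
    ultimately have "x ((x ^^ r) (T j w) - T j ?w) - (T j (x ?w) - x (T j ?w)) \<in> B k"
      using subspace_diff subB by blast
    then show ?case by (simp add: x.diff)
  qed
  have YW: "Y k \<subseteq> W k" for k by (cases k) (auto simp: Y0 YS)
  have BY: "b \<in> Y k" if "b \<in> B k" for b k
    by (cases k) (use that BW TB in \<open>auto simp: Y0 YS\<close>)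
  have TY: "T j y \<in> Y k" if j: "j < m" and y: "y \<in> Y (Suc k)" for j y k
  proof (cases k)
    case 0
    then show ?thesis using TW j y YS Y0 by simp
  next
    case (Suc k')
    have y': "y \<in> W (Suc k)" "T m y \<in> B k" using y YS by blast+
    interpret T: module_hom scale scale "T j" using Th j .
    have "T j (T m y) - T m (T j y) \<in> B k'" using comm j y'(1) Suc by simp
    moreover have "T j (T m y) \<in> B k'" using TB j y'(2) Suc by simp
    ultimately have "T j (T m y) - (T j (T m y) - T m (T j y)) \<in> B k'" using subspace_diff subB by blast
    then show ?thesis using YS Suc TW[of j] j y'(1) by simp
  qed
  define L where "L r k = {y \<in> Y k. \<exists>u\<in>U (k + r). (x ^^ r) u - y \<in> B k}" for r k
  have subY: "subspace (Y k)" for k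
  proof (cases k)
    case (Suc k')
    interpret T: module_hom scale scale "T m" using lin by simp
    have "Y k = W k \<inter> {w. T m w \<in> B k'}" using YS Suc by blast
    then show ?thesis using subspace_inter[OF subW T.subspace_linear_preimage[OF subB]] by metis
  qed (simp add: Y0 subW)
  have subL: "subspace (L r k)" for r k
  proof -
    interpret xr: module_hom scale scale "x ^^ r" by (rule xpow)
    show ?thesis
    proof (rule subspaceI)
      have "(x ^^ r) 0 - 0 \<in> B k" using subspace_0[OF subB] by simp
      then show "0 \<in> L r k" unfolding L_def using subspace_0[OF subY] subspace_0 subU by blast
    next
      fix a b assume "a \<in> L r k" "b \<in> L r k"
      then obtain y z where *: "a \<in> Y k" "b \<in> Y k" "y \<in> U (k + r)" "z \<in> U (k + r)"
        "(x ^^ r) y - a \<in> B k" "(x ^^ r) z - b \<in> B k" unfolding L_def by blast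
      have "(x ^^ r) (y + z) - (a + b) = ((x ^^ r) y - a) + ((x ^^ r) z - b)"
        by (simp add: xr.add algebra_simps)
      then have "(x ^^ r) (y + z) - (a + b) \<in> B k" using subspace_add[OF subB *(5,6)] by metis
      then show "a + b \<in> L r k" unfolding L_def
        using subspace_add[OF subY *(1,2)] subspace_add[OF _ *(3,4)] subU by blast
    next
      fix c a assume "a \<in> L r k"
      then obtain y where *: "a \<in> Y k" "y \<in> U (k + r)" "(x ^^ r) y - a \<in> B k" unfolding L_def by blast
      have "(x ^^ r) (c *s y) - c *s a = c *s ((x ^^ r) y - a)"
        by (simp add: xr.scale scale_right_diff_distrib)
      then have "(x ^^ r) (c *s y) - c *s a \<in> B k" using subspace_scale[OF subB *(3)] by metis
      then show "c *s a \<in> L r k" unfolding L_def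
        using subspace_scale[OF subY *(1), of c] subspace_scale[OF _ *(2), of c] subU by blast
    qed
  qed
  have LY: "L r k \<subseteq> Y k" for r k unfolding L_def by blast
  have BL: "B k \<subseteq> L r k" for r k
  proof
    fix b assume b: "b \<in> B k"
    interpret xr: module_hom scale scale "x ^^ r" by (rule xpow)
    have "(x ^^ r) 0 - b \<in> B k" using b subspace_neg[OF subB] by simp
    moreover have "0 \<in> U (k + r)" using subspace_0 subU by blast
    ultimately show "b \<in> L r k" unfolding L_def using b BY by blast
  qed
  have TL: "T j y \<in> L r k" if j: "j < m" and y: "y \<in> L r (Suc k)" for j y r k
  proof -
    obtain u where u: "y \<in> Y (Suc k)" "u \<in> U (Suc k + r)" "(x ^^ r) u - y \<in> B (Suc k)" using y unfolding L_def by blast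
    interpret T: module_hom scale scale "T j" using Th j .
    have "(x ^^ r) (T j u) - T j ((x ^^ r) u) \<in> B k" using xcomm[OF j, of u k r] u(2) UW by simp
    moreover have "T j ((x ^^ r) u) - T j y \<in> B k" using TB[OF _ u(3), of j] j by (simp add: T.diff)
    ultimately have "(x ^^ r) (T j u) - T j y \<in> B k" using subspace_add[OF subB] by fastforce
    then show ?thesis unfolding L_def using TY[OF j u(1)] TU[of j u "k + r"] j u(2) by auto
  qed
  have Lmono: "L (Suc r) k \<subseteq> L r k" for r k
  proof
    fix y assume "y \<in> L (Suc r) k"
    then obtain u where u: "y \<in> Y k" "u \<in> U (k + Suc r)" "(x ^^ Suc r) u - y \<in> B k" unfolding L_def by blast
    have "(x ^^ r) (x u) - y \<in> B k" using u(3) by (simp add: funpow_swap1)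
    moreover have "x u \<in> U (k + r)" using TU[of m u "k + r"] u(2) by (simp add: x_def)
    ultimately show "y \<in> L r k" unfolding L_def using u(1) by blast
  qed
  then have Lmono': "r \<le> r' \<Longrightarrow> L r' k \<subseteq> L r k" for r r' k
    by (rule lift_Suc_antimono_le[of "\<lambda>r. L r k"])
  have Lstab: "\<exists>R. \<forall>r\<ge>R. L r k = L R k" for k
    by (rule finite_dim_decseq_stable[of "\<lambda>r. L r k" "W k"]) (use subL Lmono fd LY YW in blast)+
  define Li where "Li k = (\<Inter>r. L r k)" for k
  have Li: "\<exists>R. \<forall>r\<ge>R. L r k = Li k" for k
  proof -
    obtain R where R: "\<forall>r\<ge>R. L r k = L R k" using Lstab by blast
    have "L R k \<subseteq> L r k" for r using R Lmono'[of r "max r R"] by (metis max.cobounded1 max.cobounded2)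
    then have "Li k = L R k" unfolding Li_def by blast
    then show ?thesis using R by blast
  qed
  have subLi: "subspace (Li k)" for k using Li subL by (metis order_refl)
  obtain N where N: "\<And>k z. N \<le> k \<Longrightarrow> z \<in> Y (Suc k) \<Longrightarrow> (\<And>j. j < m \<Longrightarrow> T j z \<in> Li k) \<Longrightarrow> z \<in> Li (Suc k)"
  proof (rule artinian_pairD[OF art subLi])
    show "\<And>k j u. j < m \<Longrightarrow> u \<in> Li (Suc k) \<Longrightarrow> T j u \<in> Li k" unfolding Li_def using TL by blast
    show "\<And>k. B k \<subseteq> Li k" unfolding Li_def using BL by blast
    show "\<And>k. Li k \<subseteq> Y k" unfolding Li_def using LY by blast
  qed blast
  obtain R where R: "\<forall>k\<le>N. \<forall>r\<ge>R. L r k = Li k"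
    using finite_uniform_bound[of N "\<lambda>k r. L r k = Li k"] Li by blast
  have LR: "L r k = Li k" if r: "r \<ge> R" for r k
  proof (induction k)
    case 0 then show ?case using R r by simp
  next
    case (Suc k)
    show ?case
    proof (cases "Suc k \<le> N")
      case True then show ?thesis using R r by blast
    next
      case False
      have "L r (Suc k) \<subseteq> Li (Suc k)"
      proof
        fix z assume z: "z \<in> L r (Suc k)"
        then have "T j z \<in> Li k" if "j < m" for j using TL[OF that z] Suc by blast
        then show "z \<in> Li (Suc k)" using N[of k z] False z LY by auto
      qed
      then show ?thesis unfolding Li_def by blast
    qed
  qed
  have "\<exists>N. \<forall>k\<ge>N. \<forall>z\<in>Y (Suc k). (\<forall>j<m. T j z \<in> L r k) \<longrightarrow> z \<in> L r (Suc k)" for r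
    by (rule artinian_pairD[of m T Y B "L r", OF art subL TL BL LY]) blast+
  then obtain N' where N': "\<And>r k z. r \<le> R \<Longrightarrow> k \<ge> N' \<Longrightarrow> z \<in> Y (Suc k) \<Longrightarrow> (\<forall>j<m. T j z \<in> L r k) \<Longrightarrow> z \<in> L r (Suc k)"
    using finite_uniform_bound[of R "\<lambda>r k. \<forall>z\<in>Y (Suc k). (\<forall>j<m. T j z \<in> L r k) \<longrightarrow> z \<in> L r (Suc k)"]
    by blast
  have "w \<in> U (Suc K)"
    if K: "K \<ge> N' + R" and w: "w \<in> W (Suc K)" and Tw: "\<forall>j<Suc m. T j w \<in> U K" for K w
  proof -
    \<comment> \<open>\<open>P 0\<close> is the claim up to \<open>B\<close>, which lies in
      \<open>U\<close>. The exponent descends from Suc K, where the power of x lands in degree 0 and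
      \<open>Y 0\<close> is all of \<open>W 0\<close>; at each exponent the approximation u is
      corrected once.\<close>
    define P where "P r \<longleftrightarrow> (\<exists>u\<in>U (Suc K). (x ^^ r) (w - u) \<in> B (Suc K - r))" for r
    have step: "P r" if r: "r \<le> Suc K" and u: "u \<in> U (Suc K)" and y: "(x ^^ r) (w - u) \<in> Y (Suc K - r)" for r u
    proof -
      obtain k where k: "k = Suc K - r" by simp
      have kr: "k + r = Suc K" using k r by simp
      define w' where "w' = w - u"
      interpret xr: module_hom scale scale "x ^^ r" by (rule xpow)
      have w'W: "w' \<in> W (Suc K)" unfolding w'_def using w u UW subspace_diff subW by blast
      have Tw': "T j w' \<in> U K" if j: "j \<le> m" for j
      proof -
        have "T j w \<in> U K" "T j u \<in> U K" using Tw TU u j by auto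
        then show ?thesis unfolding w'_def module_hom.diff[OF lin[OF j]] using subspace_diff subU by blast
      qed
      have yY: "(x ^^ r) w' \<in> Y k" using y unfolding w'_def k .
      \<comment> \<open>Membership in \<open>L r k\<close> is what a correction requires: it yields
        u' in \<open>U\<close> with \<open>(x ^^ r) u'\<close> congruent to
        \<open>(x ^^ r) w'\<close> modulo \<open>B\<close>, and replacing u by u + u' gives
        \<open>P r\<close>.\<close>
      have "(x ^^ r) w' \<in> L r k"
      proof (cases "r \<le> R")
        case True
        have "k = Suc (k - 1)" "k - 1 \<ge> N'" using True K k by auto
        then obtain k' where k': "k = Suc k'" "k' \<ge> N'" by blast
        have "T j ((x ^^ r) w') \<in> L r k'" if j: "j < m" for j
        proof -
          have "T j w' \<in> U (k' + r)" using Tw' j kr k' by simp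
          moreover have "(x ^^ r) (T j w') - T j ((x ^^ r) w') \<in> B k'"
            using xcomm[OF j, of w' k' r] w'W kr k' by simp
          ultimately show ?thesis unfolding L_def using TY[OF j, of "(x ^^ r) w'" k'] yY k' by blast
        qed
        then show ?thesis using N'[OF True k'(2)] yY k' by blast
      next
        case False
        \<comment> \<open>One factor x is spent on moving w' into \<open>U\<close>, which is
          possible because all \<open>T j w'\<close> lie there. This places the element in
          \<open>L q k\<close> only, but q and r are both at least R, where the sets agree.\<close>
        then obtain q where q: "r = Suc q" "q \<ge> R" by (cases r) auto
        have "(x ^^ q) (x w') - (x ^^ r) w' \<in> B k"
          using subspace_0[OF subB] q by (simp add: funpow_swap1)
        moreover have "x w' \<in> U (k + q)" using Tw'[of m] kr q by (simp add: x_def)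
        ultimately have "(x ^^ r) w' \<in> L q k" unfolding L_def using yY by blast
        then show ?thesis using LR[of q k] LR[of r k] q by simp
      qed
      then obtain u' where u': "u' \<in> U (Suc K)" "(x ^^ r) u' - (x ^^ r) w' \<in> B k" unfolding L_def using kr by auto
      have "(x ^^ r) (w - (u + u')) = - ((x ^^ r) u' - (x ^^ r) w')"
        unfolding w'_def by (simp add: xr.diff xr.add)
      then have "(x ^^ r) (w - (u + u')) \<in> B k" using u'(2) subspace_neg[OF subB] by metis
      then show ?thesis unfolding P_def using u u'(1) subspace_add subU k by metis
    qed
    have "P (Suc K - k)" if "k \<le> Suc K" for k using that
    proof (induction k)
      case 0
      have "(x ^^ Suc K) (w - 0) \<in> Y (Suc K - Suc K)" using xpW[of w 0 "Suc K"] w Y0 by simp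
      moreover have "0 \<in> U (Suc K)" using subspace_0 subU by blast
      ultimately show ?case using step[of "Suc K" 0] by simp
    next
      case (Suc k)
      define r where "r = Suc K - Suc k"
      have r: "Suc K - k = Suc r" "Suc K - r = Suc k" "r \<le> Suc K" "K - r = k" using Suc.prems r_def by auto
      then obtain u where u: "u \<in> U (Suc K)" "(x ^^ Suc r) (w - u) \<in> B k"
        using Suc.IH Suc.prems unfolding P_def by auto
      have "w - u \<in> W (Suc k + r)" using w u(1) UW subspace_diff[OF subW] r by (metis Suc.prems add.commute le_add_diff_inverse2 r_def)
      then have "(x ^^ r) (w - u) \<in> W (Suc k)" using xpW by blast
      then have "(x ^^ r) (w - u) \<in> Y (Suc k)" using u(2) YS by (simp add: x_def)
      then show ?case using step[OF r(3) u(1)] r r_def by simp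
    qed
    from this[of "Suc K"] obtain u where "u \<in> U (Suc K)" "w - u \<in> B (Suc K)" unfolding P_def by auto
    then have "u + (w - u) \<in> U (Suc K)" using BU subspace_add subU by blast
    then show ?thesis by simp
  qed
  then show "\<exists>N. \<forall>k\<ge>N. \<forall>z\<in>W (Suc k). (\<forall>j<Suc m. T j z \<in> U k) \<longrightarrow> z \<in> U (Suc k)"
    by blast
qed

text \<open>First generate the image of \<open>U\<close> in \<open>Z / Y\<close>. The remainder lies
  in \<open>Y\<close>, and in \<open>U\<close> too, being the difference of u and elements
  \<open>T j (a j)\<close> of \<open>U\<close>; the assumption on \<open>Y / B\<close>, applied to
  the intersection of \<open>U\<close> and \<open>Y\<close>, takes care of it.\<close>

lemma noetherian_pair_trans:
  assumes lin: "\<And>j. j < m \<Longrightarrow> module_hom scale scale (T j)"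
    and subZ: "\<And>k. subspace (Z k)" and subY: "\<And>k. subspace (Y k)"
    and BY: "\<And>k. B k \<subseteq> Y k" and YZ: "\<And>k. Y k \<subseteq> Z k"
    and TY: "\<And>j k w. j < m \<Longrightarrow> w \<in> Y k \<Longrightarrow> T j w \<in> Y (Suc k)"
    and ZY: "noetherian_pair m T Z Y" and YB: "noetherian_pair m T Y B"
  shows "noetherian_pair m T Z B"
  unfolding noetherian_pair_def
proof (intro allI impI, elim conjE)
  fix U :: "nat \<Rightarrow> 'b set"
  assume subU: "\<forall>k. subspace (U k)" and TU: "\<forall>k. \<forall>j<m. \<forall>u\<in>U k. T j u \<in> U (Suc k)"
    and BUZ: "\<forall>k. B k \<subseteq> U k \<and> U k \<subseteq> Z k"
  define U1 where "U1 k = {u + y | u y. u \<in> U k \<and> y \<in> Y k}" for k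
  obtain N1 where N1: "\<And>k u. N1 \<le> k \<Longrightarrow> u \<in> U1 (Suc k) \<Longrightarrow>
    \<exists>b\<in>Y (Suc k). \<exists>v. (\<forall>j<m. v j \<in> U1 k) \<and> u = b + (\<Sum>j<m. T j (v j))"
  proof (rule noetherian_pairD[OF ZY, of U1])
    show "subspace (U1 k)" for k unfolding U1_def using subspace_sums subU subY by blast
    show "T j u \<in> U1 (Suc k)" if j: "j < m" and u: "u \<in> U1 k" for k j u
      using u TU TY[OF j] module_hom.add[OF lin[OF j]] j unfolding U1_def by fastforce
    show "Y k \<subseteq> U1 k" for k
    proof
      fix y assume "y \<in> Y k"
      then have "y = 0 + y" "0 \<in> U k" "y \<in> Y k" using subspace_0 subU by auto
      then show "y \<in> U1 k" unfolding U1_def by blast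
    qed
    show "U1 k \<subseteq> Z k" for k unfolding U1_def using BUZ YZ subspace_add[OF subZ] by blast
  qed blast
  obtain N2 where N2: "\<And>k u. N2 \<le> k \<Longrightarrow> u \<in> U (Suc k) \<inter> Y (Suc k) \<Longrightarrow>
    \<exists>b\<in>B (Suc k). \<exists>v. (\<forall>j<m. v j \<in> U k \<inter> Y k) \<and> u = b + (\<Sum>j<m. T j (v j))"
    by (rule noetherian_pairD[OF YB, of "\<lambda>k. U k \<inter> Y k"]) (use subU subY TU TY BUZ BY in \<open>auto intro: subspace_inter\<close>)
  have "\<exists>b\<in>B (Suc k). \<exists>v. (\<forall>j<m. v j \<in> U k) \<and> u = b + (\<Sum>j<m. T j (v j))"
    if k: "k \<ge> max N1 N2" and u: "u \<in> U (Suc k)" for k u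
  proof -
    have "u = u + 0" "0 \<in> Y (Suc k)" using subspace_0[OF subY] by auto
    then have "u \<in> U1 (Suc k)" unfolding U1_def using u by blast
    then obtain b v where b: "b \<in> Y (Suc k)" "\<And>j. j < m \<Longrightarrow> v j \<in> U1 k" "u = b + (\<Sum>j<m. T j (v j))"
      using N1 k by (metis max.boundedE)
    have "\<exists>a y. v j = a + y \<and> a \<in> U k \<and> y \<in> Y k" if "j < m" for j using b(2)[OF that] unfolding U1_def by blast
    then obtain a y where ay: "\<And>j. j < m \<Longrightarrow> v j = a j + y j" "\<And>j. j < m \<Longrightarrow> a j \<in> U k" "\<And>j. j < m \<Longrightarrow> y j \<in> Y k"
      by metis
    define y' where "y' = b + (\<Sum>j<m. T j (y j))"
    have "(\<Sum>j<m. T j (v j)) = (\<Sum>j<m. T j (a j)) + (\<Sum>j<m. T j (y j))"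
      unfolding sum.distrib[symmetric] using ay(1) module_hom.add[OF lin] by (intro sum.cong) simp_all
    then have uy: "u = y' + (\<Sum>j<m. T j (a j))" using b(3) unfolding y'_def by (simp add: algebra_simps)
    have "y' \<in> Y (Suc k)" unfolding y'_def
      using b(1) ay(3) TY by (auto intro!: subspace_add[OF subY] subspace_sum[OF subY])
    moreover have "y' \<in> U (Suc k)"
    proof -
      have "(\<Sum>j<m. T j (a j)) \<in> U (Suc k)" by (rule subspace_sum) (use subU TU ay(2) in auto)
      then show ?thesis using u uy subspace_diff subU by (metis add_diff_cancel_right')
    qed
    ultimately have "y' \<in> U (Suc k) \<inter> Y (Suc k)" by blast
    then obtain b' v' where b': "b' \<in> B (Suc k)" "\<And>j. j < m \<Longrightarrow> v' j \<in> U k \<inter> Y k" "y' = b' + (\<Sum>j<m. T j (v' j))"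
      using N2 k by (metis max.boundedE)
    have "(\<Sum>j<m. T j (v' j + a j)) = (\<Sum>j<m. T j (v' j)) + (\<Sum>j<m. T j (a j))"
      unfolding sum.distrib[symmetric] using module_hom.add[OF lin] by (intro sum.cong) simp_all
    then have "u = b' + (\<Sum>j<m. T j (v' j + a j))" using uy b'(3) by (simp add: algebra_simps)
    moreover have "v' j + a j \<in> U k" if "j < m" for j using b'(2)[OF that] ay(2)[OF that] subspace_add subU by blast
    ultimately show ?thesis using b'(1) by (intro bexI[of _ b'] exI[of _ "\<lambda>j. v' j + a j"]) blast+
  qed
  then show "\<exists>N. \<forall>k\<ge>N. \<forall>u\<in>U (Suc k). \<exists>b\<in>B (Suc k). \<exists>v. (\<forall>j<m. v j \<in> U k) \<and> u = b + (\<Sum>j<m. T j (v j))"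
    by blast
qed

text \<open>If all \<open>T j z\<close> lie in \<open>U\<close>, the first assumption splits z into
  u in \<open>U\<close> and y in \<open>Y\<close>. Then every \<open>T j y\<close> is a difference
  of elements of \<open>U\<close> and lies in \<open>Y\<close>, so the second assumption applies to
  y.\<close>

lemma artinian_pair_trans:
  assumes lin: "\<And>j. j < m \<Longrightarrow> module_hom scale scale (T j)"
    and subZ: "\<And>k. subspace (Z k)" and subY: "\<And>k. subspace (Y k)"
    and BY: "\<And>k. B k \<subseteq> Y k" and YZ: "\<And>k. Y k \<subseteq> Z k"
    and TY: "\<And>j k w. j < m \<Longrightarrow> w \<in> Y (Suc k) \<Longrightarrow> T j w \<in> Y k"
    and ZY: "artinian_pair m T Z Y" and YB: "artinian_pair m T Y B"
  shows "artinian_pair m T Z B"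
  unfolding artinian_pair_def
proof (intro allI impI, elim conjE)
  fix U :: "nat \<Rightarrow> 'b set"
  assume subU: "\<forall>k. subspace (U k)" and TU: "\<forall>k. \<forall>j<m. \<forall>u\<in>U (Suc k). T j u \<in> U k"
    and BUZ: "\<forall>k. B k \<subseteq> U k \<and> U k \<subseteq> Z k"
  define U1 where "U1 k = {u + y | u y. u \<in> U k \<and> y \<in> Y k}" for k
  obtain N1 where N1: "\<And>k z. N1 \<le> k \<Longrightarrow> z \<in> Z (Suc k) \<Longrightarrow> (\<And>j. j < m \<Longrightarrow> T j z \<in> U1 k) \<Longrightarrow> z \<in> U1 (Suc k)"
  proof (rule artinian_pairD[OF ZY, of U1])
    show "subspace (U1 k)" for k unfolding U1_def using subspace_sums subU subY by blast
    show "T j u \<in> U1 k" if j: "j < m" and u: "u \<in> U1 (Suc k)" for k j u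
      using u TU TY[OF j] module_hom.add[OF lin[OF j]] j unfolding U1_def by fastforce
    show "Y k \<subseteq> U1 k" for k
    proof
      fix y assume "y \<in> Y k"
      then have "y = 0 + y" "0 \<in> U k" "y \<in> Y k" using subspace_0 subU by auto
      then show "y \<in> U1 k" unfolding U1_def by blast
    qed
    show "U1 k \<subseteq> Z k" for k unfolding U1_def using BUZ YZ subspace_add[OF subZ] by blast
  qed blast
  obtain N2 where N2: "\<And>k z. N2 \<le> k \<Longrightarrow> z \<in> Y (Suc k) \<Longrightarrow> (\<And>j. j < m \<Longrightarrow> T j z \<in> U k \<inter> Y k) \<Longrightarrow> z \<in> U (Suc k) \<inter> Y (Suc k)"
    by (rule artinian_pairD[OF YB, of "\<lambda>k. U k \<inter> Y k"]) (use subU subY TU TY BUZ BY in \<open>auto intro: subspace_inter\<close>)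
  have "z \<in> U (Suc k)"
    if k: "k \<ge> max N1 N2" and z: "z \<in> Z (Suc k)" and Tz: "\<forall>j<m. T j z \<in> U k" for k z
  proof -
    have "U k \<subseteq> U1 k"
    proof
      fix u assume "u \<in> U k"
      then have "u = u + 0" "u \<in> U k" "0 \<in> Y k" using subspace_0[OF subY] by auto
      then show "u \<in> U1 k" unfolding U1_def by blast
    qed
    then have "z \<in> U1 (Suc k)" using N1[of k z] k z Tz by auto
    then obtain u y where uy: "u \<in> U (Suc k)" "y \<in> Y (Suc k)" "z = u + y" unfolding U1_def by blast
    have "T j y \<in> U k \<inter> Y k" if j: "j < m" for j
    proof -
      have "T j y = T j z - T j u" using module_hom.add[OF lin[OF j]] uy(3) by simp
      moreover have "T j z - T j u \<in> U k" using Tz TU uy(1) j subspace_diff subU by blast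
      ultimately show ?thesis using TY[OF j uy(2)] by simp
    qed
    then have "y \<in> U (Suc k)" using N2[of k y] uy(2) k by auto
    then show ?thesis using uy subspace_add subU by blast
  qed
  then show "\<exists>N. \<forall>k\<ge>N. \<forall>z\<in>Z (Suc k). (\<forall>j<m. T j z \<in> U k) \<longrightarrow> z \<in> U (Suc k)" by blast
qed

end

section \<open>Linear parts of complexes over Clifford operators\<close>

text \<open>For j = k the relation \<open>c_e\<close> reads x = c j (e j x) + e j (c j x), so the
  kernel of \<open>e j\<close> equals its image. This splitting is how freeness over the exterior
  algebra enters. The grading \<open>gr\<close> is the one of the complex and is kept by all these
  operators.\<close>

locale clifford_module = vector_space scale
  for scale :: "'k::field \<Rightarrow> 'w::ab_group_add \<Rightarrow> 'w" +
  fixes n :: nat and e c :: "nat \<Rightarrow> 'w \<Rightarrow> 'w" and gr :: "int \<Rightarrow> 'w set"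
  assumes lin_e: "j < n \<Longrightarrow> module_hom scale scale (e j)"
    and lin_c: "j < n \<Longrightarrow> module_hom scale scale (c j)"
    and sub_gr: "subspace (gr i)"
    and e_gr: "j < n \<Longrightarrow> x \<in> gr i \<Longrightarrow> e j x \<in> gr i"
    and c_gr: "j < n \<Longrightarrow> x \<in> gr i \<Longrightarrow> c j x \<in> gr i"
    and e_e: "j < n \<Longrightarrow> k < n \<Longrightarrow> e j (e k x) = - e k (e j x)"
    and e_sq: "j < n \<Longrightarrow> e j (e j x) = 0"
    and c_e: "j < n \<Longrightarrow> k < n \<Longrightarrow> c j (e k x) = (if j = k then x else 0) - e k (c j x)"
begin

lemma gr_0: "0 \<in> gr i" and gr_add: "x \<in> gr i \<Longrightarrow> y \<in> gr i \<Longrightarrow> x + y \<in> gr i"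
  and gr_diff: "x \<in> gr i \<Longrightarrow> y \<in> gr i \<Longrightarrow> x - y \<in> gr i" and gr_neg: "x \<in> gr i \<Longrightarrow> - x \<in> gr i"
  by (simp_all add: subspace_0 subspace_add subspace_diff subspace_neg sub_gr)

lemma e_add: "j < n \<Longrightarrow> e j (x + y) = e j x + e j y" and e_diff: "j < n \<Longrightarrow> e j (x - y) = e j x - e j y"
  and e_neg: "j < n \<Longrightarrow> e j (- x) = - e j x" and e_0: "j < n \<Longrightarrow> e j 0 = 0"
  by (simp_all add: module_hom.add[OF lin_e] module_hom.diff[OF lin_e] module_hom.neg[OF lin_e] module_hom.zero[OF lin_e])

lemma c_add: "j < n \<Longrightarrow> c j (x + y) = c j x + c j y" and c_diff: "j < n \<Longrightarrow> c j (x - y) = c j x - c j y"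
  and c_neg: "j < n \<Longrightarrow> c j (- x) = - c j x" and c_0: "j < n \<Longrightarrow> c j 0 = 0"
  by (simp_all add: module_hom.add[OF lin_c] module_hom.diff[OF lin_c] module_hom.neg[OF lin_c] module_hom.zero[OF lin_c])

lemma e_e_eq_0: "j < n \<Longrightarrow> k < n \<Longrightarrow> e j x = 0 \<Longrightarrow> e j (e k x) = 0"
  using e_e[of j k x] e_0 by simp

section \<open>Submodules generated by the first m generators\<close>

primrec ideal_part :: "nat \<Rightarrow> int \<Rightarrow> 'w set" where
  "ideal_part 0 i = {0}"
| "ideal_part (Suc m) i = {e m y + x | y x. y \<in> gr i \<and> x \<in> ideal_part m i}"

lemma subspace_ideal_part: "m \<le> n \<Longrightarrow> subspace (ideal_part m i)"
proof (induction m)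
  case (Suc m)
  then show ?case using subspace_plus_image[OF sub_gr _ lin_e, of "ideal_part m i" m i] by simp
qed simp

lemma ideal_part_gr: "m \<le> n \<Longrightarrow> ideal_part m i \<subseteq> gr i"
  by (induction m) (auto simp: gr_0 intro!: gr_add e_gr)

lemma ideal_part_Suc: "m < n \<Longrightarrow> ideal_part m i \<subseteq> ideal_part (Suc m) i"
proof
  fix x assume "m < n" "x \<in> ideal_part m i"
  then have "x = e m 0 + x" "0 \<in> gr i" using e_0 gr_0 by auto
  with \<open>x \<in> ideal_part m i\<close> show "x \<in> ideal_part (Suc m) i" unfolding ideal_part.simps by blast
qed

lemma e_ideal_part_Suc: "m < n \<Longrightarrow> y \<in> gr i \<Longrightarrow> e m y \<in> ideal_part (Suc m) i"
  using subspace_0[OF subspace_ideal_part, of m] by force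

text \<open>The alternative of signs lets one criterion cover maps commuting with the
  \<open>e j\<close>, such as d and the homotopies \<open>R j k\<close>, and maps anticommuting with
  them, such as the contractions against other generators and the commutators \<open>T j\<close> and
  \<open>X j\<close>.\<close>

lemma ideal_part_map:
  assumes "module_hom scale scale f" "\<And>x. x \<in> gr i \<Longrightarrow> f x \<in> gr i'"
    and "\<And>j x. j < m \<Longrightarrow> x \<in> gr i \<Longrightarrow> f (e j x) = e j (f x) \<or> f (e j x) = e j (- f x)"
    and "x \<in> ideal_part m i"
  shows "f x \<in> ideal_part m i'"
  using assms(3,4)
proof (induction m arbitrary: x)
  case 0 then show ?case using module_hom.zero[OF assms(1)] by simp
next
  case (Suc m)
  then obtain y z where yz: "y \<in> gr i" "z \<in> ideal_part m i" "x = e m y + z" by auto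
  have "f (e m y) = e m (f y) \<or> f (e m y) = e m (- f y)" using Suc.prems(1)[OF _ yz(1), of m] by simp
  then obtain y' where y': "y' \<in> gr i'" "f (e m y) = e m y'" using assms(2)[OF yz(1)] gr_neg by blast
  have "f z \<in> ideal_part m i'" using Suc.IH Suc.prems(1) yz(2) by simp
  moreover have "f x = e m y' + f z" using y'(2) yz(3) module_hom.add[OF assms(1)] by simp
  ultimately show ?case using y'(1) by auto
qed

lemma e_ideal_part:
  assumes "k < n" "m \<le> n" "x \<in> ideal_part m i" shows "e k x \<in> ideal_part m i"
proof (rule ideal_part_map[OF lin_e e_gr _ assms(3)])
  fix j x assume "j < m"
  then show "e k (e j x) = e j (e k x) \<or> e k (e j x) = e j (- e k x)"
    using e_e[of k j x] assms e_neg[of j "e k x"] by simp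
qed (use assms in auto)

text \<open>The restriction k \<ge> m is essential: contracting against one of the generators of the
  ideal can remove the factor that places an element in it. For k = m it is used in the connecting
  argument.\<close>

lemma c_ideal_part:
  assumes "m \<le> k" "k < n" "x \<in> ideal_part m i" shows "c k x \<in> ideal_part m i"
proof (rule ideal_part_map[OF lin_c c_gr _ assms(3)])
  fix j x assume "j < m"
  then show "c k (e j x) = e j (c k x) \<or> c k (e j x) = e j (- c k x)"
    using c_e[of k j x] assms e_neg[of j "c k x"] by simp
qed (use assms in auto)

text \<open>The commutator with a contraction reads off the part of f involving the j-th generator;
  for the linear part it is the operator x_j on H, up to a sign depending on the exterior
  degree.\<close>

definition bracket :: "('w \<Rightarrow> 'w) \<Rightarrow> nat \<Rightarrow> 'w \<Rightarrow> 'w" where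
  "bracket f j x = c j (f x) - f (c j x)"

end

text \<open>A complex of \<open>E\<close>-modules with terms \<open>gr i = E \<otimes> H\<^sup>i\<close>, differential \<open>d\<close> and linear part \<open>l\<close>; the operators \<open>e j\<close>
  and \<open>c j\<close> are multiplication by and contraction against the \<open>j\<close>-th generator. The last
  assumptions say that \<open>d\<close> and \<open>l\<close> are minimal and agree up to terms of degree \<open>> 1\<close>.\<close>

locale clifford_complex = clifford_module scale n e c gr
  for scale :: "'k::field \<Rightarrow> 'w::ab_group_add \<Rightarrow> 'w" and n e c gr +
  fixes d l :: "'w \<Rightarrow> 'w"
  assumes fd_gr: "finite_dim (gr i)"
    and lin_d: "module_hom scale scale d" and lin_l: "module_hom scale scale l"
    and d_gr: "x \<in> gr i \<Longrightarrow> d x \<in> gr (i + 1)" and l_gr: "x \<in> gr i \<Longrightarrow> l x \<in> gr (i + 1)"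
    and d_e: "j < n \<Longrightarrow> d (e j x) = e j (d x)" and l_e: "j < n \<Longrightarrow> l (e j x) = e j (l x)"
    and d_d: "x \<in> gr i \<Longrightarrow> d (d x) = 0" and l_l: "x \<in> gr i \<Longrightarrow> l (l x) = 0"
    and socle: "x \<in> gr i \<Longrightarrow> \<forall>j<n. e j x = 0 \<Longrightarrow> d x = 0 \<and> l x = 0 \<and> (\<forall>j<n. d (c j x) = l (c j x))"
    and radical: "x \<in> gr i \<Longrightarrow> d x \<in> ideal_part n (i + 1) \<and> l x \<in> ideal_part n (i + 1) \<and>
      (\<forall>j<n. c j (d x - l x) \<in> ideal_part n (i + 1))"
begin

section \<open>Commutators with contractions and their homotopies\<close>

sublocale d: module_hom scale scale d by (rule lin_d)
sublocale l: module_hom scale scale l by (rule lin_l)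

abbreviation "T \<equiv> bracket d"
abbreviation "X \<equiv> bracket l"

text \<open>For j = k both products produce a term f x. As f commutes with \<open>e k\<close> these
  terms cancel, and only the sign from moving \<open>c j\<close> past \<open>e k\<close> is
  left.\<close>

lemma bracket_e:
  assumes "j < n" "k < n" "module_hom scale scale f" "\<And>j x. j < n \<Longrightarrow> f (e j x) = e j (f x)"
  shows "bracket f j (e k x) = - e k (bracket f j x)"
proof -
  interpret f: module_hom scale scale f by fact
  show ?thesis unfolding bracket_def using assms(1,2,4) by (simp add: c_e f.diff f.zero e_diff)
qed

lemma T_e: "j < n \<Longrightarrow> k < n \<Longrightarrow> T j (e k x) = - e k (T j x)"
  and X_e: "j < n \<Longrightarrow> k < n \<Longrightarrow> X j (e k x) = - e k (X j x)"
  by (simp_all add: bracket_e lin_d lin_l d_e l_e)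

lemma lin_bracket:
  assumes "j < n" "module_hom scale scale f"
  shows "module_hom scale scale (bracket f j)"
proof -
  interpret f: module_hom scale scale f by fact
  interpret c: module_hom scale scale "c j" using lin_c assms(1) .
  show ?thesis
    unfolding bracket_def by unfold_locales (simp_all add: f.add f.scale c.add c.scale scale_right_diff_distrib)
qed

lemma lin_T: "j < n \<Longrightarrow> module_hom scale scale (T j)" and lin_X: "j < n \<Longrightarrow> module_hom scale scale (X j)"
  by (simp_all add: lin_bracket lin_d lin_l)

lemma T_gr: "j < n \<Longrightarrow> x \<in> gr i \<Longrightarrow> T j x \<in> gr (i + 1)" and X_gr: "j < n \<Longrightarrow> x \<in> gr i \<Longrightarrow> X j x \<in> gr (i + 1)"
  unfolding bracket_def by (simp_all add: gr_diff c_gr d_gr l_gr)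

text \<open>By d d = 0, both sides are the single surviving term \<open>d (c j (d x))\<close>. Hence
  \<open>T j\<close> sends cocycles to cocycles and coboundaries to coboundaries.\<close>

lemma d_T: "j < n \<Longrightarrow> x \<in> gr i \<Longrightarrow> d (T j x) = - T j (d x)"
  unfolding bracket_def using d_d[OF c_gr] by (simp add: d.diff d_d c_0)

text \<open>The anticommutator of \<open>T j\<close> and \<open>c k\<close> serves as the homotopy
  by which \<open>T j\<close> and \<open>T k\<close> commute.\<close>

definition R :: "nat \<Rightarrow> nat \<Rightarrow> 'w \<Rightarrow> 'w" where "R j k x = T j (c k x) + c k (T j x)"

lemma lin_R: "j < n \<Longrightarrow> k < n \<Longrightarrow> module_hom scale scale (R j k)"
proof -
  assume "j < n" "k < n"
  then interpret T: module_hom scale scale "T j" + c: module_hom scale scale "c k" using lin_T lin_c by auto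
  show ?thesis
    unfolding R_def by unfold_locales (simp_all add: T.add T.scale c.add c.scale scale_right_distrib)
qed

lemma R_gr: "j < n \<Longrightarrow> k < n \<Longrightarrow> x \<in> gr i \<Longrightarrow> R j k x \<in> gr (i + 1)"
  unfolding R_def by (simp add: gr_add c_gr T_gr)

text \<open>The two summands create the term \<open>T j x\<close> for k = i with opposite signs.
  Since the homotopy is thus linear over the exterior algebra, it restricts to each Q_m and descends
  to each quotient by \<open>ideal_part m\<close>.\<close>

lemma R_e:
  assumes "j < n" "k < n" "i < n" shows "R j k (e i x) = e i (R j k x)"
proof -
  interpret T: module_hom scale scale "T j" using lin_T assms by simp
  show ?thesis unfolding R_def using assms by (simp add: c_e T_e c_neg T.diff T.zero e_add)
qed

text \<open>Expand \<open>T k\<close> as c k d - d c k and move d past \<open>T j\<close> by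
  \<open>d_T\<close>; the four terms group into d R and R d.\<close>

lemma T_T:
  assumes "j < n" "k < n" "x \<in> gr i"
  shows "T j (T k x) - T k (T j x) = d (R j k x) + R j k (d x)"
proof -
  interpret T: module_hom scale scale "T j" using lin_T assms by simp
  have "T j (T k x) = T j (c k (d x)) - T j (d (c k x))" by (simp add: bracket_def[of d k] T.diff)
  also have "T j (d (c k x)) = - d (T j (c k x))" using d_T[OF assms(1) c_gr] assms by simp
  finally have "T j (T k x) = T j (c k (d x)) + d (T j (c k x))" by simp
  moreover have "T k (T j x) = - c k (T j (d x)) - d (c k (T j x))"
    unfolding bracket_def[of d k] using d_T assms c_neg by simp
  ultimately show ?thesis unfolding R_def by (simp add: d.add)
qed

section \<open>Injective side: the filtration by partial socles\<close>

definition socle_part :: "nat \<Rightarrow> nat \<Rightarrow> 'w set" where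
  "socle_part m k = {x \<in> gr (int k). \<forall>j<m. e j x = 0}"

definition socle_cocycles :: "nat \<Rightarrow> nat \<Rightarrow> 'w set" where
  "socle_cocycles m k = {x \<in> socle_part m k. d x = 0}"

text \<open>Incoming coboundaries in degree 0 are discarded, which truncates the complex there. This
  affects homology in degree 0 only, while all conclusions concern high degrees.\<close>

definition socle_coboundaries :: "nat \<Rightarrow> nat \<Rightarrow> 'w set" where
  "socle_coboundaries m k = (case k of 0 \<Rightarrow> {0} | Suc k \<Rightarrow> d ` socle_part m k)"

lemma subspace_socle_part: "m \<le> n \<Longrightarrow> subspace (socle_part m k)"
proof (rule subspaceI)
  assume "m \<le> n"
  then have m: "j < m \<Longrightarrow> j < n" for j by simp
  show "0 \<in> socle_part m k" unfolding socle_part_def using gr_0 e_0 m by simp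
  show "x + y \<in> socle_part m k" if "x \<in> socle_part m k" "y \<in> socle_part m k" for x y
    using that gr_add e_add m unfolding socle_part_def by simp
  show "scale a x \<in> socle_part m k" if "x \<in> socle_part m k" for a x
    using that subspace_scale[OF sub_gr] module_hom.scale[OF lin_e] m unfolding socle_part_def by simp
qed

lemma subspace_socle_cocycles:
  assumes "m \<le> n" shows "subspace (socle_cocycles m k)"
proof -
  have "socle_cocycles m k = socle_part m k \<inter> {x. d x = 0}" unfolding socle_cocycles_def by blast
  then show ?thesis using subspace_inter[OF subspace_socle_part[OF assms] d.subspace_kernel] by simp
qed

lemma subspace_socle_coboundaries: "m \<le> n \<Longrightarrow> subspace (socle_coboundaries m k)"
  unfolding socle_coboundaries_def using d.subspace_image[OF subspace_socle_part] by (cases k) simp_all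

lemma socle_part_map:
  assumes "x \<in> socle_part m k" "f x \<in> gr (int k')" "f 0 = 0"
    "\<And>j. j < m \<Longrightarrow> f (e j x) = e j (f x) \<or> f (e j x) = - e j (f x)"
  shows "f x \<in> socle_part m k'"
proof -
  have "e j (f x) = 0" if "j < m" for j
    using assms(4)[OF that] assms(1,3) that unfolding socle_part_def by auto
  then show ?thesis unfolding socle_part_def using assms(2) by blast
qed

lemma gr_Suc: "gr (int k + 1) = gr (int (Suc k))"
  by (simp add: add.commute)

lemma socle_part_gr: "x \<in> socle_part m k \<Longrightarrow> x \<in> gr (int k)"
  unfolding socle_part_def by blast

lemma d_socle_part: "m \<le> n \<Longrightarrow> x \<in> socle_part m k \<Longrightarrow> d x \<in> socle_part m (Suc k)"
  by (rule socle_part_map) (use d_gr[OF socle_part_gr] d_e d.zero in \<open>simp_all add: gr_Suc\<close>)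

lemma socle_coboundaries_cocycles:
  assumes "m \<le> n" shows "socle_coboundaries m k \<subseteq> socle_cocycles m k"
proof (cases k)
  case 0 then show ?thesis
    unfolding socle_coboundaries_def using subspace_0[OF subspace_socle_cocycles[OF assms]] by simp
next
  case (Suc k')
  then show ?thesis unfolding socle_coboundaries_def socle_cocycles_def
    using d_socle_part[OF assms] d_d[OF socle_part_gr] by auto
qed

lemma T_socle_part: "m \<le> n \<Longrightarrow> j < n \<Longrightarrow> x \<in> socle_part m k \<Longrightarrow> T j x \<in> socle_part m (Suc k)"
  by (rule socle_part_map) (use T_gr[OF _ socle_part_gr] T_e module_hom.zero[OF lin_T] in \<open>simp_all add: gr_Suc\<close>)

lemma X_socle_part: "m \<le> n \<Longrightarrow> j < n \<Longrightarrow> x \<in> socle_part m k \<Longrightarrow> X j x \<in> socle_part m (Suc k)"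
  by (rule socle_part_map) (use X_gr[OF _ socle_part_gr] X_e module_hom.zero[OF lin_X] in \<open>simp_all add: gr_Suc\<close>)

lemma T_socle_cocycles:
  assumes "m \<le> n" "j < n" "x \<in> socle_cocycles m k"
  shows "T j x \<in> socle_cocycles m (Suc k)"
proof -
  have x: "x \<in> socle_part m k" "d x = 0" using assms(3) unfolding socle_cocycles_def by auto
  then have "d (T j x) = 0" using d_T[OF assms(2) socle_part_gr] module_hom.zero[OF lin_T[OF assms(2)]] by simp
  then show ?thesis using T_socle_part[OF assms(1,2) x(1)] unfolding socle_cocycles_def by blast
qed

lemma T_socle_coboundaries:
  assumes "m \<le> n" "j < n" "x \<in> socle_coboundaries m k"
  shows "T j x \<in> socle_coboundaries m (Suc k)"
proof (cases k)
  case 0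
  then have "T j x = d 0" using assms module_hom.zero[OF lin_T] d.zero by (simp add: socle_coboundaries_def)
  then show ?thesis unfolding socle_coboundaries_def using imageI[OF subspace_0[OF subspace_socle_part[OF assms(1)]], of d] by simp
next
  case (Suc k')
  then obtain y where y: "y \<in> socle_part m k'" "x = d y" using assms unfolding socle_coboundaries_def by auto
  have "T j x = d (- T j y)" using d_T[OF assms(2), of y] y unfolding socle_part_def by (auto simp: d.neg)
  moreover have "- T j y \<in> socle_part m k" using T_socle_part[OF assms(1,2) y(1)] Suc subspace_neg[OF subspace_socle_part] assms by simp
  ultimately show ?thesis unfolding socle_coboundaries_def by auto
qed

lemma T_T_socle_cocycles:
  assumes "m \<le> n" "j < n" "k < n" "x \<in> socle_cocycles m i"
  shows "T j (T k x) - T k (T j x) \<in> socle_coboundaries m (Suc (Suc i))"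
proof -
  have x: "x \<in> gr (int i)" "d x = 0" "\<And>j. j < m \<Longrightarrow> e j x = 0"
    using assms unfolding socle_cocycles_def socle_part_def by auto
  have "T j (T k x) - T k (T j x) = d (R j k x)"
    using T_T[OF assms(2,3) x(1)] x(2) module_hom.zero[OF lin_R] assms by simp
  moreover have "R j k x \<in> socle_part m (Suc i)"
  proof (rule socle_part_map[of x m i "R j k"])
    show "x \<in> socle_part m i" using assms(4) unfolding socle_cocycles_def by simp
    show "R j k x \<in> gr (int (Suc i))" using R_gr[OF assms(2,3) x(1)] by (simp add: gr_Suc)
    show "R j k 0 = 0" using module_hom.zero[OF lin_R[OF assms(2,3)]] .
    show "R j k (e t x) = e t (R j k x) \<or> R j k (e t x) = - e t (R j k x)" if "t < m" for t
      using R_e[OF assms(2,3), of t x] that assms(1) by simp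
  qed
  ultimately show ?thesis unfolding socle_coboundaries_def by simp
qed

text \<open>The connecting map of \<open>0 \<rightarrow> Q\<^sub>m\<^sub>+\<^sub>1 \<rightarrow> Q\<^sub>m \<rightarrow> Q\<^sub>m\<^sub>+\<^sub>1 \<rightarrow> 0\<close>, where \<open>Q\<^sub>m = socle_part m\<close> and the
  second map is \<open>e m\<close>, is \<open>T m\<close> up to sign.\<close>

lemma socle_connecting:
  assumes m: "m < n" and z: "z \<in> socle_cocycles (Suc m) (Suc k)" "z \<in> socle_coboundaries m (Suc k)"
  shows "\<exists>w\<in>socle_cocycles (Suc m) k. \<exists>b\<in>socle_coboundaries (Suc m) (Suc k). z = T m w + b"
proof -
  obtain y where y: "y \<in> socle_part m k" "z = d y" using z(2) unfolding socle_coboundaries_def by auto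
  have yg: "y \<in> gr (int k)" "\<And>j. j < m \<Longrightarrow> e j y = 0" using y(1) unfolding socle_part_def by auto
  have ez: "e m z = 0" "d z = 0" using z(1) unfolding socle_cocycles_def socle_part_def by auto
  have ey: "e m y \<in> socle_part (Suc m) k"
    unfolding socle_part_def using e_gr[OF m yg(1)] e_e_eq_0[OF _ m] e_sq[OF m] yg(2) m by (auto simp: less_Suc_eq)
  have "e j (e m (c m y)) = 0" if "j < Suc m" for j
  proof (cases "j = m")
    case False
    then have j: "j < m" "j < n" using that m by auto
    have "e j (c m y) = - c m (e j y)" using c_e[OF m j(2), of y] j(1) by simp
    then have "e j (c m y) = 0" using yg(2)[OF j(1)] c_0[OF m] by simp
    then show ?thesis using e_e_eq_0[OF j(2) m] by simp
  qed (use e_sq m in simp)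
  then have ecy: "e m (c m y) \<in> socle_part (Suc m) k"
    unfolding socle_part_def using e_gr[OF m c_gr[OF m yg(1)]] by blast
  have "y = c m (e m y) + e m (c m y)" using c_e[OF m m, of y] by simp
  then have "z = d (c m (e m y)) + d (e m (c m y))" using y(2) d.add by metis
  also have "d (c m (e m y)) = c m (d (e m y)) - T m (e m y)" unfolding bracket_def by simp
  also have "d (e m y) = 0" using d_e[OF m] y(2) ez by simp
  finally have "z = - T m (e m y) + d (e m (c m y))" using c_0[OF m] by simp
  then have "z = T m (- e m y) + d (e m (c m y))" using module_hom.neg[OF lin_T[OF m]] by simp
  moreover have "- e m y \<in> socle_cocycles (Suc m) k"
    using subspace_neg[OF subspace_socle_part[of "Suc m"] ey] m \<open>d (e m y) = 0\<close> unfolding socle_cocycles_def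
    by (simp add: d.neg)
  moreover have "d (e m (c m y)) \<in> socle_coboundaries (Suc m) (Suc k)"
    unfolding socle_coboundaries_def using ecy by simp
  ultimately show ?thesis by blast
qed

text \<open>Exactness of d is used only for m = 0, where it says that high degrees of homology
  vanish. In the step, \<open>Y\<close> represents the image of \<open>T m\<close>; by
  \<open>socle_connecting\<close> it contains the kernel of the map from the homology of Q_(m+1) to
  that of Q_m, so generation can be pulled back from the induction hypothesis.\<close>

lemma noetherian_socle_homology:
  assumes exact: "\<And>k x. k \<ge> K \<Longrightarrow> x \<in> gr (int (Suc k)) \<Longrightarrow> d x = 0 \<Longrightarrow> x \<in> d ` gr (int k)"
  shows "m \<le> n \<Longrightarrow> noetherian_pair m T (socle_cocycles m) (socle_coboundaries m)"
proof (induction m)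
  case 0
  show ?case unfolding noetherian_pair_def
  proof (intro allI impI, elim conjE)
    fix U assume *: "\<forall>k. socle_coboundaries 0 k \<subseteq> U k \<and> U k \<subseteq> socle_cocycles 0 k"
    have "u \<in> socle_coboundaries 0 (Suc k)" if k: "k \<ge> K" "u \<in> U (Suc k)" for k u
    proof -
      have "u \<in> socle_cocycles 0 (Suc k)" using * k(2) by blast
      then have "u \<in> d ` gr (int k)" using exact[OF k(1)] unfolding socle_cocycles_def socle_part_def by simp
      then show ?thesis unfolding socle_coboundaries_def socle_part_def by simp
    qed
    then show "\<exists>N. \<forall>k\<ge>N. \<forall>u\<in>U (Suc k). \<exists>b\<in>socle_coboundaries 0 (Suc k). \<exists>v. (\<forall>j<0. v j \<in> U k) \<and> u = b + (\<Sum>j<0. T j (v j))"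
      by auto
  qed
next
  case (Suc m)
  then have m: "m < n" "m \<le> n" "Suc m \<le> n" by auto
  define Y where "Y k = (case k of 0 \<Rightarrow> socle_coboundaries (Suc m) 0
    | Suc k \<Rightarrow> {T m w + b | w b. w \<in> socle_cocycles (Suc m) k \<and> b \<in> socle_coboundaries (Suc m) (Suc k)})" for k
  have fd: "finite_dim (socle_cocycles (Suc m) k)" for k
    by (rule finite_dim_subset[OF fd_gr[of "int k"]]) (auto simp: socle_cocycles_def socle_part_def)
  have YS: "Y (Suc k) = {T m w + b | w b. w \<in> socle_cocycles (Suc m) k \<and> b \<in> socle_coboundaries (Suc m) (Suc k)}" for k
    unfolding Y_def by simp
  have coc_mono: "socle_cocycles (Suc m) k \<subseteq> socle_cocycles m k" for k
    unfolding socle_cocycles_def socle_part_def by auto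
  have "noetherian_pair m T (socle_cocycles (Suc m)) Y"
    unfolding noetherian_pair_def
  proof (intro allI impI, elim conjE)
    fix U assume subU: "\<forall>k. subspace (U k)" and TU: "\<forall>k. \<forall>j<m. \<forall>u\<in>U k. T j u \<in> U (Suc k)"
      and YUZ: "\<forall>k. Y k \<subseteq> U k \<and> U k \<subseteq> socle_cocycles (Suc m) k"
    \<comment> \<open>The image of \<open>U\<close> in the homology of Q_m, represented by cocycles
      of Q_m.\<close>
    define U' where "U' k = {u + b | u b. u \<in> U k \<and> b \<in> socle_coboundaries m k}" for k
    obtain N where N: "\<And>k u. N \<le> k \<Longrightarrow> u \<in> U' (Suc k) \<Longrightarrow>
        \<exists>b\<in>socle_coboundaries m (Suc k). \<exists>v. (\<forall>j<m. v j \<in> U' k) \<and> u = b + (\<Sum>j<m. T j (v j))"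
    proof (rule noetherian_pairD[OF Suc.IH[OF m(2)], of U'])
      show "subspace (U' k)" for k unfolding U'_def
        using subspace_sums subU subspace_socle_coboundaries m by blast
      show "T j u \<in> U' (Suc k)" if "j < m" "u \<in> U' k" for k j u
        using that TU T_socle_coboundaries[OF m(2), of j] module_hom.add[OF lin_T, of j] m unfolding U'_def by fastforce
      show "socle_coboundaries m k \<subseteq> U' k" for k
      proof
        fix b assume "b \<in> socle_coboundaries m k"
        moreover have "b = 0 + b" "0 \<in> U k" using subspace_0 subU by auto
        ultimately show "b \<in> U' k" unfolding U'_def by blast
      qed
      show "U' k \<subseteq> socle_cocycles m k" for k
        unfolding U'_def using YUZ coc_mono socle_coboundaries_cocycles[OF m(2)]
          subspace_add[OF subspace_socle_cocycles[OF m(2)]] by blast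
    qed blast
    have "\<exists>b\<in>Y (Suc k). \<exists>v. (\<forall>j<m. v j \<in> U k) \<and> u = b + (\<Sum>j<m. T j (v j))"
      if k: "k \<ge> N" and u: "u \<in> U (Suc k)" for k u
    proof -
      have "u = u + 0" "0 \<in> socle_coboundaries m (Suc k)" using subspace_0[OF subspace_socle_coboundaries[OF m(2)]] by auto
      then have "u \<in> U' (Suc k)" unfolding U'_def using u by blast
      then obtain b v where b: "b \<in> socle_coboundaries m (Suc k)" "\<And>j. j < m \<Longrightarrow> v j \<in> U' k" "u = b + (\<Sum>j<m. T j (v j))"
        using N k by metis
      have "\<exists>a y. v j = a + y \<and> a \<in> U k \<and> y \<in> socle_coboundaries m k" if "j < m" for j using b(2)[OF that] unfolding U'_def by blast
      then obtain a y where ay: "\<And>j. j < m \<Longrightarrow> v j = a j + y j" "\<And>j. j < m \<Longrightarrow> a j \<in> U k" "\<And>j. j < m \<Longrightarrow> y j \<in> socle_coboundaries m k"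
        by metis
      \<comment> \<open>All coboundaries of Q_m are collected in b'. As a difference of elements of
        \<open>U\<close> it is also a cocycle of Q_(m+1), and the connecting lemma places it in
        \<open>Y\<close>.\<close>
      define b' where "b' = b + (\<Sum>j<m. T j (y j))"
      have "(\<Sum>j<m. T j (v j)) = (\<Sum>j<m. T j (a j)) + (\<Sum>j<m. T j (y j))"
        unfolding sum.distrib[symmetric] using ay(1) module_hom.add[OF lin_T] m by (intro sum.cong) simp_all
      then have ub: "u = b' + (\<Sum>j<m. T j (a j))" using b(3) unfolding b'_def by (simp add: algebra_simps)
      have "(\<Sum>j<m. T j (y j)) \<in> socle_coboundaries m (Suc k)"
        by (rule subspace_sum[OF subspace_socle_coboundaries[OF m(2)]]) (use ay(3) T_socle_coboundaries m in auto)
      then have "b' \<in> socle_coboundaries m (Suc k)" unfolding b'_def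
        using b(1) subspace_add[OF subspace_socle_coboundaries[OF m(2)]] by blast
      moreover have "(\<Sum>j<m. T j (a j)) \<in> U (Suc k)" by (rule subspace_sum) (use subU TU ay(2) in auto)
      then have "b' \<in> U (Suc k)" using u ub subspace_diff subU by (metis add_diff_cancel_right')
      then have "b' \<in> socle_cocycles (Suc m) (Suc k)" using YUZ by blast
      ultimately have "b' \<in> Y (Suc k)" unfolding YS using socle_connecting[OF m(1)] by blast
      then show ?thesis using ub ay(2) by blast
    qed
    then show "\<exists>N. \<forall>k\<ge>N. \<forall>u\<in>U (Suc k). \<exists>b\<in>Y (Suc k). \<exists>v. (\<forall>j<m. v j \<in> U k) \<and> u = b + (\<Sum>j<m. T j (v j))"
      by blast
  qed
  moreover have "Y 0 = socle_coboundaries (Suc m) 0" unfolding Y_def by simp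
  ultimately show ?case
    using m socle_coboundaries_cocycles[OF m(3)] T_T_socle_cocycles[OF m(3)]
    by (intro noetherian_pair_Suc[of m T "socle_cocycles (Suc m)" "socle_coboundaries (Suc m)" Y])
      (simp_all add: lin_T subspace_socle_cocycles subspace_socle_coboundaries T_socle_cocycles T_socle_coboundaries fd YS)
qed

text \<open>The filtration is climbed from the socle Q_n to the whole complex Q_0, hence the index n
  - m. As \<open>e m\<close> maps Q_m into Q_(m+1) with kernel Q_(m+1), the layer between them is a
  copy of a submodule of Q_(m+1), and the layers are assembled by
  \<open>noetherian_pair_trans\<close>.\<close>

lemma noetherian_socle_part:
  assumes "noetherian_pair n T (socle_cocycles n) (socle_coboundaries n)" "m \<le> n"
  shows "noetherian_pair n X (socle_part (n - m)) (\<lambda>_. {0})"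
  using assms(2)
proof (induction m)
  case 0
  \<comment> \<open>Here d is exchanged for l. On the socle d vanishes, so homology is the socle
    itself, and \<open>T j\<close> reduces to - d c j, which equals - l c j by the assumption
    \<open>socle\<close>.\<close>
  have soc: "d x = 0" "\<And>j. j < n \<Longrightarrow> T j x = X j x" if "x \<in> socle_part n k" for x k
    using socle[of x "int k"] that c_0 unfolding socle_part_def bracket_def by auto
  have "socle_cocycles n = socle_part n" unfolding socle_cocycles_def using soc by auto
  moreover have "socle_coboundaries n k \<subseteq> {0}" for k
    unfolding socle_coboundaries_def using soc by (auto split: nat.splits)
  then have "socle_coboundaries n = (\<lambda>_. {0})"
    using subspace_0[OF subspace_socle_coboundaries[of n]] by blast
  ultimately have N: "noetherian_pair n T (socle_part n) (\<lambda>_. {0})" using assms(1) by simp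
  show ?case unfolding noetherian_pair_def
  proof (intro allI impI, elim conjE)
    fix U assume subU: "\<forall>k. subspace (U k)" and XU: "\<forall>k. \<forall>j<n. \<forall>u\<in>U k. X j u \<in> U (Suc k)"
      and *: "\<forall>k. {0} \<subseteq> U k \<and> U k \<subseteq> socle_part (n - 0) k"
    have TX: "T j u = X j u" if ju: "j < n" "u \<in> U k" for j u k
    proof -
      have "u \<in> socle_part n k" using ju(2) * by auto
      then show ?thesis using soc(2) ju(1) by blast
    qed
    have TU: "T j u \<in> U (Suc k)" if "j < n" "u \<in> U k" for j u k using TX[OF that] XU that by simp
    obtain N where N: "\<And>k u. N \<le> k \<Longrightarrow> u \<in> U (Suc k) \<Longrightarrow>
        \<exists>b\<in>{0}. \<exists>v. (\<forall>j<n. v j \<in> U k) \<and> u = b + (\<Sum>j<n. T j (v j))"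
    proof (rule noetherian_pairD[OF N, of U])
      show "subspace (U k)" for k using subU by blast
      show "T j u \<in> U (Suc k)" if "j < n" "u \<in> U k" for k j u using TU that .
      show "{0} \<subseteq> U k" for k using * by blast
      show "U k \<subseteq> socle_part n k" for k using * by simp
    qed blast
    have "\<exists>b\<in>{0}. \<exists>v. (\<forall>j<n. v j \<in> U k) \<and> u = b + (\<Sum>j<n. X j (v j))" if ku: "k \<ge> N" "u \<in> U (Suc k)" for k u
    proof -
      obtain v where v: "\<forall>j<n. v j \<in> U k" "u = 0 + (\<Sum>j<n. T j (v j))" using N[OF ku] by blast
      have "(\<Sum>j<n. T j (v j)) = (\<Sum>j<n. X j (v j))" using v(1) TX[of _ _ k] by (intro sum.cong) simp_all
      then show ?thesis using v by auto
    qed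
    then show "\<exists>N. \<forall>k\<ge>N. \<forall>u\<in>U (Suc k). \<exists>b\<in>{0}. \<exists>v. (\<forall>j<n. v j \<in> U k) \<and> u = b + (\<Sum>j<n. X j (v j))"
      by blast
  qed
next
  case (Suc m')
  define m where "m = n - Suc m'"
  have m: "m < n" "m \<le> n" "Suc m \<le> n" "n - m' = Suc m" using Suc.prems m_def by auto
  have N: "noetherian_pair n X (socle_part (Suc m)) (\<lambda>_. {0})" using Suc m by simp
  have e_Q: "e m u \<in> socle_part (Suc m) k" if "u \<in> socle_part m k" for u k
    using that e_gr[OF m(1)] e_e_eq_0[OF _ m(1)] e_sq[OF m(1)] m(1) unfolding socle_part_def
    by (auto simp: less_Suc_eq)
  have mono: "socle_part (Suc m) k \<subseteq> socle_part m k" for k unfolding socle_part_def by auto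
  have "noetherian_pair n X (socle_part m) (socle_part (Suc m))"
    unfolding noetherian_pair_def
  proof (intro allI impI, elim conjE)
    fix U assume subU: "\<forall>k. subspace (U k)" and XU: "\<forall>k. \<forall>j<n. \<forall>u\<in>U k. X j u \<in> U (Suc k)"
      and QU: "\<forall>k. socle_part (Suc m) k \<subseteq> U k \<and> U k \<subseteq> socle_part m k"
    obtain N where N: "\<And>k u. N \<le> k \<Longrightarrow> u \<in> e m ` U (Suc k) \<Longrightarrow>
        \<exists>b\<in>{0}. \<exists>v. (\<forall>j<n. v j \<in> e m ` U k) \<and> u = b + (\<Sum>j<n. X j (v j))"
    proof (rule noetherian_pairD[OF N, of "\<lambda>k. e m ` U k"])
      show sub: "subspace (e m ` U k)" for k using module_hom.subspace_image[OF lin_e[OF m(1)]] subU by blast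
      show "X j u \<in> e m ` U (Suc k)" if j: "j < n" and u: "u \<in> e m ` U k" for k j u
      proof -
        obtain a where "a \<in> U k" "u = e m a" using u by blast
        then have "X j u = - e m (X j a)" "X j a \<in> U (Suc k)" using X_e j m XU by auto
        then show ?thesis using subspace_neg[OF sub] by simp
      qed
      show "{0} \<subseteq> e m ` U k" for k using subspace_0[OF sub] by blast
      show "e m ` U k \<subseteq> socle_part (Suc m) k" for k using QU e_Q by blast
    qed blast
    have "\<exists>b\<in>socle_part (Suc m) (Suc k). \<exists>v. (\<forall>j<n. v j \<in> U k) \<and> u = b + (\<Sum>j<n. X j (v j))"
      if k: "k \<ge> N" and u: "u \<in> U (Suc k)" for k u
    proof -
      obtain v where v: "\<forall>j<n. v j \<in> e m ` U k" "e m u = 0 + (\<Sum>j<n. X j (v j))"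
        using N[OF k imageI[OF u]] by blast
      have "\<forall>j<n. \<exists>y. y \<in> U k \<and> v j = e m y" using v(1) by blast
      then obtain w where w: "\<And>j. j < n \<Longrightarrow> w j \<in> U k" "\<And>j. j < n \<Longrightarrow> v j = e m (w j)"
        by metis
      \<comment> \<open>The plus sign comes from anticommutation: v j = e m (w j) gives X j (v j) =
        - e m (X j (w j)), so this b is annihilated by \<open>e m\<close> and lies in
        Q_(m+1).\<close>
      define b where "b = u + (\<Sum>j<n. X j (w j))"
      have "(\<Sum>j<n. X j (v j)) = (\<Sum>j<n. - e m (X j (w j)))"
        using w(2) X_e[OF _ m(1)] by (intro sum.cong) simp_all
      also have "\<dots> = - e m (\<Sum>j<n. X j (w j))"
        by (simp add: module_hom.sum[OF lin_e[OF m(1)]] sum_negf)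
      finally have "(\<Sum>j<n. X j (v j)) = - e m (\<Sum>j<n. X j (w j))" .
      then have "e m b = 0" unfolding b_def using v(2) e_add[OF m(1)] by simp
      moreover have "(\<Sum>j<n. X j (w j)) \<in> U (Suc k)" by (rule subspace_sum) (use subU XU w(1) in auto)
      then have bU: "b \<in> U (Suc k)" unfolding b_def using u subspace_add subU by blast
      then have "b \<in> socle_part m (Suc k)" using QU by blast
      ultimately have "b \<in> socle_part (Suc m) (Suc k)" unfolding socle_part_def by (simp add: less_Suc_eq)
      moreover have "u = b + (\<Sum>j<n. X j (- w j))"
        unfolding b_def by (simp add: module_hom.neg[OF lin_X] sum_negf)
      moreover have "\<forall>j<n. - w j \<in> U k" using w(1) subspace_neg subU by blast
      ultimately show ?thesis by (intro bexI[of _ b] exI[of _ "\<lambda>j. - w j"]) blast+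
    qed
    then show "\<exists>N. \<forall>k\<ge>N. \<forall>u\<in>U (Suc k). \<exists>b\<in>socle_part (Suc m) (Suc k). \<exists>v. (\<forall>j<n. v j \<in> U k) \<and> u = b + (\<Sum>j<n. X j (v j))"
      by blast
  qed
  then have "noetherian_pair n X (socle_part m) (\<lambda>_. {0})"
    using N m mono subspace_0[OF subspace_socle_part[OF m(3)]]
    by (intro noetherian_pair_trans[of n X "socle_part m" "socle_part (Suc m)" "\<lambda>_. {0}"])
      (simp_all add: lin_X subspace_socle_part X_socle_part)
  then show ?case unfolding m_def .
qed

theorem linear_part_eventually_exact_right:
  assumes exact: "\<And>k x. k \<ge> K \<Longrightarrow> x \<in> gr (int (Suc k)) \<Longrightarrow> d x = 0 \<Longrightarrow> x \<in> d ` gr (int k)"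
  shows "\<exists>N. \<forall>k\<ge>N. \<forall>x\<in>gr (int (Suc k)). l x = 0 \<longrightarrow> x \<in> l ` gr (int k)"
proof -
  have "noetherian_pair n X (socle_part (n - n)) (\<lambda>_. {0})"
    by (rule noetherian_socle_part[OF noetherian_socle_homology[OF exact]]) auto
  then have N: "noetherian_pair n X (\<lambda>k. gr (int k)) (\<lambda>_. {0})"
    by (simp add: socle_part_def[abs_def])
  have X_kernel: "X j z = l (- c j z)" if "l z = 0" "j < n" for j z
    unfolding bracket_def using that c_0 by (simp add: l.neg)
  obtain N where N: "\<And>k u. N \<le> k \<Longrightarrow> u \<in> {x \<in> gr (int (Suc k)). l x = 0} \<Longrightarrow>
     \<exists>b\<in>{0}. \<exists>v. (\<forall>j<n. v j \<in> {x \<in> gr (int k). l x = 0}) \<and> u = b + (\<Sum>j<n. X j (v j))"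
  proof (rule noetherian_pairD[OF N, of "\<lambda>k. {x \<in> gr (int k). l x = 0}"])
    show "subspace {x \<in> gr (int k). l x = 0}" for k
      by (rule subspaceI) (auto simp: gr_0 gr_add l.zero l.add l.scale subspace_scale sub_gr)
    show "X j u \<in> {x \<in> gr (int (Suc k)). l x = 0}" if "j < n" "u \<in> {x \<in> gr (int k). l x = 0}" for k j u
      using that X_gr[of j u "int k"] X_kernel l_l[OF gr_neg[OF c_gr]] by (auto simp: add.commute)
  qed (auto simp: gr_0 l.zero)
  have "x \<in> l ` gr (int k)" if k: "k \<ge> N" and x: "x \<in> gr (int (Suc k))" "l x = 0" for k x
  proof -
    obtain v where v: "\<And>j. j < n \<Longrightarrow> v j \<in> gr (int k)" "\<And>j. j < n \<Longrightarrow> l (v j) = 0" "x = (\<Sum>j<n. X j (v j))"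
      using N[OF k, of x] x by auto
    have "x = l (\<Sum>j<n. - c j (v j))" using v(3) X_kernel[OF v(2)] by (simp add: l.sum)
    moreover have "(\<Sum>j<n. - c j (v j)) \<in> gr (int k)"
      using v(1) by (intro subspace_sum[OF sub_gr]) (simp add: gr_neg c_gr)
    ultimately show ?thesis by blast
  qed
  then show ?thesis by blast
qed

section \<open>Free side: quotients by partial ideals\<close>

lemma gr_uminus_Suc: "gr (- int (Suc k) + 1) = gr (- int k)" "ideal_part m (- int (Suc k) + 1) = ideal_part m (- int k)"
  by simp_all

text \<open>Cycles of the quotient by \<open>ideal_part m\<close>, represented by their preimages in
  the complex itself. The index k stands for cohomological degree - k, so that d and the operators
  \<open>T j\<close> lower it.\<close>

definition radical_cycles :: "nat \<Rightarrow> nat \<Rightarrow> 'w set" where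
  "radical_cycles m k = {x \<in> gr (- int k). d x \<in> ideal_part m (- int k + 1)}"

definition radical_boundaries :: "nat \<Rightarrow> nat \<Rightarrow> 'w set" where
  "radical_boundaries m k = {d y + a | y a. y \<in> gr (- int (Suc k)) \<and> a \<in> ideal_part m (- int k)}"

lemma subspace_radical_cycles:
  assumes "m \<le> n" shows "subspace (radical_cycles m k)"
proof -
  have "radical_cycles m k = gr (- int k) \<inter> {x. d x \<in> ideal_part m (- int k + 1)}"
    unfolding radical_cycles_def by blast
  then show ?thesis
    using subspace_inter[OF sub_gr d.subspace_linear_preimage[OF subspace_ideal_part[OF assms]]] by metis
qed

lemma subspace_radical_boundaries: "m \<le> n \<Longrightarrow> subspace (radical_boundaries m k)"
  unfolding radical_boundaries_def by (rule subspace_plus_image[OF sub_gr subspace_ideal_part lin_d])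

lemma ideal_part_radical_boundaries: "m \<le> n \<Longrightarrow> ideal_part m (- int k) \<subseteq> radical_boundaries m k"
proof
  fix a assume "a \<in> ideal_part m (- int k)"
  moreover have "a = d 0 + a" by (simp add: d.zero)
  ultimately show "a \<in> radical_boundaries m k" unfolding radical_boundaries_def using gr_0 by blast
qed

lemma d_ideal_part: "m \<le> n \<Longrightarrow> x \<in> ideal_part m i \<Longrightarrow> d x \<in> ideal_part m (i + 1)"
  by (rule ideal_part_map[OF lin_d d_gr]) (use d_e in auto)

lemma T_ideal_part:
  assumes "m \<le> n" "j < n" "x \<in> ideal_part m i" shows "T j x \<in> ideal_part m (i + 1)"
  by (rule ideal_part_map[OF lin_T T_gr _ assms(3)]) (use assms T_e e_neg in auto)

lemma X_ideal_part:
  assumes "m \<le> n" "j < n" "x \<in> ideal_part m i" shows "X j x \<in> ideal_part m (i + 1)"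
  by (rule ideal_part_map[OF lin_X X_gr _ assms(3)]) (use assms X_e e_neg in auto)

lemma R_ideal_part:
  assumes "m \<le> n" "j < n" "k < n" "x \<in> ideal_part m i" shows "R j k x \<in> ideal_part m (i + 1)"
  by (rule ideal_part_map[OF lin_R R_gr _ assms(4)]) (use assms R_e in auto)

lemma radical_boundaries_cycles:
  assumes "m \<le> n" shows "radical_boundaries m k \<subseteq> radical_cycles m k"
proof
  fix x assume "x \<in> radical_boundaries m k"
  then obtain y a where y: "y \<in> gr (- int (Suc k))" "a \<in> ideal_part m (- int k)" "x = d y + a"
    unfolding radical_boundaries_def by blast
  have "d y \<in> gr (- int k)" "a \<in> gr (- int k)"
    using d_gr[OF y(1)] ideal_part_gr[OF assms] y(2) by (auto simp: gr_uminus_Suc)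
  moreover have "d x = d a" using y(3) d_d[OF y(1)] by (simp add: d.add)
  ultimately show "x \<in> radical_cycles m k"
    unfolding radical_cycles_def using y gr_add d_ideal_part[OF assms y(2)] by simp
qed

lemma T_radical_cycles:
  assumes "m \<le> n" "j < n" "x \<in> radical_cycles m (Suc k)"
  shows "T j x \<in> radical_cycles m k"
proof -
  have x: "x \<in> gr (- int (Suc k))" "d x \<in> ideal_part m (- int (Suc k) + 1)"
    using assms(3) unfolding radical_cycles_def by auto
  have "T j (d x) \<in> ideal_part m (- int k + 1)" using T_ideal_part[OF assms(1,2) x(2)] by simp
  then have "d (T j x) \<in> ideal_part m (- int k + 1)"
    using d_T[OF assms(2) x(1)] subspace_neg[OF subspace_ideal_part[OF assms(1)]] by simp
  then show ?thesis unfolding radical_cycles_def using T_gr[OF assms(2) x(1)] by simp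
qed

lemma T_radical_boundaries:
  assumes "m \<le> n" "j < n" "x \<in> radical_boundaries m (Suc k)"
  shows "T j x \<in> radical_boundaries m k"
proof -
  obtain y a where y: "y \<in> gr (- int (Suc (Suc k)))" "a \<in> ideal_part m (- int (Suc k))" "x = d y + a"
    using assms(3) unfolding radical_boundaries_def by blast
  have "T j x = d (- T j y) + T j a"
    using d_T[OF assms(2) y(1)] y(3) module_hom.add[OF lin_T[OF assms(2)]] by (simp add: d.neg)
  moreover have "- T j y \<in> gr (- int (Suc k))" using gr_neg[OF T_gr[OF assms(2) y(1)]] by (simp add: gr_uminus_Suc)
  moreover have "T j a \<in> ideal_part m (- int k)" using T_ideal_part[OF assms(1,2) y(2)] by simp
  ultimately show ?thesis unfolding radical_boundaries_def by blast
qed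

lemma T_T_radical_cycles:
  assumes "m \<le> n" "j < n" "i < n" "x \<in> radical_cycles m (Suc (Suc k))"
  shows "T j (T i x) - T i (T j x) \<in> radical_boundaries m k"
proof -
  have x: "x \<in> gr (- int (Suc (Suc k)))" "d x \<in> ideal_part m (- int (Suc (Suc k)) + 1)"
    using assms(4) unfolding radical_cycles_def by auto
  have "R j i x \<in> gr (- int (Suc k))" using R_gr[OF assms(2,3) x(1)] by (simp add: gr_uminus_Suc)
  moreover have "R j i (d x) \<in> ideal_part m (- int k)" using R_ideal_part[OF assms(1-3) x(2)] by simp
  ultimately show ?thesis unfolding T_T[OF assms(2,3) x(1)] radical_boundaries_def by blast
qed

text \<open>The kernel of \<open>T m\<close> on the homology of \<open>G / I\<^sub>m\<^sub>+\<^sub>1\<close>, where \<open>I\<^sub>m = ideal_part m\<close>, comes from the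
  homology of \<open>G / I\<^sub>m\<close>.\<close>

lemma radical_connecting:
  assumes m: "m < n" and z: "z \<in> radical_cycles (Suc m) (Suc k)" and Tz: "T m z \<in> radical_boundaries (Suc m) k"
  shows "\<exists>w\<in>radical_cycles m (Suc k). z - w \<in> ideal_part (Suc m) (- int (Suc k))"
proof -
  have zg: "z \<in> gr (- int (Suc k))" and dz: "d z \<in> ideal_part (Suc m) (- int (Suc k) + 1)"
    using z unfolding radical_cycles_def by auto
  then obtain y i2 where y: "y \<in> gr (- int k)" "i2 \<in> ideal_part m (- int k)" "d z = e m y + i2" by auto
  obtain b i0 where b: "b \<in> gr (- int (Suc k))" "i0 \<in> ideal_part (Suc m) (- int k)" "T m z = d b + i0"
    using Tz unfolding radical_boundaries_def by blast
  obtain a i1 where a: "a \<in> gr (- int k)" "i1 \<in> ideal_part m (- int k)" "i0 = e m a + i1" using b(2) by auto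
  define w where "w = z - e m (c m z + b)"
  have mn: "m \<le> n" using m by simp
  have "c m (d z) = y - e m (c m y) + c m i2" using y(3) c_add[OF m] c_e[OF m m] by simp
  moreover have "c m (d z) = d (c m z) + d b + e m a + i1" using b(3) a(3) unfolding bracket_def by (simp add: algebra_simps)
  ultimately have "y = d (c m z + b) + e m (a + c m y) + (i1 - c m i2)"
    using e_add[OF m] by (simp add: d.add algebra_simps)
  then have "e m y = e m (d (c m z + b) + e m (a + c m y) + (i1 - c m i2))" by simp
  then have "e m y = d (e m (c m z + b)) + e m (i1 - c m i2)"
    using e_add[OF m] e_sq[OF m] d_e[OF m] by (simp add: d.add)
  then have "d w = i2 + e m (i1 - c m i2)" unfolding w_def using y(3) by (simp add: d.diff)
  moreover have "i1 - c m i2 \<in> ideal_part m (- int k)"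
    using subspace_diff[OF subspace_ideal_part[OF mn] a(2) c_ideal_part[OF order_refl m y(2)]] .
  then have "i2 + e m (i1 - c m i2) \<in> ideal_part m (- int k)"
    using subspace_add[OF subspace_ideal_part[OF mn] y(2) e_ideal_part[OF m mn]] by blast
  moreover have cb: "c m z + b \<in> gr (- int (Suc k))" using gr_add c_gr[OF m zg] b(1) by blast
  then have "w \<in> gr (- int (Suc k))" unfolding w_def using gr_diff zg e_gr[OF m] by blast
  ultimately have "w \<in> radical_cycles m (Suc k)" unfolding radical_cycles_def by simp
  moreover have "z - w \<in> ideal_part (Suc m) (- int (Suc k))"
    unfolding w_def using e_ideal_part_Suc[OF m cb] by simp
  ultimately show ?thesis by blast
qed

text \<open>\<open>Y\<close> represents the kernel of \<open>T m\<close> on the homology modulo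
  \<open>ideal_part (Suc m)\<close>. It is handled by the induction hypothesis through
  \<open>radical_connecting\<close>, and \<open>artinian_pair_Suc\<close> extends the result to all
  of the homology. Since \<open>gr 1\<close> is zero, \<open>T m\<close> vanishes in degree 0 and
  \<open>Y 0\<close> consists of all cycles.\<close>

lemma artinian_radical_homology:
  assumes exact: "\<And>k x. k \<ge> K \<Longrightarrow> x \<in> gr (- int k) \<Longrightarrow> d x = 0 \<Longrightarrow> x \<in> d ` gr (- int (Suc k))"
    and gr1: "gr 1 = {0}"
  shows "m \<le> n \<Longrightarrow> artinian_pair m T (radical_cycles m) (radical_boundaries m)"
proof (induction m)
  case 0
  show ?case unfolding artinian_pair_def
  proof (intro allI impI, elim conjE)
    fix U assume *: "\<forall>k. radical_boundaries 0 k \<subseteq> U k \<and> U k \<subseteq> radical_cycles 0 k"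
    have "z \<in> U (Suc k)" if k: "k \<ge> K" "z \<in> radical_cycles 0 (Suc k)" for k z
    proof -
      have "z \<in> d ` gr (- int (Suc (Suc k)))" using exact[of "Suc k" z] k unfolding radical_cycles_def by simp
      then obtain y where "y \<in> gr (- int (Suc (Suc k)))" "z = d y + 0" by auto
      then have "z \<in> radical_boundaries 0 (Suc k)" unfolding radical_boundaries_def ideal_part.simps by blast
      then show ?thesis using * by blast
    qed
    then show "\<exists>N. \<forall>k\<ge>N. \<forall>z\<in>radical_cycles 0 (Suc k). (\<forall>j<0. T j z \<in> U k) \<longrightarrow> z \<in> U (Suc k)"
      by blast
  qed
next
  case (Suc m)
  then have m: "m < n" "m \<le> n" "Suc m \<le> n" by auto
  define Y where "Y k = (case k of 0 \<Rightarrow> radical_cycles (Suc m) 0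
    | Suc k \<Rightarrow> {w \<in> radical_cycles (Suc m) (Suc k). T m w \<in> radical_boundaries (Suc m) k})" for k
  have Y0: "Y 0 = radical_cycles (Suc m) 0"
    and YS: "Y (Suc k) = {w \<in> radical_cycles (Suc m) (Suc k). T m w \<in> radical_boundaries (Suc m) k}" for k
    unfolding Y_def by simp_all
  have fd: "finite_dim (radical_cycles (Suc m) k)" for k
    by (rule finite_dim_subset[OF fd_gr[of "- int k"]]) (auto simp: radical_cycles_def)
  have T0: "T j w = 0" if "j \<le> m" "w \<in> radical_cycles (Suc m) 0" for j w
  proof -
    have "T j w \<in> gr (0 + 1)" using that m by (intro T_gr) (auto simp: radical_cycles_def)
    then show ?thesis using gr1 by simp
  qed
  have bd_mono: "radical_boundaries m k \<subseteq> radical_boundaries (Suc m) k" for k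
    unfolding radical_boundaries_def using ideal_part_Suc[OF m(1)] by blast
  have "artinian_pair m T Y (radical_boundaries (Suc m))"
    unfolding artinian_pair_def
  proof (intro allI impI, elim conjE)
    fix U assume subU: "\<forall>k. subspace (U k)" and TU: "\<forall>k. \<forall>j<m. \<forall>u\<in>U (Suc k). T j u \<in> U k"
      and BUY: "\<forall>k. radical_boundaries (Suc m) k \<subseteq> U k \<and> U k \<subseteq> Y k"
    obtain N where N: "\<And>k z. N \<le> k \<Longrightarrow> z \<in> radical_cycles m (Suc k) \<Longrightarrow>
        (\<And>j. j < m \<Longrightarrow> T j z \<in> U k \<inter> radical_cycles m k) \<Longrightarrow> z \<in> U (Suc k) \<inter> radical_cycles m (Suc k)"
    proof (rule artinian_pairD[OF Suc.IH[OF m(2)], of "\<lambda>k. U k \<inter> radical_cycles m k"])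
      show "subspace (U k \<inter> radical_cycles m k)" for k
        using subspace_inter subU subspace_radical_cycles[OF m(2)] by blast
      show "T j u \<in> U k \<inter> radical_cycles m k" if "j < m" "u \<in> U (Suc k) \<inter> radical_cycles m (Suc k)" for k j u
        using that TU T_radical_cycles[OF m(2), of j] m by simp
      show "radical_boundaries m k \<subseteq> U k \<inter> radical_cycles m k" for k
        using bd_mono BUY radical_boundaries_cycles[OF m(2)] by blast
    qed blast+
    have "z \<in> U (Suc k)" if k: "k \<ge> N" and z: "z \<in> Y (Suc k)" and Tz: "\<forall>j<m. T j z \<in> U k" for k z
    proof -
      \<comment> \<open>The correction z - w lies in the larger ideal, hence among the boundaries
        and in \<open>U\<close>. So z may be replaced by w, a cycle modulo the smaller ideal, to
        which the induction hypothesis applies.\<close>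
      obtain w where w: "w \<in> radical_cycles m (Suc k)" "z - w \<in> ideal_part (Suc m) (- int (Suc k))"
        using radical_connecting[OF m(1)] z YS by blast
      have zwU: "z - w \<in> U (Suc k)" using w(2) ideal_part_radical_boundaries[OF m(3)] BUY by blast
      have "T j w \<in> U k \<inter> radical_cycles m k" if j: "j < m" for j
      proof -
        have "T j (z - w) \<in> U k" using TU zwU j by blast
        then have "T j z - T j (z - w) \<in> U k" using Tz j subspace_diff subU by blast
        then have "T j w \<in> U k" using module_hom.diff[OF lin_T] j m by simp
        then show ?thesis using T_radical_cycles[OF m(2) _ w(1), of j] j m by simp
      qed
      then have "w \<in> U (Suc k)" using N[OF k w(1)] by blast
      then have "w + (z - w) \<in> U (Suc k)" using zwU subspace_add subU by blast
      then show ?thesis by simp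
    qed
    then show "\<exists>N. \<forall>k\<ge>N. \<forall>z\<in>Y (Suc k). (\<forall>j<m. T j z \<in> U k) \<longrightarrow> z \<in> U (Suc k)" by blast
  qed
  then show ?case
    using m radical_boundaries_cycles[OF m(3)] T_T_radical_cycles[OF m(3)] T0
    by (intro artinian_pair_Suc[of m T "radical_cycles (Suc m)" "radical_boundaries (Suc m)" Y])
      (simp_all add: lin_T subspace_radical_cycles subspace_radical_boundaries T_radical_cycles T_radical_boundaries fd YS Y0)
qed

text \<open>The dual climb, from the quotient by all generators to the quotient by none.
  Multiplication by \<open>e m\<close> maps the quotient by \<open>ideal_part (Suc m)\<close> onto
  the layer between \<open>ideal_part m\<close> and \<open>ideal_part (Suc m)\<close>, so a
  submodule of the layer is tested on its preimage under \<open>e m\<close>.\<close>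

lemma artinian_ideal_part:
  assumes "artinian_pair n T (radical_cycles n) (radical_boundaries n)" "m \<le> n"
  shows "artinian_pair n X (\<lambda>k. gr (- int k)) (\<lambda>k. ideal_part (n - m) (- int k))"
  using assms(2)
proof (induction m)
  case 0
  have "radical_cycles n = (\<lambda>k. gr (- int k))"
    unfolding radical_cycles_def using radical by blast
  moreover have "radical_boundaries n k = ideal_part n (- int k)" for k
  proof
    show "radical_boundaries n k \<subseteq> ideal_part n (- int k)"
      unfolding radical_boundaries_def using radical[of _ "- int (Suc k)"] subspace_add[OF subspace_ideal_part[OF order_refl]]
      by auto
  qed (simp add: ideal_part_radical_boundaries)
  ultimately have N: "artinian_pair n T (\<lambda>k. gr (- int k)) (\<lambda>k. ideal_part n (- int k))"
    using assms(1) by (metis (no_types, lifting) ext)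
  \<comment> \<open>Here d is exchanged for l. The parts d c j and l c j end in the ideal by
    minimality, and so does c j (d - l), because d and l agree up to terms of degree > 1.\<close>
  have TX: "T j u - X j u \<in> ideal_part n (i + 1)" if ju: "j < n" "u \<in> gr i" for j u i
  proof -
    have "d (c j u) \<in> ideal_part n (i + 1)" "l (c j u) \<in> ideal_part n (i + 1)" "c j (d u - l u) \<in> ideal_part n (i + 1)"
      using radical[OF ju(2)] radical[OF c_gr[OF ju]] ju(1) by auto
    then have "c j (d u - l u) - (d (c j u) - l (c j u)) \<in> ideal_part n (i + 1)"
      using subspace_diff[OF subspace_ideal_part[OF order_refl]] by blast
    then show ?thesis unfolding bracket_def using c_diff[OF ju(1)] by (simp add: algebra_simps)
  qed
  show ?case unfolding artinian_pair_def
  proof (intro allI impI, elim conjE)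
    fix U assume subU: "\<forall>k. subspace (U k)" and XU: "\<forall>k. \<forall>j<n. \<forall>u\<in>U (Suc k). X j u \<in> U k"
      and *: "\<forall>k. ideal_part (n - 0) (- int k) \<subseteq> U k \<and> U k \<subseteq> gr (- int k)"
    have TX': "T j u \<in> U k \<longleftrightarrow> X j u \<in> U k" if ju: "j < n" "u \<in> gr (- int (Suc k))" for j u k
    proof -
      have "T j u - X j u \<in> U k" using TX[OF ju] * by auto
      then show ?thesis using subspace_add[of "U k"] subspace_diff[of "U k"] subU
        by (metis add_diff_cancel_left' diff_add_cancel)
    qed
    have TU: "T j u \<in> U k" if "j < n" "u \<in> U (Suc k)" for j u k
      using that TX'[OF that(1)] XU * by blast
    obtain N where "\<And>k z. N \<le> k \<Longrightarrow> z \<in> gr (- int (Suc k)) \<Longrightarrow> (\<And>j. j < n \<Longrightarrow> T j z \<in> U k) \<Longrightarrow> z \<in> U (Suc k)"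
      by (rule artinian_pairD[OF N, of U]) (use subU TU * in auto)
    then show "\<exists>N. \<forall>k\<ge>N. \<forall>z\<in>gr (- int (Suc k)). (\<forall>j<n. X j z \<in> U k) \<longrightarrow> z \<in> U (Suc k)"
      using TX' by blast
  qed
next
  case (Suc m')
  define m where "m = n - Suc m'"
  have m: "m < n" "m \<le> n" "Suc m \<le> n" "n - m' = Suc m" using Suc.prems m_def by auto
  have N: "artinian_pair n X (\<lambda>k. gr (- int k)) (\<lambda>k. ideal_part (Suc m) (- int k))" using Suc m by simp
  have "artinian_pair n X (\<lambda>k. ideal_part (Suc m) (- int k)) (\<lambda>k. ideal_part m (- int k))"
    unfolding artinian_pair_def
  proof (intro allI impI, elim conjE)
    fix U assume subU: "\<forall>k. subspace (U k)" and XU: "\<forall>k. \<forall>j<n. \<forall>u\<in>U (Suc k). X j u \<in> U k"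
      and IU: "\<forall>k. ideal_part m (- int k) \<subseteq> U k \<and> U k \<subseteq> ideal_part (Suc m) (- int k)"
    define U' where "U' k = gr (- int k) \<inter> {x. e m x \<in> U k}" for k
    have eX: "e m (X j x) \<in> U k \<longleftrightarrow> X j (e m x) \<in> U k" if "j < n" for j k x
      using X_e[OF that m(1)] subspace_neg[of "U k"] subU by (metis minus_minus)
    obtain N where N: "\<And>k z. N \<le> k \<Longrightarrow> z \<in> gr (- int (Suc k)) \<Longrightarrow> (\<And>j. j < n \<Longrightarrow> X j z \<in> U' k) \<Longrightarrow> z \<in> U' (Suc k)"
    proof (rule artinian_pairD[OF N, of U'])
      show "subspace (U' k)" for k unfolding U'_def
        using subspace_inter[OF sub_gr] module_hom.subspace_linear_preimage[OF lin_e[OF m(1)]] subU by blast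
      show "X j u \<in> U' k" if "j < n" "u \<in> U' (Suc k)" for k j u
        using that X_gr[OF that(1), of u "- int (Suc k)"] eX[OF that(1)] XU unfolding U'_def by simp
      show "ideal_part (Suc m) (- int k) \<subseteq> U' k" for k
      proof
        fix x assume x: "x \<in> ideal_part (Suc m) (- int k)"
        then obtain y i where "y \<in> gr (- int k)" "i \<in> ideal_part m (- int k)" "x = e m y + i" by auto
        then have "e m x \<in> ideal_part m (- int k)" using e_add[OF m(1)] e_sq[OF m(1)] e_ideal_part[OF m(1,2)] by simp
        then show "x \<in> U' k" unfolding U'_def using IU x ideal_part_gr[OF m(3)] by blast
      qed
    qed (auto simp: U'_def)
    have "z \<in> U (Suc k)"
      if k: "k \<ge> N" and z: "z \<in> ideal_part (Suc m) (- int (Suc k))" and Xz: "\<forall>j<n. X j z \<in> U k" for k z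
    proof -
      obtain y i where y: "y \<in> gr (- int (Suc k))" "i \<in> ideal_part m (- int (Suc k))" "z = e m y + i" using z by auto
      have "X j y \<in> U' k" if j: "j < n" for j
      proof -
        have "X j i \<in> ideal_part m (- int k)" using X_ideal_part[OF m(2) j y(2)] by simp
        then have "X j i \<in> U k" using IU by blast
        then have "X j z - X j i \<in> U k" using Xz j subspace_diff subU by blast
        then have "X j (e m y) \<in> U k" using y(3) module_hom.add[OF lin_X[OF j]] by simp
        then show ?thesis unfolding U'_def using eX[OF j] X_gr[OF j y(1)] by simp
      qed
      then have "e m y \<in> U (Suc k)" using N[OF k y(1)] unfolding U'_def by blast
      moreover have "i \<in> U (Suc k)" using y(2) IU by blast
      ultimately show ?thesis using y(3) subspace_add subU by blast
    qed
    then show "\<exists>N. \<forall>k\<ge>N. \<forall>z\<in>ideal_part (Suc m) (- int (Suc k)). (\<forall>j<n. X j z \<in> U k) \<longrightarrow> z \<in> U (Suc k)"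
      by blast
  qed
  moreover have "X j w \<in> ideal_part (Suc m) (- int k)" if "j < n" "w \<in> ideal_part (Suc m) (- int (Suc k))" for j k w
    using X_ideal_part[OF m(3) that] unfolding gr_uminus_Suc .
  ultimately have "artinian_pair n X (\<lambda>k. gr (- int k)) (\<lambda>k. ideal_part m (- int k))"
    using N m ideal_part_Suc[OF m(1)] ideal_part_gr[OF m(3)]
    by (intro artinian_pair_trans[of n X "\<lambda>k. gr (- int k)" "\<lambda>k. ideal_part (Suc m) (- int k)" "\<lambda>k. ideal_part m (- int k)"])
      (simp_all add: lin_X sub_gr subspace_ideal_part del: ideal_part.simps of_nat_Suc)
  then show ?case unfolding m_def .
qed

theorem linear_part_eventually_exact_left:
  assumes exact: "\<And>k x. k \<ge> K \<Longrightarrow> x \<in> gr (- int k) \<Longrightarrow> d x = 0 \<Longrightarrow> x \<in> d ` gr (- int (Suc k))"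
    and gr1: "gr 1 = {0}"
  shows "\<exists>N. \<forall>k\<ge>N. \<forall>x\<in>gr (- int k). l x = 0 \<longrightarrow> x \<in> l ` gr (- int (Suc k))"
proof -
  have "artinian_pair n X (\<lambda>k. gr (- int k)) (\<lambda>k. ideal_part (n - n) (- int k))"
    by (rule artinian_ideal_part[OF artinian_radical_homology[OF exact gr1]]) auto
  then have N: "artinian_pair n X (\<lambda>k. gr (- int k)) (\<lambda>_. {0})" by simp
  have X_l: "X j z = l (- c j z)" if "l z = 0" "j < n" for j z
    unfolding bracket_def using that c_0 by (simp add: l.neg)
  \<comment> \<open>Choosing the image of l as \<open>U\<close>: a cocycle z satisfies X j z = l (-
    c j z), so all \<open>X j z\<close> lie in \<open>U\<close> and the artinian condition returns z
    itself to the image. The image in degree - k comes from degree - Suc k, hence the shift.\<close>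
  obtain N where N: "\<And>k z. N \<le> k \<Longrightarrow> z \<in> gr (- int (Suc k)) \<Longrightarrow> (\<And>j. j < n \<Longrightarrow> X j z \<in> l ` gr (- int (Suc k)))
      \<Longrightarrow> z \<in> l ` gr (- int (Suc (Suc k)))"
  proof (rule artinian_pairD[OF N, of "\<lambda>k. l ` gr (- int (Suc k))"])
    show sub: "subspace (l ` gr (- int (Suc k)))" for k by (rule l.subspace_image[OF sub_gr])
    show "X j u \<in> l ` gr (- int (Suc k))" if j: "j < n" and u: "u \<in> l ` gr (- int (Suc (Suc k)))" for k j u
    proof -
      obtain y where y: "y \<in> gr (- int (Suc (Suc k)))" "u = l y" using u by blast
      have "u \<in> gr (- int (Suc k))" using l_gr[OF y(1)] y(2) by (simp add: gr_uminus_Suc)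
      then have "- c j u \<in> gr (- int (Suc k))" using c_gr[OF j] gr_neg by blast
      then show ?thesis using X_l[of u j] l_l[OF y(1)] y(2) j by blast
    qed
    show "{0} \<subseteq> l ` gr (- int (Suc k))" for k using subspace_0[OF sub] by blast
    show "l ` gr (- int (Suc k)) \<subseteq> gr (- int k)" for k using l_gr[of _ "- int (Suc k)"] by auto
  qed blast
  have "x \<in> l ` gr (- int (Suc k))" if k: "k \<ge> Suc N" and x: "x \<in> gr (- int k)" "l x = 0" for k x
  proof -
    obtain k' where k': "k = Suc k'" "k' \<ge> N" using k by (cases k) auto
    have "X j x \<in> l ` gr (- int (Suc k'))" if "j < n" for j
      using X_l[OF x(2) that] gr_neg[OF c_gr[OF that x(1)]] k' by blast
    then show ?thesis using N[OF k'(2)] x(1) k' by blast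
  qed
  then show ?thesis by blast
qed

end

section \<open>The exterior algebra as a quotient of the word algebra\<close>

lemma sum_fun_apply: "(\<Sum>i\<in>A. f i) x = (\<Sum>i\<in>A. f i x)"
  by (induction A rule: infinite_finite_induct) auto

abbreviation WA :: "('v list \<Rightarrow> 'k::field) ring" where "WA \<equiv> word_algebra"

lemma word_algebra_simps:
  "carrier WA = {f. finite {w. f w \<noteq> 0}}"
  "f \<otimes>\<^bsub>WA\<^esub> g = (\<lambda>w. \<Sum>i\<le>length w. f (take i w) * g (drop i w))"
  "\<one>\<^bsub>WA\<^esub> = word []" "\<zero>\<^bsub>WA\<^esub> = 0" "f \<oplus>\<^bsub>WA\<^esub> g = f + g"
  by (simp_all add: word_algebra_def word_def fun_eq_iff)

lemma word_closed [simp]: "word u \<in> carrier WA"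
  by (simp add: word_algebra_simps word_def)

lemma word_algebra_mult_closed:
  assumes "f \<in> carrier WA" "g \<in> carrier WA" shows "f \<otimes>\<^bsub>WA\<^esub> g \<in> carrier WA"
proof -
  let ?S = "(\<lambda>(u, v). u @ v) ` ({w. f w \<noteq> 0} \<times> {w. g w \<noteq> 0})"
  have "w \<in> ?S" if w: "(f \<otimes>\<^bsub>WA\<^esub> g) w \<noteq> 0" for w
  proof -
    obtain i where "f (take i w) * g (drop i w) \<noteq> 0"
      using w unfolding word_algebra_simps by (meson sum.neutral)
    then show ?thesis by (intro image_eqI[of _ _ "(take i w, drop i w)"]) auto
  qed
  then have "{w. (f \<otimes>\<^bsub>WA\<^esub> g) w \<noteq> 0} \<subseteq> ?S" by blast
  moreover have "finite ?S" using assms by (simp add: word_algebra_simps)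
  ultimately show ?thesis using finite_subset by (auto simp: word_algebra_simps(1))
qed

lemma word_algebra_add_closed:
  assumes "f \<in> carrier WA" "g \<in> carrier WA" shows "f + g \<in> carrier WA"
proof -
  have "{w. (f + g) w \<noteq> 0} \<subseteq> {w. f w \<noteq> 0} \<union> {w. g w \<noteq> 0}" by auto
  moreover have "finite ({w. f w \<noteq> 0} \<union> {w. g w \<noteq> 0})" using assms by (simp add: word_algebra_simps)
  ultimately show ?thesis unfolding word_algebra_simps(1) using finite_subset by blast
qed

lemma word_algebra_scale_closed: "f \<in> carrier WA \<Longrightarrow> (\<lambda>w. a * f w) \<in> carrier WA"
proof -
  assume "f \<in> carrier WA"
  moreover have "{w. a * f w \<noteq> 0} \<subseteq> {w. f w \<noteq> 0}" by auto
  ultimately show ?thesis unfolding word_algebra_simps(1) using finite_subset by blast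
qed

text \<open>Both sides sum over all cuts of w into three consecutive pieces; i and j in the proof
  are the lengths of the first two.\<close>

lemma word_algebra_mult_assoc:
  fixes f g h :: "'v list \<Rightarrow> 'k::field"
  shows "(f \<otimes>\<^bsub>WA\<^esub> g) \<otimes>\<^bsub>WA\<^esub> h = f \<otimes>\<^bsub>WA\<^esub> (g \<otimes>\<^bsub>WA\<^esub> h)"
proof
  fix w :: "'v list"
  let ?n = "length w"
  define F where "F i j = f (take i w) * (g (take j (drop i w)) * h (drop (i + j) w))" for i j
  have "((f \<otimes>\<^bsub>WA\<^esub> g) \<otimes>\<^bsub>WA\<^esub> h) w = (\<Sum>k\<le>?n. \<Sum>i\<le>k. F i (k - i))"
    unfolding word_algebra_simps F_def sum_distrib_right
    by (intro sum.cong) (auto simp: min_def drop_take mult.assoc)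
  also have "\<dots> = (\<Sum>(i,j)\<in>{(i,j). i + j \<le> ?n}. F i j)"
    by (rule sum.triangle_reindex_eq[symmetric])
  also have "{(i,j). i + j \<le> ?n} = (SIGMA i:{..?n}. {..?n - i})" by auto
  also have "(\<Sum>(i,j)\<in>(SIGMA i:{..?n}. {..?n - i}). F i j) = (\<Sum>i\<le>?n. \<Sum>j\<le>?n - i. F i j)"
    by (simp add: sum.Sigma)
  also have "\<dots> = (f \<otimes>\<^bsub>WA\<^esub> (g \<otimes>\<^bsub>WA\<^esub> h)) w"
    unfolding word_algebra_simps F_def sum_distrib_left by (intro sum.cong) (auto simp: add.commute)
  finally show "((f \<otimes>\<^bsub>WA\<^esub> g) \<otimes>\<^bsub>WA\<^esub> h) w = (f \<otimes>\<^bsub>WA\<^esub> (g \<otimes>\<^bsub>WA\<^esub> h)) w" .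
qed

lemma word_algebra_mult_word:
  "word u \<otimes>\<^bsub>WA\<^esub> f = (\<lambda>w. if take (length u) w = u then f (drop (length u) w) else 0)"
proof
  fix w
  have "(word u \<otimes>\<^bsub>WA\<^esub> f) w = (\<Sum>i\<le>length w. if i = length u then (if take (length u) w = u then f (drop (length u) w) else 0) else 0)"
    unfolding word_algebra_simps
  proof (intro sum.cong refl)
    fix i assume "i \<in> {..length w}"
    then have "take i w = u \<longleftrightarrow> i = length u \<and> take (length u) w = u" by auto
    then show "word u (take i w) * f (drop i w) =
        (if i = length u then (if take (length u) w = u then f (drop (length u) w) else 0) else 0)"
      unfolding word_def by simp
  qed
  also have "\<dots> = (if take (length u) w = u then f (drop (length u) w) else 0)"
  proof (cases "take (length u) w = u")
    case True
    then have "length u \<le> length w" by (metis length_take min.cobounded1)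
    then show ?thesis by simp
  qed simp
  finally show "(word u \<otimes>\<^bsub>WA\<^esub> f) w = (if take (length u) w = u then f (drop (length u) w) else 0)" .
qed

lemma word_mult_word: "word u \<otimes>\<^bsub>WA\<^esub> word v = word (u @ v)"
proof
  fix w
  have "take (length u) w = u \<and> drop (length u) w = v \<longleftrightarrow> w = u @ v"
    using append_eq_conv_conj[of u v w] by auto
  then show "(word u \<otimes>\<^bsub>WA\<^esub> word v) w = word (u @ v) w"
    unfolding word_algebra_mult_word by (simp add: word_def) blast
qed

lemma word_algebra_mult_add:
  "f \<otimes>\<^bsub>WA\<^esub> (g + h) = f \<otimes>\<^bsub>WA\<^esub> g + f \<otimes>\<^bsub>WA\<^esub> h" "(g + h) \<otimes>\<^bsub>WA\<^esub> f = g \<otimes>\<^bsub>WA\<^esub> f + h \<otimes>\<^bsub>WA\<^esub> f"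
  "f \<otimes>\<^bsub>WA\<^esub> (g - h) = f \<otimes>\<^bsub>WA\<^esub> g - f \<otimes>\<^bsub>WA\<^esub> h" "(g - h) \<otimes>\<^bsub>WA\<^esub> f = g \<otimes>\<^bsub>WA\<^esub> f - h \<otimes>\<^bsub>WA\<^esub> f"
  by (simp_all add: word_algebra_simps fun_eq_iff algebra_simps sum.distrib sum_subtractf)

lemma word_algebra_mult_scale:
  "f \<otimes>\<^bsub>WA\<^esub> (\<lambda>w. a * g w) = (\<lambda>w. a * (f \<otimes>\<^bsub>WA\<^esub> g) w)" "(\<lambda>w. a * f w) \<otimes>\<^bsub>WA\<^esub> g = (\<lambda>w. a * (f \<otimes>\<^bsub>WA\<^esub> g) w)"
  by (simp_all add: word_algebra_simps fun_eq_iff sum_distrib_left algebra_simps)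

lemma word_algebra_one: "word [] \<otimes>\<^bsub>WA\<^esub> f = f" "f \<otimes>\<^bsub>WA\<^esub> word [] = f"
proof -
  show "word [] \<otimes>\<^bsub>WA\<^esub> f = f" by (simp add: word_algebra_mult_word)
  show "f \<otimes>\<^bsub>WA\<^esub> word [] = f"
  proof
    fix w
    have "(f \<otimes>\<^bsub>WA\<^esub> word []) w = (\<Sum>i\<le>length w. if i = length w then f w else 0)"
      unfolding word_algebra_simps word_def by (intro sum.cong) auto
    then show "(f \<otimes>\<^bsub>WA\<^esub> word []) w = f w" by simp
  qed
qed

lemma word_algebra_ring: "ring (WA :: ('v list \<Rightarrow> 'k::field) ring)"
proof (rule ringI)
  show "abelian_group (WA :: ('v list \<Rightarrow> 'k) ring)"
  proof (rule abelian_groupI, goal_cases)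
    case (6 x)
    then have "- x \<in> carrier WA" by (simp add: word_algebra_simps)
    then show ?case by (intro bexI[of _ "- x"]) (simp_all add: word_algebra_simps)
  qed (use word_algebra_add_closed in \<open>auto simp: word_algebra_simps(4,5) add.assoc add.commute\<close>, simp add: word_algebra_simps)
  show "Group.monoid (WA :: ('v list \<Rightarrow> 'k) ring)"
    by (rule monoidI) (simp_all add: word_algebra_mult_closed word_algebra_mult_assoc word_algebra_one word_algebra_simps(3))
qed (simp_all add: word_algebra_simps(5) word_algebra_mult_add)

interpretation WA: ring word_algebra by (rule word_algebra_ring)

lemma word_algebra_minus: "f \<in> carrier WA \<Longrightarrow> \<ominus>\<^bsub>WA\<^esub> f = - f"
  by (rule WA.minus_equality) (auto simp: word_algebra_simps)

lemma word_algebra_diff: "f \<in> carrier WA \<Longrightarrow> g \<in> carrier WA \<Longrightarrow> f \<ominus>\<^bsub>WA\<^esub> g = f - g"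
  unfolding a_minus_def by (simp add: word_algebra_minus word_algebra_simps(5))

lemma word_algebra_sum_closed: "(\<And>i. i \<in> A \<Longrightarrow> f i \<in> carrier WA) \<Longrightarrow> sum f A \<in> carrier WA"
  using WA.zero_closed word_algebra_add_closed
  by (induction A rule: infinite_finite_induct) (auto simp: word_algebra_simps(4))

lemma word_algebra_expand:
  assumes "f \<in> carrier WA" "finite S" "{w. f w \<noteq> 0} \<subseteq> S"
  shows "f = (\<Sum>u\<in>S. (\<lambda>w. f u * word u w))"
proof
  fix w
  have "(\<Sum>u\<in>S. (\<lambda>w. f u * word u w)) w = (\<Sum>u\<in>S. if u = w then f w else 0)"
    unfolding sum_fun_apply word_def by (intro sum.cong) auto
  also have "\<dots> = f w" using assms by auto
  finally show "f w = (\<Sum>u\<in>S. (\<lambda>w. f u * word u w)) w" by simp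
qed

lemma exterior_relations_closed: "exterior_relations scale \<subseteq> carrier WA"
proof -
  have "(\<lambda>w. word [x + y] w - word [x] w - word [y] w) \<in> carrier (WA :: ('v list \<Rightarrow> 'k::field) ring)" for x y :: "'v::ab_group_add"
  proof -
    have "word [x + y] \<ominus>\<^bsub>WA\<^esub> word [x] \<ominus>\<^bsub>WA\<^esub> word [y] \<in> carrier (WA :: ('v list \<Rightarrow> 'k) ring)" by simp
    moreover have "word [x + y] - word [x] \<in> carrier (WA :: ('v list \<Rightarrow> 'k) ring)"
      using WA.minus_closed[of "word [x + y]" "word [x]"] by (simp add: word_algebra_diff)
    ultimately show ?thesis by (simp add: word_algebra_diff fun_diff_def)
  qed
  moreover have "(\<lambda>w. word [scale a x] w - a * word [x] w) \<in> carrier (WA :: ('v list \<Rightarrow> 'k::field) ring)" for x :: 'v and a scale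
  proof -
    have 1: "(\<lambda>w. a * word [x] w) \<in> carrier (WA :: ('v list \<Rightarrow> 'k) ring)" by (simp add: word_algebra_scale_closed)
    then show ?thesis using WA.minus_closed[OF word_closed[of "[scale a x]"] 1] word_algebra_diff[OF word_closed 1]
      by (simp add: fun_diff_def)
  qed
  ultimately show ?thesis unfolding exterior_relations_def by auto
qed

lemma exterior_ideal_ideal: "ideal (exterior_ideal scale) WA"
  unfolding exterior_ideal_def by (rule WA.genideal_ideal[OF exterior_relations_closed])

lemma exterior_relations_ideal: "exterior_relations scale \<subseteq> exterior_ideal scale"
  unfolding exterior_ideal_def by (rule WA.genideal_self[OF exterior_relations_closed])

context
  fixes scale :: "'k::field \<Rightarrow> 'v::ab_group_add \<Rightarrow> 'v"
begin

interpretation EI: ideal "exterior_ideal scale" WA by (rule exterior_ideal_ideal)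

lemma exterior_ideal_closed: "f \<in> exterior_ideal scale \<Longrightarrow> f \<in> carrier WA"
  using EI.a_subset by blast

lemma exterior_ideal_add: "f \<in> exterior_ideal scale \<Longrightarrow> g \<in> exterior_ideal scale \<Longrightarrow> f + g \<in> exterior_ideal scale"
  using EI.a_closed by (simp add: word_algebra_simps)

lemma exterior_ideal_zero: "0 \<in> exterior_ideal scale"
  using EI.zero_closed by (simp add: word_algebra_simps)

lemma exterior_ideal_mult:
  "f \<in> exterior_ideal scale \<Longrightarrow> g \<in> carrier WA \<Longrightarrow> f \<otimes>\<^bsub>WA\<^esub> g \<in> exterior_ideal scale"
  "f \<in> exterior_ideal scale \<Longrightarrow> g \<in> carrier WA \<Longrightarrow> g \<otimes>\<^bsub>WA\<^esub> f \<in> exterior_ideal scale"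
  using EI.I_l_closed EI.I_r_closed by auto

lemma exterior_ideal_scale:
  assumes "f \<in> exterior_ideal scale" shows "(\<lambda>w. a * f w) \<in> exterior_ideal scale"
proof -
  have "(\<lambda>w. a * word [] w) \<otimes>\<^bsub>WA\<^esub> f \<in> exterior_ideal scale"
    using exterior_ideal_mult(2)[OF assms] word_algebra_scale_closed[OF word_closed] by blast
  then show ?thesis by (simp add: word_algebra_mult_scale word_algebra_one)
qed

lemma exterior_ideal_uminus: "f \<in> exterior_ideal scale \<Longrightarrow> - f \<in> exterior_ideal scale"
  using exterior_ideal_scale[of f "- 1"] by (simp add: fun_Compl_def)

lemma exterior_ideal_diff: "f \<in> exterior_ideal scale \<Longrightarrow> g \<in> exterior_ideal scale \<Longrightarrow> f - g \<in> exterior_ideal scale"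
  using exterior_ideal_add[OF _ exterior_ideal_uminus, of f g] by simp

lemma word_add_exterior: "word [x + y] - word [x] - word [y] \<in> exterior_ideal scale"
  using exterior_relations_ideal[of scale] unfolding exterior_relations_def by (auto simp: fun_diff_def)

lemma word_scale_exterior: "word [scale a x] - (\<lambda>w. a * word [x] w) \<in> exterior_ideal scale"
  using exterior_relations_ideal[of scale] unfolding exterior_relations_def by (auto simp: fun_diff_def)

lemma word_square_exterior: "word [x, x] \<in> exterior_ideal scale"
  using exterior_relations_ideal[of scale] unfolding exterior_relations_def by auto

text \<open>Polarisation of the square of u + v. The additivity relation r is multiplied by letters
  from both sides, because the free algebra lives on the underlying set of V and
  \<open>word [u + v]\<close> is not yet a sum there.\<close>

lemma word_anticommute_exterior: "word [u, v] + word [v, u] \<in> exterior_ideal scale"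
proof -
  let ?r = "word [u + v] - word [u] - word [v] :: 'v list \<Rightarrow> 'k"
  have r: "?r \<in> exterior_ideal scale" by (rule word_add_exterior)
  have "?r \<otimes>\<^bsub>WA\<^esub> word [u + v] + word [u] \<otimes>\<^bsub>WA\<^esub> ?r + word [v] \<otimes>\<^bsub>WA\<^esub> ?r \<in> exterior_ideal scale"
    by (intro exterior_ideal_add exterior_ideal_mult r word_closed)
  also have "?r \<otimes>\<^bsub>WA\<^esub> word [u + v] + word [u] \<otimes>\<^bsub>WA\<^esub> ?r + word [v] \<otimes>\<^bsub>WA\<^esub> ?r
    = word [u + v, u + v] - word [u, u] - word [v, v] - (word [u, v] + word [v, u])"
    by (simp add: word_algebra_mult_add word_mult_word algebra_simps)
  finally have "word [u + v, u + v] - word [u, u] - word [v, v] -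
      (word [u + v, u + v] - word [u, u] - word [v, v] - (word [u, v] + word [v, u])) \<in> exterior_ideal scale"
    by (rule exterior_ideal_diff[rotated]) (intro exterior_ideal_diff word_square_exterior)
  moreover have "A - (A - B) = B" for A B :: "'v list \<Rightarrow> 'k" by (simp add: fun_eq_iff)
  ultimately show ?thesis by metis
qed

lemma exterior_algebra_ring: "ring (exterior_algebra scale)"
  unfolding exterior_algebra_def by (rule EI.quotient_is_ring)

lemma exterior_class_hom: "exterior_class scale \<in> ring_hom WA (exterior_algebra scale)"
  unfolding exterior_class_def[abs_def] exterior_algebra_def by (rule EI.rcos_ring_hom)

lemma exterior_class_closed: "f \<in> carrier WA \<Longrightarrow> exterior_class scale f \<in> carrier (exterior_algebra scale)"
  using ring_hom_closed[OF exterior_class_hom] .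

lemma exterior_class_add:
  "f \<in> carrier WA \<Longrightarrow> g \<in> carrier WA \<Longrightarrow>
    exterior_class scale f \<oplus>\<^bsub>exterior_algebra scale\<^esub> exterior_class scale g = exterior_class scale (f + g)"
  using ring_hom_add[OF exterior_class_hom] by (simp add: word_algebra_simps(5))

lemma exterior_class_mult:
  "f \<in> carrier WA \<Longrightarrow> g \<in> carrier WA \<Longrightarrow>
    exterior_class scale f \<otimes>\<^bsub>exterior_algebra scale\<^esub> exterior_class scale g = exterior_class scale (f \<otimes>\<^bsub>WA\<^esub> g)"
  using ring_hom_mult[OF exterior_class_hom] by simp

lemma exterior_class_one: "exterior_class scale (word []) = \<one>\<^bsub>exterior_algebra scale\<^esub>"
  using ring_hom_one[OF exterior_class_hom] by (simp add: word_algebra_simps(3))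

lemma exterior_class_zero: "exterior_class scale 0 = \<zero>\<^bsub>exterior_algebra scale\<^esub>"
  using ring_hom_zero[OF exterior_class_hom word_algebra_ring exterior_algebra_ring] by (simp add: word_algebra_simps(4))

lemma exterior_classE:
  assumes "a \<in> carrier (exterior_algebra scale)"
  obtains f where "f \<in> carrier WA" "a = exterior_class scale f"
  using assms unfolding exterior_algebra_def FactRing_def A_RCOSETS_def' exterior_class_def a_r_coset_def by auto

lemma exterior_class_eqI:
  assumes "f \<in> carrier WA" "g \<in> carrier WA" "f - g \<in> exterior_ideal scale"
  shows "exterior_class scale f = exterior_class scale g"
  using assms EI.a_repr_independence'[of f g] WA.quotient_eq_iff_same_a_r_cos[OF EI.ideal_axioms, of f g]
  unfolding exterior_class_def by (simp add: word_algebra_diff)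

text \<open>Controls representatives picked by \<open>SOME\<close>, as in
  \<open>exterior_component\<close> and later in \<open>phi\<close>: they differ from a known one by
  an element of the ideal.\<close>

lemma exterior_class_mem:
  assumes "f \<in> carrier WA" "g \<in> exterior_class scale f"
  shows "g \<in> carrier WA" "g - f \<in> exterior_ideal scale"
proof -
  obtain i where i: "i \<in> exterior_ideal scale" "g = i + f"
    using assms(2) unfolding exterior_class_def a_r_coset_def' by (auto simp: word_algebra_simps)
  then show "g \<in> carrier WA" using exterior_ideal_closed word_algebra_add_closed assms(1) by blast
  show "g - f \<in> exterior_ideal scale" using i by simp
qed

lemma exterior_class_self: "f \<in> carrier WA \<Longrightarrow> f \<in> exterior_class scale f"
  unfolding exterior_class_def by (rule EI.a_rcos_self)

end

section \<open>The Fock space model of the exterior algebra\<close>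

text \<open>The sign of moving e_j into its place in the increasing product e_I. The counted set is
  finite for every I, so no finiteness of I is required.\<close>

definition sign_below :: "nat \<Rightarrow> nat set \<Rightarrow> 'k::field" where
  "sign_below j I = (- 1) ^ card {i \<in> I. i < j}"

definition wedge :: "nat \<Rightarrow> (nat set \<Rightarrow> 'k::field) \<Rightarrow> nat set \<Rightarrow> 'k" where
  "wedge j f I = (if j \<in> I then sign_below j I * f (I - {j}) else 0)"

text \<open>The interior product, transpose of \<open>wedge j\<close>; including or omitting j in I
  does not change the sign, so both carry the same one.\<close>

definition contract :: "nat \<Rightarrow> (nat set \<Rightarrow> 'k::field) \<Rightarrow> nat set \<Rightarrow> 'k" where
  "contract j f I = (if j \<in> I then 0 else sign_below j I * f (insert j I))"

lemma sign_below_square: "sign_below j I * (sign_below j I * x) = (x :: 'k::field)"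
  unfolding sign_below_def by (simp add: mult.assoc[symmetric] power_add[symmetric])

lemma sign_below_self: "sign_below j (insert j I) = sign_below j I" "sign_below j (I - {j}) = sign_below j I"
  unfolding sign_below_def by (rule arg_cong[where f = "\<lambda>A. (- 1) ^ card A"]; auto)+

lemma sign_below_insert:
  assumes "k \<notin> I" shows "sign_below j (insert k I) = (if k < j then - sign_below j I else sign_below j I)"
proof (cases "k < j")
  case True
  then have "{i \<in> insert k I. i < j} = insert k {i \<in> I. i < j}" by auto
  moreover have "finite {i \<in> I. i < j}" by (rule finite_subset[of _ "{..<j}"]) auto
  ultimately show ?thesis unfolding sign_below_def using True assms by simp
next
  case False
  then have "{i \<in> insert k I. i < j} = {i \<in> I. i < j}" by auto
  then show ?thesis unfolding sign_below_def using False by simp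
qed

lemma sign_below_remove:
  assumes "k \<in> I" shows "(sign_below j (I - {k}) :: 'k::field) = (if k < j then - sign_below j I else sign_below j I)"
proof -
  have "(sign_below j (insert k (I - {k})) :: 'k) = (if k < j then - sign_below j (I - {k}) else sign_below j (I - {k}))"
    by (rule sign_below_insert) simp
  then show ?thesis using assms by (simp add: insert_absorb split: if_splits)
qed

lemma wedge_wedge: "wedge j (wedge k f) = - wedge k (wedge j f)"
proof
  fix I
  have "I - {j} - {k} = I - {k} - {j}" by blast
  then show "wedge j (wedge k f) I = (- wedge k (wedge j f)) I"
    by (cases "j = k") (auto simp: wedge_def sign_below_remove linorder_neq_iff)
qed

lemma wedge_square: "wedge j (wedge j f) = 0"
  by (simp add: fun_eq_iff wedge_def)

lemma contract_wedge: "contract j (wedge k f) = (if j = k then f else 0) - wedge k (contract j f)"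
proof
  fix I
  show "contract j (wedge k f) I = ((if j = k then f else 0) - wedge k (contract j f)) I"
  proof (cases "j = k")
    case True
    then show ?thesis by (simp add: contract_def wedge_def sign_below_self sign_below_square insert_absorb)
  next
    case False
    then have "insert j I - {k} = insert j (I - {k})" by blast
    then show ?thesis using False
      by (auto simp: contract_def wedge_def sign_below_remove sign_below_insert)
  qed
qed

lemma wedge_add: "wedge j (f + g) = wedge j f + wedge j g"
  and wedge_scale: "wedge j (\<lambda>I. a * f I) = (\<lambda>I. a * wedge j f I)"
  by (simp_all add: fun_eq_iff wedge_def algebra_simps)

lemma wedge_sum: "wedge j (\<lambda>I. \<Sum>i\<in>A. f i I) = (\<lambda>I. \<Sum>i\<in>A. wedge j (f i) I)"
  by (simp add: fun_eq_iff wedge_def sum_distrib_left)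

text \<open>Peeling off the last index leaves a row and a column that cancel, and a diagonal entry.
  Vanishing on the diagonal is a separate assumption because antisymmetry does not imply it in
  characteristic 2.\<close>

lemma sum_antisymmetric:
  fixes A :: "nat \<Rightarrow> nat \<Rightarrow> 'a::ab_group_add"
  assumes "\<And>j. A j j = 0" "\<And>j k. A j k = - A k j"
  shows "(\<Sum>j<n. \<Sum>k<n. A j k) = 0"
proof (induction n)
  case (Suc n)
  have "(\<Sum>j<n. A j n) = - (\<Sum>k<n. A n k)" unfolding sum_negf[symmetric] by (rule sum.cong[OF refl assms(2)])
  then show ?case using Suc assms(1) by (simp add: sum.distrib)
qed simp

text \<open>The parameter S is a set of exterior degrees, so that homogeneous parts
  \<open>{m}\<close>, filtration steps \<open>{m..}\<close> and mere membership in the model, S =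
  \<open>UNIV\<close>, obey the same rules.\<close>

definition deg_in :: "nat \<Rightarrow> nat set \<Rightarrow> (nat set \<Rightarrow> 'k::field) \<Rightarrow> bool" where
  "deg_in n S f \<longleftrightarrow> (\<forall>I. f I \<noteq> 0 \<longrightarrow> I \<subseteq> {..<n} \<and> card I \<in> S)"

lemma deg_in_wedge: "deg_in n S f \<Longrightarrow> j < n \<Longrightarrow> deg_in n (Suc ` S) (wedge j f)"
proof -
  assume f: "deg_in n S f" and j: "j < n"
  have "I \<subseteq> {..<n} \<and> card I \<in> Suc ` S" if I: "wedge j f I \<noteq> 0" for I
  proof -
    have "j \<in> I" "f (I - {j}) \<noteq> 0" using I by (auto simp: wedge_def split: if_splits)
    then have *: "I - {j} \<subseteq> {..<n}" "card (I - {j}) \<in> S" "j \<in> I" using f unfolding deg_in_def by auto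
    then have "I \<subseteq> {..<n}" using j by auto
    moreover have "card I = Suc (card (I - {j}))" using *(3) calculation by (metis card.remove finite_lessThan finite_subset)
    ultimately show ?thesis using *(2) by blast
  qed
  then show ?thesis unfolding deg_in_def by blast
qed

lemma deg_in_0: "deg_in n S 0" unfolding deg_in_def by simp

lemma deg_in_add: "deg_in n S f \<Longrightarrow> deg_in n S g \<Longrightarrow> deg_in n S (f + g)"
  unfolding deg_in_def by (metis add.right_neutral plus_fun_apply)

lemma deg_in_scale: "deg_in n S f \<Longrightarrow> deg_in n S (\<lambda>I. a * f I)"
  unfolding deg_in_def by simp

lemma deg_in_sum: "(\<And>i. i \<in> A \<Longrightarrow> deg_in n S (f i)) \<Longrightarrow> deg_in n S (\<lambda>I. \<Sum>i\<in>A. f i I)"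
  unfolding deg_in_def by (meson sum.not_neutral_contains_not_neutral)

lemma deg_in_mono: "deg_in n S f \<Longrightarrow> S \<subseteq> S' \<Longrightarrow> deg_in n S' f"
  unfolding deg_in_def by blast

lemma deg_in_UNIV: "deg_in n UNIV f \<longleftrightarrow> (\<forall>I. f I \<noteq> 0 \<longrightarrow> I \<subseteq> {..<n})"
  unfolding deg_in_def by simp

definition vacuum :: "nat set \<Rightarrow> 'k::field" where "vacuum I = (if I = {} then 1 else 0)"

locale exterior_model = finite_dimensional_vector_space scale Basis
  for scale :: "'k::field \<Rightarrow> 'v::ab_group_add \<Rightarrow> 'v" and Basis :: "'v set" +
  fixes n :: nat and bas :: "nat \<Rightarrow> 'v"
  assumes bas: "bij_betw bas {..<n} Basis"
begin

abbreviation EA :: "('v list \<Rightarrow> 'k) set ring" where "EA \<equiv> exterior_algebra scale"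
abbreviation EI :: "('v list \<Rightarrow> 'k) set" where "EI \<equiv> exterior_ideal scale"
abbreviation cls :: "('v list \<Rightarrow> 'k) \<Rightarrow> ('v list \<Rightarrow> 'k) set" where "cls \<equiv> exterior_class scale"

sublocale EA: ring EA by (rule exterior_algebra_ring)

section \<open>Action of words on the Fock space\<close>

definition vec :: "'v \<Rightarrow> (nat set \<Rightarrow> 'k) \<Rightarrow> nat set \<Rightarrow> 'k" where
  "vec v f = (\<lambda>I. \<Sum>j<n. representation Basis v (bas j) * wedge j f I)"

lemma vec_add_right: "vec v (f + g) = vec v f + vec v g"
  by (simp add: vec_def fun_eq_iff wedge_add algebra_simps sum.distrib)

lemma vec_scale_right: "vec v (\<lambda>I. a * f I) = (\<lambda>I. a * vec v f I)"
  by (simp add: vec_def fun_eq_iff wedge_scale sum_distrib_left algebra_simps)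

lemma vec_add_left: "vec (u + v) f = vec u f + vec v f"
  by (simp add: vec_def fun_eq_iff representation_add[OF independent_Basis] span_Basis algebra_simps sum.distrib)

lemma vec_scale_left: "vec (scale a v) f = (\<lambda>I. a * vec v f I)"
  by (simp add: vec_def fun_eq_iff representation_scale[OF independent_Basis] span_Basis sum_distrib_left algebra_simps)

lemma bas_Basis: "j < n \<Longrightarrow> bas j \<in> Basis"
  using bas bij_betwE by blast

lemma vec_bas: "j < n \<Longrightarrow> vec (bas j) f = wedge j f"
proof
  fix I assume j: "j < n"
  have "vec (bas j) f I = (\<Sum>i<n. if i = j then wedge j f I else 0)"
    unfolding vec_def using bas j representation_basis[OF independent_Basis bas_Basis[OF j]]
    by (intro sum.cong) (auto simp: bij_betw_def inj_on_eq_iff)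
  then show "vec (bas j) f I = wedge j f I" using j by simp
qed

lemma vec_vec: "vec v (vec v f) = 0"
proof
  fix I
  let ?c = "\<lambda>j. representation Basis v (bas j)"
  have "vec v (vec v f) I = (\<Sum>j<n. \<Sum>k<n. ?c j * ?c k * wedge j (wedge k f) I)"
    by (simp add: vec_def wedge_sum wedge_scale sum_distrib_left mult.assoc)
  also have "\<dots> = 0"
  proof (rule sum_antisymmetric)
    show "?c j * ?c j * wedge j (wedge j f) I = 0" for j by (simp add: wedge_square)
    show "?c j * ?c k * wedge j (wedge k f) I = - (?c k * ?c j * wedge k (wedge j f) I)" for j k
      using wedge_wedge[of j k f] by simp
  qed
  finally show "vec v (vec v f) I = 0 I" by simp
qed

definition act :: "'v list \<Rightarrow> (nat set \<Rightarrow> 'k) \<Rightarrow> nat set \<Rightarrow> 'k" where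
  "act w = foldr vec w"

lemma act_simps [simp]: "act [] f = f" "act (v # w) f = vec v (act w f)" "act (u @ w) f = act u (act w f)"
  by (simp_all add: act_def)

lemma act_add: "act w (f + g) = act w f + act w g"
  by (induction w) (simp_all only: act_simps vec_add_right)

lemma act_scale: "act w (\<lambda>I. a * f I) = (\<lambda>I. a * act w f I)"
  by (induction w) (simp_all only: act_simps vec_scale_right)

lemma act_0: "act w 0 = 0"
  using act_scale[of w 0 0] by (simp add: zero_fun_def)

lemma act_sum: "finite A \<Longrightarrow> act w (\<lambda>I. \<Sum>i\<in>A. f i I) = (\<lambda>I. \<Sum>i\<in>A. act w (f i) I)"
proof (induction A rule: finite_induct)
  case empty then show ?case using act_0 by (simp add: zero_fun_def)
next
  case (insert x A)
  have "act w (\<lambda>I. \<Sum>i\<in>insert x A. f i I) = act w (f x + (\<lambda>I. \<Sum>i\<in>A. f i I))"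
    using insert(1,2) by (simp add: plus_fun_def)
  then show ?case using insert by (simp add: act_add fun_eq_iff)
qed

definition app :: "('v list \<Rightarrow> 'k) \<Rightarrow> (nat set \<Rightarrow> 'k) \<Rightarrow> nat set \<Rightarrow> 'k" where
  "app p f = (\<lambda>I. \<Sum>w | p w \<noteq> 0. p w * act w f I)"

lemma app_superset: "finite S \<Longrightarrow> {w. p w \<noteq> 0} \<subseteq> S \<Longrightarrow> app p f = (\<lambda>I. \<Sum>w\<in>S. p w * act w f I)"
  unfolding app_def by (rule ext, rule sum.mono_neutral_left) auto

lemma app_word: "app (word u) f = act u f"
  using app_superset[of "{u}" "word u"] by (auto simp: word_def fun_eq_iff)

lemma app_add:
  assumes "p \<in> carrier WA" "q \<in> carrier WA" shows "app (p + q) f = app p f + app q f"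
proof -
  let ?S = "{w. p w \<noteq> 0} \<union> {w. q w \<noteq> 0}"
  have S: "finite ?S" using assms by (simp add: word_algebra_simps)
  have sub: "{w. (p + q) w \<noteq> 0} \<subseteq> ?S" by auto
  note * = app_superset[of ?S "p + q", OF S sub] app_superset[of ?S p, OF S] app_superset[of ?S q, OF S]
  show ?thesis by (subst *(1), subst *(2), blast, subst *(3), blast) (simp add: fun_eq_iff algebra_simps sum.distrib)
qed

lemma app_scale:
  assumes "p \<in> carrier WA" shows "app (\<lambda>w. a * p w) f = (\<lambda>I. a * app p f I)"
proof -
  have S: "finite {w. p w \<noteq> 0}" using assms by (simp add: word_algebra_simps)
  have sub: "{w. a * p w \<noteq> 0} \<subseteq> {w. p w \<noteq> 0}" by auto
  show ?thesis by (subst app_superset[OF S sub]) (simp add: app_def fun_eq_iff algebra_simps sum_distrib_left)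
qed

lemma app_0: "app 0 f = 0"
  by (simp add: app_def fun_eq_iff)

lemma app_diff:
  assumes "p \<in> carrier WA" "q \<in> carrier WA" shows "app (p - q) f = app p f - app q f"
proof -
  have "p - q = p + (\<lambda>w. - 1 * q w)" by (simp add: fun_eq_iff)
  then have "app (p - q) f = app p f + (\<lambda>I. - 1 * app q f I)"
    using app_add[OF assms(1) word_algebra_scale_closed[OF assms(2), of "- 1"]] app_scale[OF assms(2), of "- 1"]
    by (simp only:)
  then show ?thesis by (simp add: fun_eq_iff)
qed

lemma app_sum:
  assumes "\<And>i. i \<in> A \<Longrightarrow> p i \<in> carrier WA" shows "app (sum p A) f = (\<Sum>i\<in>A. app (p i) f)"
  using assms
proof (induction A rule: infinite_finite_induct)
  case (insert x A)
  then show ?case using app_add[of "p x" "sum p A" f] word_algebra_sum_closed[of A p] by (simp del: plus_fun_apply)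
qed (simp_all add: app_0)

lemma app_word_mult:
  assumes "q \<in> carrier WA" shows "app (word u \<otimes>\<^bsub>WA\<^esub> q) f = act u (app q f)"
proof -
  let ?Q = "{w. q w \<noteq> 0}"
  have Q: "finite ?Q" using assms by (simp add: word_algebra_simps)
  have mult: "(word u \<otimes>\<^bsub>WA\<^esub> q) (u @ x) = q x" for x by (simp add: word_algebra_mult_word)
  have sub: "{w. (word u \<otimes>\<^bsub>WA\<^esub> q) w \<noteq> 0} \<subseteq> (\<lambda>x. u @ x) ` ?Q"
  proof
    fix w assume "w \<in> {w. (word u \<otimes>\<^bsub>WA\<^esub> q) w \<noteq> 0}"
    then have "take (length u) w = u" "q (drop (length u) w) \<noteq> 0"
      by (auto simp: word_algebra_mult_word split: if_splits)
    moreover have "w = take (length u) w @ drop (length u) w" by simp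
    ultimately show "w \<in> (\<lambda>x. u @ x) ` ?Q" by (intro image_eqI[of _ _ "drop (length u) w"]) simp_all
  qed
  have "app (word u \<otimes>\<^bsub>WA\<^esub> q) f = (\<lambda>I. \<Sum>w\<in>(\<lambda>x. u @ x) ` ?Q. (word u \<otimes>\<^bsub>WA\<^esub> q) w * act w f I)"
    by (rule app_superset[OF finite_imageI[OF Q] sub])
  also have "\<dots> = (\<lambda>I. \<Sum>x\<in>?Q. q x * act u (act x f) I)"
    by (simp add: sum.reindex inj_on_def mult)
  also have "\<dots> = act u (app q f)" unfolding app_def using act_sum[OF Q] by (simp add: act_scale)
  finally show ?thesis .
qed

lemma app_mult:
  assumes p: "p \<in> carrier WA" and q: "q \<in> carrier WA" shows "app (p \<otimes>\<^bsub>WA\<^esub> q) f = app p (app q f)"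
proof -
  let ?P = "{w. p w \<noteq> 0}"
  have P: "finite ?P" using p by (simp add: word_algebra_simps)
  have c: "(\<lambda>w. p u * word u w) \<in> carrier WA" for u by (rule word_algebra_scale_closed) simp
  have expand: "p = (\<Sum>u\<in>?P. (\<lambda>w. p u * word u w))" by (rule word_algebra_expand[OF p P order_refl])
  have eq: "(\<Sum>u\<in>A. (\<lambda>w. p u * word u w)) \<otimes>\<^bsub>WA\<^esub> q = (\<Sum>u\<in>A. (\<lambda>w. p u * (word u \<otimes>\<^bsub>WA\<^esub> q) w))" if "finite A" for A
    using that
  proof (induction A rule: finite_induct)
    case empty show ?case by (simp add: word_algebra_simps(2) fun_eq_iff)
  next
    case (insert x A)
    then show ?case using word_algebra_mult_add(2)[of "\<lambda>w. p x * word x w" "\<Sum>u\<in>A. (\<lambda>w. p u * word u w)" q]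
      by (simp del: plus_fun_apply minus_apply add: word_algebra_mult_scale)
  qed
  have "p \<otimes>\<^bsub>WA\<^esub> q = (\<Sum>u\<in>?P. (\<lambda>w. p u * (word u \<otimes>\<^bsub>WA\<^esub> q) w))"
    using arg_cong[OF expand, of "\<lambda>x. x \<otimes>\<^bsub>WA\<^esub> q"] eq[OF P] by (rule trans)
  then have "app (p \<otimes>\<^bsub>WA\<^esub> q) f = app (\<Sum>u\<in>?P. (\<lambda>w. p u * (word u \<otimes>\<^bsub>WA\<^esub> q) w)) f" by (rule arg_cong)
  also have "\<dots> = (\<Sum>u\<in>?P. app (\<lambda>w. p u * (word u \<otimes>\<^bsub>WA\<^esub> q) w) f)"
    by (rule app_sum) (intro word_algebra_scale_closed word_algebra_mult_closed q word_closed)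
  also have "\<dots> = (\<Sum>u\<in>?P. (\<lambda>I. p u * act u (app q f) I))"
    using app_scale[OF word_algebra_mult_closed[OF word_closed q]] app_word_mult[OF q] by simp
  also have "\<dots> = app p (app q f)" by (simp add: fun_eq_iff sum_fun_apply app_def)
  finally show ?thesis .
qed

text \<open>By multiplicativity of \<open>app\<close> the elements acting as zero form a two-sided
  ideal. It contains the defining relations: the linear ones since \<open>vec\<close> is linear in
  the vector, the squares by \<open>vec_vec\<close>.\<close>

lemma app_exterior_ideal: "p \<in> EI \<Longrightarrow> app p f = 0"
proof -
  define J where "J = {p \<in> carrier WA. \<forall>f. app p f = 0}"
  have "ideal J WA"
  proof (rule idealI[OF word_algebra_ring])
    show "subgroup J (add_monoid WA)"
    proof (rule WA.add.subgroupI)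
      show "J \<noteq> {}" using app_0 WA.zero_closed unfolding J_def by (auto simp: word_algebra_simps(4))
      show "\<ominus>\<^bsub>WA\<^esub> a \<in> J" if "a \<in> J" for a
      proof -
        have a: "a \<in> carrier WA" "\<And>f. app a f = 0" using that unfolding J_def by auto
        have "0 \<in> carrier (WA :: ('v list \<Rightarrow> 'k) ring)" by (simp add: word_algebra_simps)
        then have "app (0 - a) f = 0" for f using app_diff[OF _ a(1), of 0 f] a(2) app_0 by (simp only: diff_self)
        then show ?thesis using a(1) WA.a_inv_closed[OF a(1)] unfolding J_def
          by (simp only: word_algebra_minus[OF a(1)] diff_0 mem_Collect_eq) blast
      qed
      show "a \<oplus>\<^bsub>WA\<^esub> b \<in> J" if "a \<in> J" "b \<in> J" for a b
        using that unfolding J_def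
        by (simp add: word_algebra_simps(5) app_add word_algebra_add_closed del: plus_fun_apply)
    qed (auto simp: J_def)
    show "x \<otimes>\<^bsub>WA\<^esub> a \<in> J" "a \<otimes>\<^bsub>WA\<^esub> x \<in> J" if "a \<in> J" "x \<in> carrier WA" for a x
    proof -
      have a: "a \<in> carrier WA" "\<And>f. app a f = 0" using that(1) unfolding J_def by auto
      have "app x 0 = 0" by (simp add: app_def act_0 fun_eq_iff)
      then show "x \<otimes>\<^bsub>WA\<^esub> a \<in> J" "a \<otimes>\<^bsub>WA\<^esub> x \<in> J"
        using a app_mult[OF that(2) a(1)] app_mult[OF a(1) that(2)] that(2)
        unfolding J_def by (simp_all add: word_algebra_mult_closed)
    qed
  qed
  moreover have "exterior_relations scale \<subseteq> J"
  proof
    fix r assume r: "r \<in> exterior_relations scale"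
    then have rc: "r \<in> carrier WA" using exterior_relations_closed by blast
    have "app r f = 0" for f
    proof -
      consider x y where "r = word [x + y] - word [x] - word [y]"
        | a x where "r = word [scale a x] - (\<lambda>w. a * word [x] w)" | x where "r = word [x, x]"
        using r unfolding exterior_relations_def by (auto simp: fun_diff_def)
      then show ?thesis
      proof cases
        case 1
        have "word [x + y] - word [x] \<in> carrier (WA :: ('v list \<Rightarrow> 'k) ring)"
          using WA.minus_closed[of "word [x + y]" "word [x]"] by (simp add: word_algebra_diff)
        then show ?thesis unfolding 1 by (simp add: app_diff app_word vec_add_left)
      next
        case 2
        then show ?thesis by (simp add: app_diff app_scale word_algebra_scale_closed app_word vec_scale_left)
      next
        case 3
        then show ?thesis by (simp add: app_word vec_vec)
      qed
    qed
    then show "r \<in> J" unfolding J_def using rc by blast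
  qed
  ultimately have "EI \<subseteq> J" unfolding exterior_ideal_def by (rule WA.genideal_minimal)
  then show "p \<in> EI \<Longrightarrow> app p f = 0" unfolding J_def by blast
qed

text \<open>The orbit map of the vacuum, which reads off the coefficients of a in the monomials e_I.
  The chosen representative is immaterial because the exterior ideal acts as zero.\<close>

definition phi :: "('v list \<Rightarrow> 'k) set \<Rightarrow> nat set \<Rightarrow> 'k" where
  "phi a = app (SOME p. p \<in> a) vacuum"

lemma phi_cls: assumes "p \<in> carrier WA" shows "phi (cls p) = app p vacuum"
proof -
  have "(SOME q. q \<in> cls p) \<in> cls p" by (rule someI[of "\<lambda>q. q \<in> cls p", OF exterior_class_self[OF assms]])
  note q = exterior_class_mem[OF assms this]
  show ?thesis unfolding phi_def using app_diff[OF q(1) assms] app_exterior_ideal[OF q(2)] by (simp add: fun_eq_iff)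
qed

lemma phi_zero: "phi \<zero>\<^bsub>EA\<^esub> = 0"
  using phi_cls[OF WA.zero_closed] by (simp add: exterior_class_zero[symmetric] word_algebra_simps(4) app_0)

lemma phi_one: "phi \<one>\<^bsub>EA\<^esub> = vacuum"
  using phi_cls[OF word_closed] by (simp add: exterior_class_one[symmetric] app_word)

lemma phi_add:
  assumes "a \<in> carrier EA" "b \<in> carrier EA" shows "phi (a \<oplus>\<^bsub>EA\<^esub> b) = phi a + phi b"
proof -
  obtain p q where "p \<in> carrier WA" "q \<in> carrier WA" "a = cls p" "b = cls q" using assms exterior_classE by metis
  then show ?thesis by (simp add: exterior_class_add phi_cls app_add word_algebra_add_closed)
qed

lemma phi_mult_cls:
  assumes p: "p \<in> carrier WA" and "b \<in> carrier EA" shows "phi (cls p \<otimes>\<^bsub>EA\<^esub> b) = app p (phi b)"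
proof -
  obtain q where "q \<in> carrier WA" "b = cls q" using assms exterior_classE by metis
  then show ?thesis using p by (simp add: exterior_class_mult phi_cls app_mult)
qed

definition gen :: "nat \<Rightarrow> ('v list \<Rightarrow> 'k) set" where "gen j = cls (word [bas j])"
definition scal :: "'k \<Rightarrow> ('v list \<Rightarrow> 'k) set" where "scal a = cls (\<lambda>w. a * word [] w)"

lemma gen_closed [simp]: "gen j \<in> carrier EA" and scal_closed [simp]: "scal a \<in> carrier EA"
  unfolding gen_def scal_def by (simp_all add: exterior_class_closed word_algebra_scale_closed)

lemma phi_gen: "j < n \<Longrightarrow> b \<in> carrier EA \<Longrightarrow> phi (gen j \<otimes>\<^bsub>EA\<^esub> b) = wedge j (phi b)"
  unfolding gen_def by (simp add: phi_mult_cls app_word vec_bas)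

lemma phi_scal: "b \<in> carrier EA \<Longrightarrow> phi (scal a \<otimes>\<^bsub>EA\<^esub> b) = (\<lambda>I. a * phi b I)"
  unfolding scal_def by (simp add: phi_mult_cls app_scale app_word word_algebra_scale_closed)

lemma deg_in_vec: "deg_in n S f \<Longrightarrow> deg_in n (Suc ` S) (vec v f)"
  unfolding vec_def by (intro deg_in_sum deg_in_scale deg_in_wedge) auto

lemma deg_in_act: "deg_in n S f \<Longrightarrow> deg_in n ((+) (length w) ` S) (act w f)"
proof (induction w)
  case (Cons v w)
  then have "deg_in n (Suc ` (+) (length w) ` S) (act (v # w) f)" using deg_in_vec by simp
  then show ?case by (simp add: image_image)
qed simp

lemma deg_in_vacuum: "deg_in n {0} vacuum"
  unfolding deg_in_def vacuum_def by simp

lemma deg_in_act_vacuum: "deg_in n {length w} (act w vacuum)"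
  using deg_in_act[OF deg_in_vacuum, of w] by simp

lemma deg_in_phi: "a \<in> carrier EA \<Longrightarrow> deg_in n UNIV (phi a)"
  by (erule exterior_classE) (auto simp: phi_cls app_def intro!: deg_in_sum deg_in_scale deg_in_mono[OF deg_in_act_vacuum])

section \<open>Straightening into increasing monomials\<close>

definition std_word :: "nat set \<Rightarrow> 'v list" where
  "std_word J = map bas (sorted_list_of_set J)"

definition std :: "(nat set \<Rightarrow> 'k) \<Rightarrow> 'v list \<Rightarrow> 'k" where
  "std g = (\<Sum>J\<in>Pow {..<n}. (\<lambda>w. g J * word (std_word J) w))"

lemma std_closed: "std g \<in> carrier WA"
  unfolding std_def by (intro word_algebra_sum_closed word_algebra_scale_closed word_closed)

lemma app_std: "app (std g) f = (\<lambda>I. \<Sum>J\<in>Pow {..<n}. g J * act (std_word J) f I)"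
  unfolding std_def using app_sum[of "Pow {..<n}" "\<lambda>J w. g J * word (std_word J) w" f]
  by (simp add: fun_eq_iff sum_fun_apply word_algebra_scale_closed app_scale app_word)

lemma act_sorted:
  assumes "sorted xs" "distinct xs" "set xs \<subseteq> {..<n}"
  shows "act (map bas xs) vacuum = (\<lambda>I. if I = set xs then 1 else 0)"
  using assms
proof (induction xs)
  case Nil show ?case by (simp add: vacuum_def fun_eq_iff)
next
  case (Cons x xs)
  \<comment> \<open>The word is applied from its right end, so x is wedged onto larger indices only
    and no sign arises.\<close>
  have "{i \<in> insert x (set xs). i < x} = {}" using Cons.prems by auto
  then have s: "(sign_below x (insert x (set xs)) :: 'k) = 1" unfolding sign_below_def by (simp only: card.empty power_0)
  have "act (map bas (x # xs)) vacuum = wedge x (\<lambda>I. if I = set xs then 1 else 0)"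
    using Cons vec_bas by simp
  also have "\<dots> = (\<lambda>I. if I = set (x # xs) then 1 else 0)"
  proof
    fix I
    show "wedge x (\<lambda>I. if I = set xs then 1 else 0 :: 'k) I = (if I = set (x # xs) then 1 else 0)"
    proof (cases "I = insert x (set xs)")
      case True
      then have "I - {x} = set xs" using Cons.prems by auto
      then show ?thesis using True s by (simp add: wedge_def)
    next
      case False
      then have "x \<notin> I \<or> I - {x} \<noteq> set xs" by blast
      then show ?thesis using False by (simp add: wedge_def)
    qed
  qed
  finally show ?case .
qed

lemma phi_std: assumes "deg_in n UNIV g" shows "phi (cls (std g)) = g"
proof
  fix I
  have "act (std_word J) vacuum = (\<lambda>I. if I = J then 1 else 0)" if "J \<in> Pow {..<n}" for J
  proof -
    have "finite J" using that finite_subset by auto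
    then show ?thesis unfolding std_word_def using act_sorted[of "sorted_list_of_set J"] that by auto
  qed
  then have "phi (cls (std g)) I = (\<Sum>J\<in>Pow {..<n}. if I = J then g I else 0)"
    unfolding phi_cls[OF std_closed] app_std by (intro sum.cong) auto
  also have "\<dots> = g I" using assms unfolding deg_in_UNIV by auto
  finally show "phi (cls (std g)) I = g I" .
qed

lemma std_add: "std (f + g) = std f + std g"
  unfolding std_def sum.distrib[symmetric] by (intro sum.cong) (auto simp: fun_eq_iff algebra_simps)

lemma std_scale: "std (\<lambda>I. a * f I) = (\<lambda>w. a * std f w)"
  unfolding std_def by (simp add: fun_eq_iff sum_fun_apply sum_distrib_left algebra_simps)

lemma std_word_exterior:
  assumes "J \<subseteq> {..<n}" shows "std (\<lambda>I. if I = J then 1 else 0) = word (std_word J)"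
proof
  fix w
  have "std (\<lambda>I. if I = J then 1 else 0) w = (\<Sum>K\<in>Pow {..<n}. if K = J then word (std_word J) w else 0)"
    unfolding std_def sum_fun_apply by (intro sum.cong) auto
  then show "std (\<lambda>I. if I = J then 1 else 0) w = word (std_word J) w" using assms by simp
qed

text \<open>Bubble the letter j to the right: passing a smaller letter costs a sign, and meeting
  itself gives a square and the coefficient 0. The coefficient is left existential since spanning is
  all that is concluded from it.\<close>

lemma insort_exterior:
  assumes "sorted xs" "distinct xs"
  shows "\<exists>a. word (map bas (j # xs)) - (\<lambda>w. a * word (map bas (insort_insert j xs)) w) \<in> EI"
  using assms
proof (induction xs)
  case Nil
  have "word (map bas [j]) - (\<lambda>w. 1 * word (map bas (insort_insert j [])) w) \<in> EI"
    by (simp add: insort_insert_key_def exterior_ideal_zero)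
  then show ?case by blast
next
  case (Cons x xs)
  consider "j < x" | "j = x" | "x < j" by linarith
  then show ?case
  proof cases
    case 1
    then have "insort_insert j (x # xs) = j # x # xs" using Cons.prems by (auto simp: insort_insert_key_def)
    then have "word (map bas (j # x # xs)) - (\<lambda>w. 1 * word (map bas (insort_insert j (x # xs))) w) \<in> EI"
      by (simp add: exterior_ideal_zero)
    then show ?thesis by blast
  next
    case 2
    have "word [bas x, bas x] \<otimes>\<^bsub>WA\<^esub> word (map bas xs) \<in> EI"
      by (intro exterior_ideal_mult word_square_exterior word_closed)
    then have "word (map bas (j # x # xs)) - (\<lambda>w. 0 * word (map bas (insort_insert j (x # xs))) w) \<in> EI"
      using 2 by (simp add: word_mult_word fun_diff_def)
    then show ?thesis by blast
  next
    case 3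
    have "sorted xs" "distinct xs" using Cons.prems by auto
    with Cons.IH obtain a where a: "word (map bas (j # xs)) - (\<lambda>w. a * word (map bas (insort_insert j xs)) w) \<in> EI"
      by blast
    have ins: "insort_insert j (x # xs) = x # insort_insert j xs" using 3 by (auto simp: insort_insert_key_def)
    have "word [bas x] \<otimes>\<^bsub>WA\<^esub> (word (map bas (j # xs)) - (\<lambda>w. a * word (map bas (insort_insert j xs)) w)) \<in> EI"
      by (intro exterior_ideal_mult a word_closed)
    then have 1: "word (map bas (x # j # xs)) - (\<lambda>w. a * word (map bas (insort_insert j (x # xs))) w) \<in> EI"
      unfolding ins by (simp del: plus_fun_apply minus_apply add: word_algebra_mult_add word_algebra_mult_scale word_mult_word)
    have "(word [bas j, bas x] + word [bas x, bas j]) \<otimes>\<^bsub>WA\<^esub> word (map bas xs) \<in> EI"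
      by (intro exterior_ideal_mult word_anticommute_exterior word_closed)
    then have 2: "word (map bas (j # x # xs)) + word (map bas (x # j # xs)) \<in> EI"
      by (simp del: plus_fun_apply minus_apply add: word_algebra_mult_add word_mult_word)
    have "word (map bas (j # x # xs)) - (\<lambda>w. (- a) * word (map bas (insort_insert j (x # xs))) w) =
       (word (map bas (j # x # xs)) + word (map bas (x # j # xs))) -
       (word (map bas (x # j # xs)) - (\<lambda>w. a * word (map bas (insort_insert j (x # xs))) w))"
      by (simp add: fun_eq_iff)
    then have "word (map bas (j # x # xs)) - (\<lambda>w. (- a) * word (map bas (insort_insert j (x # xs))) w) \<in> EI"
      using exterior_ideal_diff[OF 2 1] by metis
    then show ?thesis by blast
  qed
qed

definition spanned :: "('v list \<Rightarrow> 'k) \<Rightarrow> bool" where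
  "spanned p \<longleftrightarrow> (\<exists>g. p - std g \<in> EI)"

lemma spanned_add: assumes "spanned p" "spanned q" shows "spanned (p + q)"
proof -
  obtain f g where "p - std f \<in> EI" "q - std g \<in> EI" using assms unfolding spanned_def by blast
  then have "(p - std f) + (q - std g) \<in> EI" by (rule exterior_ideal_add)
  then have "p + q - std (f + g) \<in> EI" by (simp add: std_add algebra_simps)
  then show ?thesis unfolding spanned_def by blast
qed

lemma spanned_scale: assumes "spanned p" shows "spanned (\<lambda>w. a * p w)"
proof -
  obtain f where "p - std f \<in> EI" using assms unfolding spanned_def by blast
  then have "(\<lambda>w. a * (p - std f) w) \<in> EI" by (rule exterior_ideal_scale)
  moreover have "(\<lambda>w. a * (p - std f) w) = (\<lambda>w. a * p w) - std (\<lambda>I. a * f I)"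
    by (simp add: std_scale fun_eq_iff algebra_simps)
  ultimately show ?thesis unfolding spanned_def by metis
qed

lemma spanned_cong: assumes "spanned p" "q - p \<in> EI" shows "spanned q"
proof -
  obtain f where "p - std f \<in> EI" using assms unfolding spanned_def by blast
  then have "(q - p) + (p - std f) \<in> EI" using assms(2) exterior_ideal_add by blast
  then show ?thesis unfolding spanned_def by (metis add_diff_eq diff_add_cancel)
qed

lemma spanned_0: "spanned 0"
proof -
  have "std (\<lambda>I. 0) = 0" by (simp add: std_def fun_eq_iff sum_fun_apply)
  then have "0 - std (\<lambda>I. 0) \<in> EI" using exterior_ideal_zero by simp
  then show ?thesis unfolding spanned_def by blast
qed

lemma spanned_sum: "(\<And>i. i \<in> A \<Longrightarrow> spanned (p i)) \<Longrightarrow> spanned (sum p A)"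
  by (induction A rule: infinite_finite_induct) (auto simp: spanned_0 spanned_add)

lemma spanned_sorted:
  assumes "sorted xs" "distinct xs" "set xs \<subseteq> {..<n}" shows "spanned (word (map bas xs))"
proof -
  have "sorted_list_of_set (set xs) = xs" using assms(1,2) by (simp add: sorted_list_of_set.idem_if_sorted_distinct)
  then have "word (map bas xs) - std (\<lambda>I. if I = set xs then 1 else 0) = 0"
    using std_word_exterior[OF assms(3)] by (simp add: std_word_def)
  then show ?thesis unfolding spanned_def using exterior_ideal_zero by metis
qed

text \<open>After multiplication the new letter is straightened into each standard monomial.
  Therefore the standard monomials span a left-stable subspace modulo the ideal, which by expanding
  letters in the basis contains every word.\<close>

lemma spanned_bas_mult: assumes "spanned p" "j < n" shows "spanned (word [bas j] \<otimes>\<^bsub>WA\<^esub> p)"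
proof -
  obtain g where g: "p - std g \<in> EI" using assms unfolding spanned_def by blast
  have "word [bas j] \<otimes>\<^bsub>WA\<^esub> (\<Sum>J\<in>A. (\<lambda>w. g J * word (std_word J) w)) =
    (\<Sum>J\<in>A. (\<lambda>w. g J * word (bas j # std_word J) w))" for A
  proof (induction A rule: infinite_finite_induct)
    case (insert x A)
    then show ?case by (simp del: plus_fun_apply minus_apply add: word_algebra_mult_add word_algebra_mult_scale word_mult_word)
  qed (simp_all add: word_algebra_mult_word fun_eq_iff)
  then have eq: "word [bas j] \<otimes>\<^bsub>WA\<^esub> std g = (\<Sum>J\<in>Pow {..<n}. (\<lambda>w. g J * word (bas j # std_word J) w))"
    unfolding std_def .
  have "spanned (word [bas j] \<otimes>\<^bsub>WA\<^esub> std g)" unfolding eq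
  proof (intro spanned_sum spanned_scale)
    fix J assume J: "J \<in> Pow {..<n}"
    let ?xs = "sorted_list_of_set J"
    have fin: "finite J" using J finite_subset by auto
    obtain a where a: "word (map bas (j # ?xs)) - (\<lambda>w. a * word (map bas (insort_insert j ?xs)) w) \<in> EI"
      using insort_exterior[of ?xs j] sorted_sorted_list_of_set distinct_sorted_list_of_set by blast
    have "spanned (\<lambda>w. a * word (map bas (insort_insert j ?xs)) w)"
      using fin J assms(2)
      by (intro spanned_scale spanned_sorted) (auto simp: sorted_insort_insert distinct_insort_insert set_insort_insert)
    then show "spanned (word (bas j # std_word J))" unfolding std_word_def using spanned_cong a by simp
  qed
  moreover have "word [bas j] \<otimes>\<^bsub>WA\<^esub> p - word [bas j] \<otimes>\<^bsub>WA\<^esub> std g \<in> EI"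
    unfolding word_algebra_mult_add(3)[symmetric] by (intro exterior_ideal_mult g word_closed)
  ultimately show ?thesis by (rule spanned_cong)
qed

lemma word_sum_exterior:
  assumes "finite A"
  shows "word [\<Sum>i\<in>A. scale (c i) (b i)] - (\<Sum>i\<in>A. (\<lambda>w. c i * word [b i] w)) \<in> EI"
  using assms
proof (induction A rule: finite_induct)
  case empty
  have "word [scale 0 0] - (\<lambda>w. 0 * word [0] w) \<in> EI" by (rule word_scale_exterior)
  then show ?case by (simp add: fun_diff_def)
next
  case (insert x A)
  let ?s = "\<Sum>i\<in>A. scale (c i) (b i)" and ?t = "\<Sum>i\<in>A. (\<lambda>w. c i * word [b i] w)"
  have "(word [scale (c x) (b x) + ?s] - word [scale (c x) (b x)] - word [?s]) +
     (word [scale (c x) (b x)] - (\<lambda>w. c x * word [b x] w)) + (word [?s] - ?t) \<in> EI"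
    by (intro exterior_ideal_add word_add_exterior word_scale_exterior insert.IH)
  moreover have "(word [scale (c x) (b x) + ?s] - word [scale (c x) (b x)] - word [?s]) +
     (word [scale (c x) (b x)] - (\<lambda>w. c x * word [b x] w)) + (word [?s] - ?t) =
     word [scale (c x) (b x) + ?s] - ((\<lambda>w. c x * word [b x] w) + ?t)"
    by (simp add: fun_eq_iff)
  ultimately show ?case unfolding sum.insert[OF insert(1,2)] by metis
qed

lemma spanned_word: "spanned (word w)"
proof (induction w)
  case Nil show ?case using spanned_sorted[of "[]"] by simp
next
  case (Cons v w)
  let ?c = "\<lambda>j. representation Basis v (bas j)"
  have "v = (\<Sum>b\<in>Basis. scale (representation Basis v b) b)"
    using sum_representation_eq[OF independent_Basis _ finite_Basis] span_Basis by auto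
  also have "\<dots> = (\<Sum>j<n. scale (?c j) (bas j))"
    using sum.reindex_bij_betw[OF bas, of "\<lambda>b. scale (representation Basis v b) b"] by simp
  finally have v: "v = (\<Sum>j<n. scale (?c j) (bas j))" .
  have "word [v] - (\<Sum>j<n. (\<lambda>w. ?c j * word [bas j] w)) \<in> EI"
    using word_sum_exterior[of "{..<n}" ?c bas] v[symmetric] by (simp only: finite_lessThan)
  then have "(word [v] - (\<Sum>j<n. (\<lambda>w. ?c j * word [bas j] w))) \<otimes>\<^bsub>WA\<^esub> word w \<in> EI"
    by (intro exterior_ideal_mult word_closed)
  moreover have "(\<Sum>j\<in>A. (\<lambda>w. ?c j * word [bas j] w)) \<otimes>\<^bsub>WA\<^esub> word w = (\<Sum>j\<in>A. (\<lambda>x. ?c j * (word [bas j] \<otimes>\<^bsub>WA\<^esub> word w) x))" for A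
  proof (induction A rule: infinite_finite_induct)
    case (insert x A)
    then show ?case by (simp del: plus_fun_apply minus_apply add: word_algebra_mult_add word_algebra_mult_scale)
  qed (simp_all add: word_algebra_simps(2) fun_eq_iff)
  ultimately have "word (v # w) - (\<Sum>j<n. (\<lambda>x. ?c j * (word [bas j] \<otimes>\<^bsub>WA\<^esub> word w) x)) \<in> EI"
    by (simp del: plus_fun_apply minus_apply add: word_algebra_mult_add word_mult_word)
  moreover have "spanned (\<Sum>j<n. (\<lambda>x. ?c j * (word [bas j] \<otimes>\<^bsub>WA\<^esub> word w) x))"
    using Cons by (intro spanned_sum spanned_scale spanned_bas_mult) auto
  ultimately show ?case using spanned_cong by blast
qed

text \<open>Standard monomials span by \<open>spanned_word\<close>, and \<open>phi_std\<close>
  recovers their coefficients. Hence they form a basis and \<open>phi\<close> identifies the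
  exterior algebra with the functions supported on subsets of \<open>{..<n}\<close>.\<close>

lemma std_phi: assumes "a \<in> carrier EA" shows "cls (std (phi a)) = a"
proof -
  obtain p where p: "p \<in> carrier WA" "a = cls p" using assms exterior_classE by metis
  have "spanned (\<Sum>u\<in>{w. p w \<noteq> 0}. (\<lambda>w. p u * word u w))"
    by (intro spanned_sum spanned_scale spanned_word)
  then have "spanned p" using word_algebra_expand[OF p(1) _ order_refl] p(1) by (simp add: word_algebra_simps)
  then obtain g where g: "p - std g \<in> EI" unfolding spanned_def by blast
  \<comment> \<open>\<open>std\<close> looks at subsets of \<open>{..<n}\<close> only; cutting g off
    outside them leaves \<open>std g\<close> unchanged and makes \<open>phi_std\<close>
    applicable.\<close>
  define h where "h I = (if I \<subseteq> {..<n} then g I else 0)" for I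
  have "std h = std g" unfolding std_def h_def by (intro sum.cong) auto
  then have a: "a = cls (std h)" using exterior_class_eqI[OF p(1) std_closed, of h] g p(2) by simp
  moreover have "deg_in n UNIV h" unfolding deg_in_UNIV h_def by simp
  ultimately show ?thesis using phi_std by simp
qed

lemma phi_inj: "a \<in> carrier EA \<Longrightarrow> b \<in> carrier EA \<Longrightarrow> phi a = phi b \<Longrightarrow> a = b"
  using std_phi by metis

section \<open>Product, grading and augmentation in the model\<close>

definition model_mult :: "(nat set \<Rightarrow> 'k) \<Rightarrow> (nat set \<Rightarrow> 'k) \<Rightarrow> nat set \<Rightarrow> 'k" where
  "model_mult g h = (\<lambda>I. \<Sum>J\<in>Pow {..<n}. g J * act (std_word J) h I)"

lemma phi_mult:
  assumes "a \<in> carrier EA" "b \<in> carrier EA"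
  shows "phi (a \<otimes>\<^bsub>EA\<^esub> b) = model_mult (phi a) (phi b)"
  using phi_mult_cls[OF std_closed assms(2), of "phi a"] std_phi[OF assms(1)] by (simp add: app_std model_mult_def)

lemma deg_in_model_mult:
  assumes "deg_in n S g" "deg_in n T h" "\<And>s t. s \<in> S \<Longrightarrow> t \<in> T \<Longrightarrow> s + t \<in> U"
  shows "deg_in n U (model_mult g h)"
  unfolding model_mult_def
proof (rule deg_in_sum)
  fix J assume J: "J \<in> Pow {..<n}"
  show "deg_in n U (\<lambda>I. g J * act (std_word J) h I)"
  proof (cases "g J = 0")
    case True then show ?thesis by (simp add: deg_in_def)
  next
    case False
    then have "card J \<in> S" using assms(1) unfolding deg_in_def by blast
    moreover have "finite J" using J finite_subset by auto
    ultimately have "length (std_word J) \<in> S" by (simp add: std_word_def)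
    then show ?thesis using assms(3) by (intro deg_in_scale deg_in_mono[OF deg_in_act[OF assms(2)]]) auto
  qed
qed

text \<open>A word of length j maps the vacuum into exterior degree j. Thus cutting a representative
  by word length amounts to cutting \<open>phi a\<close> by cardinality, whichever representative
  was picked.\<close>

lemma component_closed:
  assumes "a \<in> carrier EA"
  shows "exterior_component scale j a \<in> carrier EA"
    and "phi (exterior_component scale j a) = (\<lambda>I. if card I = j then phi a I else 0)"
proof -
  obtain p where p: "p \<in> carrier WA" "a = cls p" using assms exterior_classE by metis
  define q where "q = (SOME f. f \<in> a)"
  have "q \<in> a" unfolding q_def p(2) by (rule someI[of "\<lambda>q. q \<in> cls p", OF exterior_class_self[OF p(1)]])
  then have q: "q \<in> carrier WA" using exterior_class_mem[OF p(1)] p(2) by blast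
  define r where "r = (\<lambda>w. if length w = j then q w else 0)"
  have fin: "finite {w. q w \<noteq> 0}" using q by (simp add: word_algebra_simps)
  have sub: "{w. r w \<noteq> 0} \<subseteq> {w. q w \<noteq> 0}" unfolding r_def by auto
  have r: "r \<in> carrier WA" unfolding word_algebra_simps(1) using finite_subset[OF sub fin] by blast
  have comp: "exterior_component scale j a = cls r" unfolding exterior_component_def r_def q_def ..
  show "exterior_component scale j a \<in> carrier EA" unfolding comp by (rule exterior_class_closed[OF r])
  show "phi (exterior_component scale j a) = (\<lambda>I. if card I = j then phi a I else 0)"
  proof
    fix I
    have "phi (exterior_component scale j a) I = (\<Sum>w | q w \<noteq> 0. r w * act w vacuum I)"
      unfolding comp phi_cls[OF r] app_superset[OF fin sub] ..
    also have "\<dots> = (\<Sum>w | q w \<noteq> 0. if card I = j then q w * act w vacuum I else 0)"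
    proof (rule sum.cong[OF refl])
      fix w
      have "act w vacuum I = 0 \<or> card I = length w" using deg_in_act_vacuum[of w] unfolding deg_in_def by blast
      then show "r w * act w vacuum I = (if card I = j then q w * act w vacuum I else 0)" unfolding r_def by auto
    qed
    also have "\<dots> = (if card I = j then phi a I else 0)"
      unfolding phi_def q_def[symmetric] app_def by simp
    finally show "phi (exterior_component scale j a) I = (if card I = j then phi a I else 0)" .
  qed
qed

text \<open>The value at the empty set is the augmentation to K: a nonempty word acts with a wedge
  product in front, which has no constant term.\<close>

lemma phi_mult_empty:
  assumes "a \<in> carrier EA" "b \<in> carrier EA"
  shows "phi (a \<otimes>\<^bsub>EA\<^esub> b) {} = phi a {} * phi b {}"
proof -
  have "act (std_word J) (phi b) {} = 0" if J: "J \<in> Pow {..<n}" "J \<noteq> {}" for J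
  proof -
    have "finite J" using J(1) finite_subset by auto
    then obtain v w where "std_word J = v # w" using J(2) by (cases "std_word J") (auto simp: std_word_def)
    then show ?thesis by (simp add: vec_def wedge_def)
  qed
  then have "phi (a \<otimes>\<^bsub>EA\<^esub> b) {} = (\<Sum>J\<in>Pow {..<n}. if J = {} then phi a {} * phi b {} else 0)"
    unfolding phi_mult[OF assms] model_mult_def by (intro sum.cong) (auto simp: std_word_def)
  then show ?thesis by simp
qed

text \<open>The kernel of the augmentation is an ideal containing the generators. This translates
  minimality into vanishing constant terms of the matrix entries.\<close>

lemma phi_max_ideal: "a \<in> exterior_max_ideal scale \<Longrightarrow> phi a {} = 0"
proof -
  define J where "J = {a \<in> carrier EA. phi a {} = 0}"
  have neg: "phi (\<ominus>\<^bsub>EA\<^esub> a) {} = 0" if a: "a \<in> J" for a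
  proof -
    have "phi (a \<oplus>\<^bsub>EA\<^esub> \<ominus>\<^bsub>EA\<^esub> a) = phi a + phi (\<ominus>\<^bsub>EA\<^esub> a)" using a by (intro phi_add) (auto simp: J_def)
    moreover have "a \<oplus>\<^bsub>EA\<^esub> \<ominus>\<^bsub>EA\<^esub> a = \<zero>\<^bsub>EA\<^esub>" using a EA.r_neg by (auto simp: J_def)
    ultimately have "phi a {} + phi (\<ominus>\<^bsub>EA\<^esub> a) {} = 0" using phi_zero by (metis plus_fun_apply zero_fun_apply)
    then show ?thesis using a by (simp add: J_def)
  qed
  have "ideal J EA"
  proof (rule idealI[OF exterior_algebra_ring])
    show "subgroup J (add_monoid EA)"
    proof (rule EA.add.subgroupI)
      show "J \<noteq> {}" using phi_zero EA.zero_closed unfolding J_def by auto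
      show "a \<oplus>\<^bsub>EA\<^esub> b \<in> J" if "a \<in> J" "b \<in> J" for a b
        using that phi_add unfolding J_def by simp
      show "\<ominus>\<^bsub>EA\<^esub> a \<in> J" if "a \<in> J" for a using neg[OF that] that unfolding J_def by simp
    qed (auto simp: J_def)
  qed (auto simp: J_def phi_mult_empty)
  moreover have "range (\<lambda>v. cls (word [v])) \<subseteq> J"
    unfolding J_def by (auto simp: exterior_class_closed phi_cls app_word vec_def wedge_def)
  ultimately have "exterior_max_ideal scale \<subseteq> J" unfolding exterior_max_ideal_def by (rule EA.genideal_minimal)
  then show "a \<in> exterior_max_ideal scale \<Longrightarrow> phi a {} = 0"
    unfolding J_def by auto
qed

end

section \<open>Coordinates in free modules\<close>

context left_module
begin

lemma smult_zero_left: assumes "x \<in> carrier M" shows "\<zero> \<odot>\<^bsub>M\<^esub> x = \<zero>\<^bsub>M\<^esub>"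
proof -
  have c: "\<zero> \<odot>\<^bsub>M\<^esub> x \<in> carrier M" using assms smult_closed by simp
  have "\<zero> \<odot>\<^bsub>M\<^esub> x \<oplus>\<^bsub>M\<^esub> \<zero> \<odot>\<^bsub>M\<^esub> x = \<zero> \<odot>\<^bsub>M\<^esub> x"
    using smult_l_distr[of \<zero> \<zero> x] assms by simp
  then show ?thesis using M.add.l_cancel_one[OF c c] by simp
qed

lemma smult_zero_right: assumes "a \<in> carrier R" shows "a \<odot>\<^bsub>M\<^esub> \<zero>\<^bsub>M\<^esub> = \<zero>\<^bsub>M\<^esub>"
proof -
  have c: "a \<odot>\<^bsub>M\<^esub> \<zero>\<^bsub>M\<^esub> \<in> carrier M" using assms smult_closed by simp
  have "a \<odot>\<^bsub>M\<^esub> \<zero>\<^bsub>M\<^esub> \<oplus>\<^bsub>M\<^esub> a \<odot>\<^bsub>M\<^esub> \<zero>\<^bsub>M\<^esub> = a \<odot>\<^bsub>M\<^esub> \<zero>\<^bsub>M\<^esub>"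
    using smult_r_distr[of a "\<zero>\<^bsub>M\<^esub>" "\<zero>\<^bsub>M\<^esub>"] assms by simp
  then show ?thesis using M.add.l_cancel_one[OF c c] by simp
qed

lemma smult_finsum_right:
  assumes "finite A" "a \<in> carrier R" "\<And>i. i \<in> A \<Longrightarrow> f i \<in> carrier M"
  shows "a \<odot>\<^bsub>M\<^esub> finsum M f A = (\<Oplus>\<^bsub>M\<^esub>i\<in>A. a \<odot>\<^bsub>M\<^esub> f i)"
  using assms(1,3)
proof (induction A rule: finite_induct)
  case (insert x A)
  then show ?case using assms(2) by (simp add: smult_r_distr smult_closed Pi_def)
qed (simp add: smult_zero_right assms(2))

lemma lin_comb_superset:
  assumes "finite S" "S \<subseteq> carrier M" "{b. c b \<noteq> \<zero>} \<subseteq> S" "\<And>b. b \<in> S \<Longrightarrow> c b \<in> carrier R"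
  shows "lin_comb R M c = (\<Oplus>\<^bsub>M\<^esub>b\<in>S. c b \<odot>\<^bsub>M\<^esub> b)"
  unfolding lin_comb_def
  using assms by (intro M.add.finprod_mono_neutral_cong_left) (auto simp: smult_zero_left smult_closed)

lemma finite_coeffsD:
  assumes "c \<in> finite_coeffs R B"
  shows "finite {b. c b \<noteq> \<zero>}" "{b. c b \<noteq> \<zero>} \<subseteq> B" "\<And>b. c b \<in> carrier R" "\<And>b. b \<notin> B \<Longrightarrow> c b = \<zero>"
  using assms unfolding finite_coeffs_def by (auto simp: Pi_def)

lemma lin_comb_eq:
  assumes "c \<in> finite_coeffs R B" "B \<subseteq> carrier M" "finite S" "S \<subseteq> B" "{b. c b \<noteq> \<zero>} \<subseteq> S"
  shows "lin_comb R M c = (\<Oplus>\<^bsub>M\<^esub>b\<in>S. c b \<odot>\<^bsub>M\<^esub> b)"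
  using assms finite_coeffsD(3)[OF assms(1)] by (intro lin_comb_superset) auto

lemma lin_comb_closed:
  assumes "c \<in> finite_coeffs R B" "B \<subseteq> carrier M"
  shows "lin_comb R M c \<in> carrier M"
  unfolding lin_comb_def using finite_coeffsD[OF assms(1)] assms(2) smult_closed
  by (intro M.finsum_closed) auto

lemma finite_coeffs_add:
  assumes "c \<in> finite_coeffs R B" "c' \<in> finite_coeffs R B"
  shows "(\<lambda>b. c b \<oplus> c' b) \<in> finite_coeffs R B"
proof -
  note c = finite_coeffsD[OF assms(1)] finite_coeffsD[OF assms(2)]
  have "{b. c b \<oplus> c' b \<noteq> \<zero>} \<subseteq> {b. c b \<noteq> \<zero>} \<union> {b. c' b \<noteq> \<zero>}" by auto
  then have "finite {b. c b \<oplus> c' b \<noteq> \<zero>}" using c(1,5) finite_subset by blast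
  then show ?thesis unfolding finite_coeffs_def using c by auto
qed

lemma finite_coeffs_smult:
  assumes "a \<in> carrier R" "c \<in> finite_coeffs R B"
  shows "(\<lambda>b. a \<otimes> c b) \<in> finite_coeffs R B"
proof -
  note c = finite_coeffsD[OF assms(2)]
  have "{b. a \<otimes> c b \<noteq> \<zero>} \<subseteq> {b. c b \<noteq> \<zero>}" using assms(1) by auto
  then have "finite {b. a \<otimes> c b \<noteq> \<zero>}" using c(1) finite_subset by blast
  then show ?thesis unfolding finite_coeffs_def using c assms(1) by auto
qed

lemma lin_comb_add:
  assumes "c \<in> finite_coeffs R B" "c' \<in> finite_coeffs R B" "B \<subseteq> carrier M"
  shows "lin_comb R M (\<lambda>b. c b \<oplus> c' b) = lin_comb R M c \<oplus>\<^bsub>M\<^esub> lin_comb R M c'"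
proof -
  let ?S = "{b. c b \<noteq> \<zero>} \<union> {b. c' b \<noteq> \<zero>}"
  note c = finite_coeffsD[OF assms(1)] finite_coeffsD[OF assms(2)]
  have S: "finite ?S" "?S \<subseteq> B" using c by auto
  have sub: "{b. c b \<oplus> c' b \<noteq> \<zero>} \<subseteq> ?S" by auto
  have BM: "b \<in> carrier M" if "b \<in> ?S" for b using that S(2) assms(3) by blast
  have eq: "lin_comb R M (\<lambda>b. c b \<oplus> c' b) = (\<Oplus>\<^bsub>M\<^esub>b\<in>?S. (c b \<oplus> c' b) \<odot>\<^bsub>M\<^esub> b)"
    "lin_comb R M c = (\<Oplus>\<^bsub>M\<^esub>b\<in>?S. c b \<odot>\<^bsub>M\<^esub> b)" "lin_comb R M c' = (\<Oplus>\<^bsub>M\<^esub>b\<in>?S. c' b \<odot>\<^bsub>M\<^esub> b)"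
    using lin_comb_eq[OF finite_coeffs_add[OF assms(1,2)] assms(3) S sub]
      lin_comb_eq[OF assms(1,3) S] lin_comb_eq[OF assms(2,3) S] by auto
  have "(\<Oplus>\<^bsub>M\<^esub>b\<in>?S. (c b \<oplus> c' b) \<odot>\<^bsub>M\<^esub> b) = (\<Oplus>\<^bsub>M\<^esub>b\<in>?S. c b \<odot>\<^bsub>M\<^esub> b \<oplus>\<^bsub>M\<^esub> c' b \<odot>\<^bsub>M\<^esub> b)"
    using c(3,7) BM by (intro M.finsum_cong') (auto simp: smult_closed smult_l_distr)
  also have "\<dots> = (\<Oplus>\<^bsub>M\<^esub>b\<in>?S. c b \<odot>\<^bsub>M\<^esub> b) \<oplus>\<^bsub>M\<^esub> (\<Oplus>\<^bsub>M\<^esub>b\<in>?S. c' b \<odot>\<^bsub>M\<^esub> b)"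
    using c(3,7) BM by (intro M.finsum_addf) (auto simp: smult_closed)
  finally show ?thesis unfolding eq .
qed

lemma lin_comb_smult:
  assumes "a \<in> carrier R" "c \<in> finite_coeffs R B" "B \<subseteq> carrier M"
  shows "lin_comb R M (\<lambda>b. a \<otimes> c b) = a \<odot>\<^bsub>M\<^esub> lin_comb R M c"
proof -
  let ?S = "{b. c b \<noteq> \<zero>}"
  note c = finite_coeffsD[OF assms(2)]
  have sub: "{b. a \<otimes> c b \<noteq> \<zero>} \<subseteq> ?S" using assms(1) by auto
  have BM: "b \<in> carrier M" if "b \<in> ?S" for b using that c(2) assms(3) by blast
  have "a \<odot>\<^bsub>M\<^esub> lin_comb R M c = (\<Oplus>\<^bsub>M\<^esub>b\<in>?S. a \<odot>\<^bsub>M\<^esub> (c b \<odot>\<^bsub>M\<^esub> b))"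
    unfolding lin_comb_def using c BM smult_closed assms(1) by (intro smult_finsum_right) auto
  also have "\<dots> = (\<Oplus>\<^bsub>M\<^esub>b\<in>?S. (a \<otimes> c b) \<odot>\<^bsub>M\<^esub> b)"
    using c(3) BM assms(1) by (intro M.finsum_cong') (auto simp: smult_assoc1 smult_closed)
  also have "\<dots> = lin_comb R M (\<lambda>b. a \<otimes> c b)"
    by (rule lin_comb_eq[OF finite_coeffs_smult[OF assms(1,2)] assms(3) c(1,2) sub, symmetric])
  finally show ?thesis by simp
qed

definition delta :: "'m \<Rightarrow> 'm \<Rightarrow> 'r" where "delta b = (\<lambda>b'. if b' = b then \<one> else \<zero>)"

lemma delta_coeffs: "b \<in> B \<Longrightarrow> delta b \<in> finite_coeffs R B"
  unfolding finite_coeffs_def delta_def by (auto intro: finite_subset[of _ "{b}"])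

lemma lin_comb_delta: assumes "b \<in> carrier M" shows "lin_comb R M (delta b) = b"
proof -
  have "lin_comb R M (delta b) = (\<Oplus>\<^bsub>M\<^esub>x\<in>{b}. delta b x \<odot>\<^bsub>M\<^esub> x)"
    using assms by (intro lin_comb_superset) (auto simp: delta_def)
  also have "\<dots> = b" using assms by (simp add: delta_def smult_one)
  finally show ?thesis .
qed

end

lemma left_module_homD:
  assumes "f \<in> left_module_hom R M N"
  shows "\<And>x. x \<in> carrier M \<Longrightarrow> f x \<in> carrier N"
    "\<And>x y. x \<in> carrier M \<Longrightarrow> y \<in> carrier M \<Longrightarrow> f (x \<oplus>\<^bsub>M\<^esub> y) = f x \<oplus>\<^bsub>N\<^esub> f y"
    "\<And>a x. a \<in> carrier R \<Longrightarrow> x \<in> carrier M \<Longrightarrow> f (a \<odot>\<^bsub>M\<^esub> x) = a \<odot>\<^bsub>N\<^esub> f x"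
  using assms unfolding left_module_hom_def by auto

lemma left_module_hom_zero:
  assumes "left_module R M" "left_module R N" "f \<in> left_module_hom R M N"
  shows "f \<zero>\<^bsub>M\<^esub> = \<zero>\<^bsub>N\<^esub>"
proof -
  interpret M: left_module R M by fact
  interpret N: left_module R N by fact
  have "f (\<zero>\<^bsub>R\<^esub> \<odot>\<^bsub>M\<^esub> \<zero>\<^bsub>M\<^esub>) = \<zero>\<^bsub>R\<^esub> \<odot>\<^bsub>N\<^esub> f \<zero>\<^bsub>M\<^esub>"
    using left_module_homD(3)[OF assms(3)] by simp
  then show ?thesis using M.smult_zero_left N.smult_zero_left left_module_homD(1)[OF assms(3)] by simp
qed

lemma left_module_hom_finsum:
  assumes "left_module R M" "left_module R N" "f \<in> left_module_hom R M N"
    and "finite A" "\<And>i. i \<in> A \<Longrightarrow> g i \<in> carrier M"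
  shows "f (finsum M g A) = (\<Oplus>\<^bsub>N\<^esub>i\<in>A. f (g i))"
proof -
  interpret M: left_module R M by fact
  interpret N: left_module R N by fact
  show ?thesis using assms(4,5)
  proof (induction A rule: finite_induct)
    case empty
    then show ?case using left_module_hom_zero[OF assms(1-3)] by simp
  next
    case (insert x A)
    then show ?case using left_module_homD[OF assms(3)] by (simp add: Pi_def M.M.finsum_closed)
  qed
qed

locale based_module = left_module R M for R :: "('r, 'x) ring_scheme" (structure)
  and M :: "('r, 'm, 'y) module_scheme" (structure) +
  fixes B :: "'m set"
  assumes basis: "is_basis R M B"
begin

lemma B_closed: "B \<subseteq> carrier M" using basis unfolding is_basis_def by blast

abbreviation "co \<equiv> coord R M B"

lemma coord_props: assumes "x \<in> carrier M" shows "co x \<in> finite_coeffs R B" "lin_comb R M (co x) = x"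
proof -
  have "\<exists>!c. c \<in> finite_coeffs R B \<and> lin_comb R M c = x" using assms basis unfolding is_basis_def by blast
  from theI'[OF this] show "co x \<in> finite_coeffs R B" "lin_comb R M (co x) = x" unfolding coord_def by auto
qed

lemma coord_unique:
  assumes "c \<in> finite_coeffs R B" "lin_comb R M c = x" shows "co x = c"
proof -
  have x: "x \<in> carrier M" using lin_comb_closed[OF assms(1) B_closed] assms(2) by simp
  have "\<exists>!c. c \<in> finite_coeffs R B \<and> lin_comb R M c = x" using x basis unfolding is_basis_def by blast
  then show ?thesis using coord_props[OF x] assms by blast
qed

lemma coord_closed: "x \<in> carrier M \<Longrightarrow> co x b \<in> carrier R"
  by (rule finite_coeffsD(3)[OF coord_props(1)])

lemma coord_outside: "x \<in> carrier M \<Longrightarrow> b \<notin> B \<Longrightarrow> co x b = \<zero>\<^bsub>R\<^esub>"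
  by (rule finite_coeffsD(4)[OF coord_props(1)])

lemma coord_inj: "x \<in> carrier M \<Longrightarrow> y \<in> carrier M \<Longrightarrow> co x = co y \<Longrightarrow> x = y"
  using coord_props(2) by metis

lemma coord_add:
  assumes "x \<in> carrier M" "y \<in> carrier M" shows "co (x \<oplus>\<^bsub>M\<^esub> y) = (\<lambda>b. co x b \<oplus>\<^bsub>R\<^esub> co y b)"
  using lin_comb_add[OF coord_props(1)[OF assms(1)] coord_props(1)[OF assms(2)] B_closed] coord_props assms
  by (intro coord_unique finite_coeffs_add) auto

lemma coord_smult:
  assumes "a \<in> carrier R" "x \<in> carrier M" shows "co (a \<odot>\<^bsub>M\<^esub> x) = (\<lambda>b. a \<otimes>\<^bsub>R\<^esub> co x b)"
  using lin_comb_smult[OF assms(1) coord_props(1)[OF assms(2)] B_closed] coord_props[OF assms(2)] assms(1)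
  by (intro coord_unique finite_coeffs_smult) auto

lemma coord_zero: "co \<zero>\<^bsub>M\<^esub> = (\<lambda>b. \<zero>\<^bsub>R\<^esub>)"
  using coord_smult[OF R.zero_closed M.zero_closed] smult_zero_left coord_closed by simp

lemma coord_basis: "b \<in> B \<Longrightarrow> co b = delta b"
  using delta_coeffs lin_comb_delta B_closed by (intro coord_unique) auto

lemma coord_finsum:
  assumes "finite A" "\<And>i. i \<in> A \<Longrightarrow> g i \<in> carrier M"
  shows "co (finsum M g A) b = (\<Oplus>\<^bsub>R\<^esub>i\<in>A. co (g i) b)"
  using assms
proof (induction A rule: finite_induct)
  case (insert x A)
  then show ?case by (simp add: Pi_def coord_add coord_closed M.finsum_closed)
qed (simp add: coord_zero)

end

lemma coord_map_of_matrix: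
  assumes "based_module R M B" "based_module R N B'"
    and A: "\<And>b. b \<in> B \<Longrightarrow> A b \<in> finite_coeffs R B'" and fin: "finite B" and x: "x \<in> carrier M"
  shows "map_of_matrix R M B N A x \<in> carrier N"
    and "coord R N B' (map_of_matrix R M B N A x) b' = (\<Oplus>\<^bsub>R\<^esub>b\<in>B. coord R M B x b \<otimes>\<^bsub>R\<^esub> A b b')"
proof -
  interpret M: based_module R M B by fact
  interpret N: based_module R N B' by fact
  let ?S = "{b. coord R M B x b \<noteq> \<zero>\<^bsub>R\<^esub>}"
  note c = M.finite_coeffsD[OF M.coord_props(1)[OF x]]
  have lc: "lin_comb R N (A b) \<in> carrier N" "coord R N B' (lin_comb R N (A b)) = A b" if "b \<in> B" for b
    using N.lin_comb_closed[OF A[OF that] N.B_closed] N.coord_unique[OF A[OF that] refl] by auto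
  have cl: "coord R M B x b \<odot>\<^bsub>N\<^esub> lin_comb R N (A b) \<in> carrier N" if "b \<in> ?S" for b
    using lc(1) c(2,3) that by (intro N.smult_closed) auto
  show "map_of_matrix R M B N A x \<in> carrier N"
    unfolding map_of_matrix_def using cl by (intro N.M.finsum_closed) auto
  have "coord R N B' (map_of_matrix R M B N A x) b' = (\<Oplus>\<^bsub>R\<^esub>b\<in>?S. coord R N B' (coord R M B x b \<odot>\<^bsub>N\<^esub> lin_comb R N (A b)) b')"
    unfolding map_of_matrix_def using cl by (intro N.coord_finsum c(1)) auto
  also have "\<dots> = (\<Oplus>\<^bsub>R\<^esub>b\<in>?S. coord R M B x b \<otimes>\<^bsub>R\<^esub> A b b')"
  proof (rule M.R.finsum_cong')
    show "(\<lambda>b. coord R M B x b \<otimes>\<^bsub>R\<^esub> A b b') \<in> ?S \<rightarrow> carrier R"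
      using c(2,3) N.finite_coeffsD(3)[OF A] by auto
    show "coord R N B' (coord R M B x b \<odot>\<^bsub>N\<^esub> lin_comb R N (A b)) b' = coord R M B x b \<otimes>\<^bsub>R\<^esub> A b b'" if "b \<in> ?S" for b
    proof -
      have "b \<in> B" using that c(2) by blast
      then show ?thesis using N.coord_smult[OF c(3) lc(1)] lc(2) by simp
    qed
  qed simp
  also have "\<dots> = (\<Oplus>\<^bsub>R\<^esub>b\<in>B. coord R M B x b \<otimes>\<^bsub>R\<^esub> A b b')"
    using c(2,3) N.finite_coeffsD(3)[OF A] by (intro M.R.add.finprod_mono_neutral_cong_left fin) auto
  finally show "coord R N B' (map_of_matrix R M B N A x) b' = (\<Oplus>\<^bsub>R\<^esub>b\<in>B. coord R M B x b \<otimes>\<^bsub>R\<^esub> A b b')" .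
qed

lemma coord_hom:
  assumes "based_module R M B" "based_module R N B'" "f \<in> left_module_hom R M N"
    and fin: "finite S" "S \<subseteq> B" "{b. coord R M B x b \<noteq> \<zero>\<^bsub>R\<^esub>} \<subseteq> S" and x: "x \<in> carrier M"
  shows "coord R N B' (f x) b' = (\<Oplus>\<^bsub>R\<^esub>b\<in>S. coord R M B x b \<otimes>\<^bsub>R\<^esub> coord R N B' (f b) b')"
proof -
  interpret M: based_module R M B by fact
  interpret N: based_module R N B' by fact
  note f = left_module_homD[OF assms(3)]
  note c = M.coord_props[OF x]
  have BM: "b \<in> carrier M" if "b \<in> S" for b using that fin(2) M.B_closed by blast
  have cl: "coord R M B x b \<odot>\<^bsub>M\<^esub> b \<in> carrier M" if "b \<in> S" for b
    using M.smult_closed M.coord_closed[OF x] BM that by blast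
  have "x = (\<Oplus>\<^bsub>M\<^esub>b\<in>S. coord R M B x b \<odot>\<^bsub>M\<^esub> b)"
    using M.lin_comb_eq[OF c(1) M.B_closed fin] c(2) by simp
  then have "f x = f (\<Oplus>\<^bsub>M\<^esub>b\<in>S. coord R M B x b \<odot>\<^bsub>M\<^esub> b)" by simp
  also have "\<dots> = (\<Oplus>\<^bsub>N\<^esub>b\<in>S. f (coord R M B x b \<odot>\<^bsub>M\<^esub> b))"
    by (rule left_module_hom_finsum[OF M.left_module_axioms N.left_module_axioms assms(3) fin(1) cl])
  finally have "coord R N B' (f x) b' = (\<Oplus>\<^bsub>R\<^esub>b\<in>S. coord R N B' (f (coord R M B x b \<odot>\<^bsub>M\<^esub> b)) b')"
    using N.coord_finsum[OF fin(1), of "\<lambda>b. f (coord R M B x b \<odot>\<^bsub>M\<^esub> b)"] f(1)[OF cl] by simp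
  also have "\<dots> = (\<Oplus>\<^bsub>R\<^esub>b\<in>S. coord R M B x b \<otimes>\<^bsub>R\<^esub> coord R N B' (f b) b')"
    using f BM M.coord_closed[OF x] N.coord_closed
    by (intro M.R.finsum_cong') (auto simp: N.coord_smult)
  finally show ?thesis .
qed

section \<open>Minimal free complexes\<close>

text \<open>Gaussian elimination on the coordinate p: a vector with nonzero entry at p is the pivot,
  the others are reduced by it, and the coefficient s of the pivot is chosen afterwards so that the
  sum vanishes at p.\<close>

lemma linear_dependency:
  fixes v :: "'j \<Rightarrow> 'p \<Rightarrow> 'k::field"
  assumes "finite P" "finite J" "card P < card J"
  shows "\<exists>c. (\<exists>j\<in>J. c j \<noteq> 0) \<and> (\<forall>p\<in>P. (\<Sum>j\<in>J. c j * v j p) = 0)"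
  using assms
proof (induction P arbitrary: J v rule: finite_induct)
  case empty
  then obtain j where "j \<in> J" by fastforce
  then show ?case by (intro exI[of _ "\<lambda>_. 1"]) auto
next
  case (insert p P)
  show ?case
  proof (cases "\<forall>j\<in>J. v j p = 0")
    case True
    have "card P < card J" using insert.hyps insert.prems by simp
    then obtain c where "\<exists>j\<in>J. c j \<noteq> 0" "\<forall>p\<in>P. (\<Sum>j\<in>J. c j * v j p) = 0" using insert.IH insert.prems(1) by blast
    then show ?thesis using True by (intro exI[of _ c]) auto
  next
    case False
    then obtain j0 where j0: "j0 \<in> J" "v j0 p \<noteq> 0" by blast
    define J' where "J' = J - {j0}"
    have J: "J = insert j0 J'" "finite J'" "j0 \<notin> J'" using j0(1) insert.prems(1) unfolding J'_def by auto
    have "card P < card J'" using insert.hyps insert.prems J by simp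
    then obtain c where c: "\<exists>j\<in>J'. c j \<noteq> 0" "\<forall>q\<in>P. (\<Sum>j\<in>J'. c j * (v j q - v j p / v j0 p * v j0 q)) = 0"
      using insert.IH[OF J(2), of "\<lambda>j q. v j q - v j p / v j0 p * v j0 q"] by blast
    define s where "s = - (\<Sum>j\<in>J'. c j * v j p) / v j0 p"
    define c' where "c' = c(j0 := s)"
    have sum: "(\<Sum>j\<in>J. c' j * v j q) = s * v j0 q + (\<Sum>j\<in>J'. c j * v j q)" for q
      unfolding J(1) c'_def using J(2,3) by (simp, intro sum.cong) auto
    have "(\<Sum>j\<in>J. c' j * v j q) = 0" if q: "q \<in> insert p P" for q
    proof (cases "q = p")
      case True
      then show ?thesis unfolding sum s_def using j0(2) by simp
    next
      case False
      have "0 = (\<Sum>j\<in>J'. c j * (v j q - v j p / v j0 p * v j0 q))" using c(2) q False by simp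
      also have "\<dots> = (\<Sum>j\<in>J'. c j * v j q) - (\<Sum>j\<in>J'. c j * v j p) / v j0 p * v j0 q"
        by (simp add: right_diff_distrib sum_subtractf sum_distrib_right sum_divide_distrib mult.assoc)
      finally show ?thesis unfolding sum s_def by simp
    qed
    moreover have "\<exists>j\<in>J. c' j \<noteq> 0" using c(1) J unfolding c'_def by auto
    ultimately show ?thesis by blast
  qed
qed

lemma (in left_module) lin_comb_finsum:
  assumes "finite J" "\<And>j. j \<in> J \<Longrightarrow> a j \<in> carrier R" "\<And>j. j \<in> J \<Longrightarrow> u j \<in> finite_coeffs R S" "S \<subseteq> carrier M"
  shows "(\<lambda>s. \<Oplus>j\<in>J. a j \<otimes> u j s) \<in> finite_coeffs R S \<and>
    lin_comb R M (\<lambda>s. \<Oplus>j\<in>J. a j \<otimes> u j s) = (\<Oplus>\<^bsub>M\<^esub>j\<in>J. a j \<odot>\<^bsub>M\<^esub> lin_comb R M (u j))"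
  using assms(1-3)
proof (induction J rule: finite_induct)
  case empty
  have "(\<lambda>s. \<zero>) \<in> finite_coeffs R S" unfolding finite_coeffs_def by simp
  moreover have "lin_comb R M (\<lambda>s. \<zero>) = \<zero>\<^bsub>M\<^esub>" unfolding lin_comb_def by simp
  ultimately show ?case by simp
next
  case (insert x J)
  have cl: "a j \<otimes> u j s \<in> carrier R" if "j \<in> insert x J" for j s
    using finite_coeffsD(3)[OF insert.prems(2)[OF that]] insert.prems(1)[OF that] by simp
  have eq: "(\<lambda>s. \<Oplus>j\<in>insert x J. a j \<otimes> u j s) = (\<lambda>s. a x \<otimes> u x s \<oplus> (\<Oplus>j\<in>J. a j \<otimes> u j s))"
    using insert(1,2) cl by (intro ext R.finsum_insert) auto
  have x: "(\<lambda>s. a x \<otimes> u x s) \<in> finite_coeffs R S" using insert.prems by (intro finite_coeffs_smult) auto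
  have IH: "(\<lambda>s. \<Oplus>j\<in>J. a j \<otimes> u j s) \<in> finite_coeffs R S"
    "lin_comb R M (\<lambda>s. \<Oplus>j\<in>J. a j \<otimes> u j s) = (\<Oplus>\<^bsub>M\<^esub>j\<in>J. a j \<odot>\<^bsub>M\<^esub> lin_comb R M (u j))"
    using insert.IH insert.prems by auto
  have mcl: "a j \<odot>\<^bsub>M\<^esub> lin_comb R M (u j) \<in> carrier M" if "j \<in> insert x J" for j
    using lin_comb_closed[OF insert.prems(2)[OF that] assms(4)] insert.prems(1)[OF that] smult_closed by simp
  have "lin_comb R M (\<lambda>s. a x \<otimes> u x s) = a x \<odot>\<^bsub>M\<^esub> lin_comb R M (u x)"
    using insert.prems assms(4) by (intro lin_comb_smult) auto
  moreover have "(\<Oplus>\<^bsub>M\<^esub>j\<in>insert x J. a j \<odot>\<^bsub>M\<^esub> lin_comb R M (u j)) =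
      a x \<odot>\<^bsub>M\<^esub> lin_comb R M (u x) \<oplus>\<^bsub>M\<^esub> (\<Oplus>\<^bsub>M\<^esub>j\<in>J. a j \<odot>\<^bsub>M\<^esub> lin_comb R M (u j))"
    using insert(1,2) mcl by (intro M.finsum_insert) auto
  ultimately show ?case unfolding eq using finite_coeffs_add[OF x IH(1)] lin_comb_add[OF x IH(1) assms(4)] IH(2) by simp
qed

context exterior_model
begin

section \<open>Dimension bounds over the ground field\<close>

lemma phi_finsum:
  assumes "finite A" "\<And>i. i \<in> A \<Longrightarrow> g i \<in> carrier EA"
  shows "phi (finsum EA g A) = (\<lambda>I. \<Sum>i\<in>A. phi (g i) I)"
  using assms
proof (induction A rule: finite_induct)
  case empty show ?case by (simp add: phi_zero fun_eq_iff)
next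
  case (insert x A)
  then have "phi (finsum EA g (insert x A)) = phi (g x) + phi (finsum EA g A)"
    by (simp add: Pi_def phi_add EA.finsum_closed del: plus_fun_apply)
  then show ?case using insert by (simp add: fun_eq_iff)
qed

lemma phi_finsum_empty:
  assumes "finite A" "\<And>i. i \<in> A \<Longrightarrow> a i \<in> carrier EA" "\<And>i. i \<in> A \<Longrightarrow> b i \<in> carrier EA"
  shows "phi (\<Oplus>\<^bsub>EA\<^esub>i\<in>A. a i \<otimes>\<^bsub>EA\<^esub> b i) {} = (\<Sum>i\<in>A. phi (a i) {} * phi (b i) {})"
  using phi_finsum[OF assms(1), of "\<lambda>i. a i \<otimes>\<^bsub>EA\<^esub> b i"] assms by (simp add: phi_mult_empty)

text \<open>Over K the coefficient vectors have |S| 2^n coordinates, indexed by a generator and a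
  monomial. A relation between chosen coefficient vectors u j passes to the elements y j, although S
  need not be a basis.\<close>

lemma module_dependency:
  assumes N: "left_module EA N" and S: "finite S" "S \<subseteq> carrier N"
    and J: "finite J" "card (S \<times> Pow {..<n}) < card J"
    and y: "\<And>j. j \<in> J \<Longrightarrow> y j \<in> lin_comb EA N ` finite_coeffs EA S"
  shows "\<exists>c. (\<exists>j\<in>J. c j \<noteq> 0) \<and> (\<Oplus>\<^bsub>N\<^esub>j\<in>J. scal (c j) \<odot>\<^bsub>N\<^esub> y j) = \<zero>\<^bsub>N\<^esub>"
proof -
  interpret N: left_module EA N by fact
  have "\<forall>j\<in>J. \<exists>u. u \<in> finite_coeffs EA S \<and> y j = lin_comb EA N u" using y by blast
  then obtain u where u: "\<And>j. j \<in> J \<Longrightarrow> u j \<in> finite_coeffs EA S" "\<And>j. j \<in> J \<Longrightarrow> y j = lin_comb EA N (u j)"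
    by metis
  have "finite (S \<times> Pow {..<n})" using S(1) by simp
  from linear_dependency[OF this J, of "\<lambda>j (s, I). phi (u j s) I"]
  obtain c where c: "\<exists>j\<in>J. c j \<noteq> 0" "\<And>s I. s \<in> S \<Longrightarrow> I \<subseteq> {..<n} \<Longrightarrow> (\<Sum>j\<in>J. c j * phi (u j s) I) = 0" by auto
  have cl: "u j s \<in> carrier EA" if "j \<in> J" for j s using N.finite_coeffsD(3)[OF u(1)[OF that]] .
  have zero: "(\<Oplus>\<^bsub>EA\<^esub>j\<in>J. scal (c j) \<otimes>\<^bsub>EA\<^esub> u j s) = \<zero>\<^bsub>EA\<^esub>" for s
  proof (rule phi_inj)
    have ph: "phi (\<Oplus>\<^bsub>EA\<^esub>j\<in>J. scal (c j) \<otimes>\<^bsub>EA\<^esub> u j s) I = (\<Sum>j\<in>J. c j * phi (u j s) I)" for I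
      using phi_finsum[OF J(1), of "\<lambda>j. scal (c j) \<otimes>\<^bsub>EA\<^esub> u j s"] cl by (simp add: phi_scal)
    have "(\<Sum>j\<in>J. c j * phi (u j s) I) = 0" for I
    proof (cases "s \<in> S \<and> I \<subseteq> {..<n}")
      case False
      have "phi (u j s) I = 0" if j: "j \<in> J" for j
      proof (cases "s \<in> S")
        case True
        then show ?thesis using False deg_in_phi[OF cl[OF j], of s] unfolding deg_in_UNIV by blast
      next
        case False
        then show ?thesis using N.finite_coeffsD(4)[OF u(1)[OF j]] by (simp add: phi_zero)
      qed
      then show ?thesis by simp
    qed (use c(2) in blast)
    then show "phi (\<Oplus>\<^bsub>EA\<^esub>j\<in>J. scal (c j) \<otimes>\<^bsub>EA\<^esub> u j s) = phi \<zero>\<^bsub>EA\<^esub>"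
      using ph by (simp add: fun_eq_iff phi_zero)
  qed (use cl in auto)
  have "(\<Oplus>\<^bsub>N\<^esub>j\<in>J. scal (c j) \<odot>\<^bsub>N\<^esub> y j) = (\<Oplus>\<^bsub>N\<^esub>j\<in>J. scal (c j) \<odot>\<^bsub>N\<^esub> lin_comb EA N (u j))"
    using u N.smult_closed N.lin_comb_closed[OF u(1) S(2)] by (intro N.M.finsum_cong') auto
  also have "\<dots> = lin_comb EA N (\<lambda>s. \<zero>\<^bsub>EA\<^esub>)"
    using N.lin_comb_finsum[of J "\<lambda>j. scal (c j)" u S, OF J(1) _ u(1) S(2)] zero by simp
  also have "\<dots> = \<zero>\<^bsub>N\<^esub>" unfolding lin_comb_def by simp
  finally show ?thesis using c(1) by blast
qed

text \<open>All finite subsets of B have at most |S| 2^n elements. Finite rank is always proved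
  through this criterion; y sends basis elements either to their images or to preimages of the
  associated socle elements.\<close>

lemma finite_of_no_dependency:
  assumes N: "left_module EA N" and S: "finite S" "S \<subseteq> carrier N"
    and y: "\<And>b. b \<in> B \<Longrightarrow> y b \<in> lin_comb EA N ` finite_coeffs EA S"
    and indep: "\<And>J c. finite J \<Longrightarrow> J \<subseteq> B \<Longrightarrow> (\<Oplus>\<^bsub>N\<^esub>b\<in>J. scal (c b) \<odot>\<^bsub>N\<^esub> y b) = \<zero>\<^bsub>N\<^esub> \<Longrightarrow> \<forall>b\<in>J. c b = 0"
  shows "finite B"
proof (rule finite_if_finite_subsets_card_bdd[THEN conjunct1])
  fix J assume J: "J \<subseteq> B" "finite J"
  show "card J \<le> card (S \<times> Pow {..<n})"
  proof (rule ccontr)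
    assume "\<not> card J \<le> card (S \<times> Pow {..<n})"
    then obtain c where "\<exists>j\<in>J. c j \<noteq> 0" "(\<Oplus>\<^bsub>N\<^esub>j\<in>J. scal (c j) \<odot>\<^bsub>N\<^esub> y j) = \<zero>\<^bsub>N\<^esub>"
      using module_dependency[OF N S J(2), of y] y J(1) by force
    then show False using indep[OF J(2,1)] by blast
  qed
qed

text \<open>The product of all generators, spanning the socle of the algebra. It plays the part in
  the injective case that reduction modulo the maximal ideal plays in the free case.\<close>

definition top_elem :: "('v list \<Rightarrow> 'k) set" where
  "top_elem = cls (std (\<lambda>I. if I = {..<n} then 1 else 0))"

lemma top_elem_closed [simp]: "top_elem \<in> carrier EA"
  unfolding top_elem_def by (rule exterior_class_closed[OF std_closed])

lemma phi_top_elem: "phi top_elem = (\<lambda>I. if I = {..<n} then 1 else 0)"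
  unfolding top_elem_def by (rule phi_std) (simp add: deg_in_UNIV)

lemma deg_in_of_phi_empty: "a \<in> carrier EA \<Longrightarrow> phi a {} = 0 \<Longrightarrow> deg_in n {1..} (phi a)"
  using deg_in_phi[of a] unfolding deg_in_def
  by (metis One_nat_def Suc_leI atLeast_iff card_gt_0_iff finite_lessThan finite_subset)

lemma deg_in_above_eq_0: "deg_in n {m..} f \<Longrightarrow> n < m \<Longrightarrow> f = 0"
  unfolding deg_in_def fun_eq_iff
  by (metis atLeast_iff card_lessThan card_mono finite_lessThan not_le order_trans zero_fun_apply)

lemma top_elem_mult: assumes "a \<in> carrier EA" "phi a {} = 0" shows "top_elem \<otimes>\<^bsub>EA\<^esub> a = \<zero>\<^bsub>EA\<^esub>"
proof (rule phi_inj)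
  have "deg_in n {n} (phi top_elem)" unfolding phi_top_elem deg_in_def by simp
  then have "deg_in n {Suc n..} (phi (top_elem \<otimes>\<^bsub>EA\<^esub> a))"
    unfolding phi_mult[OF top_elem_closed assms(1)]
    by (intro deg_in_model_mult[OF _ deg_in_of_phi_empty[OF assms]]) auto
  then have "phi (top_elem \<otimes>\<^bsub>EA\<^esub> a) = 0" by (rule deg_in_above_eq_0) simp
  then show "phi (top_elem \<otimes>\<^bsub>EA\<^esub> a) = phi \<zero>\<^bsub>EA\<^esub>" using phi_zero by (rule trans[OF _ sym])
qed (use assms in auto)

end

section \<open>Radical and socle of the terms of a minimal complex\<close>

locale minimal_complex = exterior_model scale Basis n bas
  for scale :: "'k::field \<Rightarrow> 'v::ab_group_add \<Rightarrow> 'v" and Basis n bas +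
  fixes G :: "(('v list \<Rightarrow> 'k) set, 'c) cochain" and B :: "int \<Rightarrow> 'c set"
  assumes minimal: "minimal_free_wrt scale G B"
begin

abbreviation "gcoord i \<equiv> coord EA (obj G i) (B i)"

lemma cochain: "left_module EA (obj G i)" "diff G i \<in> left_module_hom EA (obj G i) (obj G (i + 1))"
    "x \<in> carrier (obj G i) \<Longrightarrow> diff G (i + 1) (diff G i x) = \<zero>\<^bsub>obj G (i + 2)\<^esub>"
  using minimal unfolding minimal_free_wrt_def is_cochain_def by auto

lemma based: "based_module EA (obj G i) (B i)"
  using minimal cochain(1) unfolding minimal_free_wrt_def based_module_def based_module_axioms_def by blast

lemma diff_minimal: "b \<in> B i \<Longrightarrow> b' \<in> B (i + 1) \<Longrightarrow> gcoord (i + 1) (diff G i b) b' \<in> exterior_max_ideal scale"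
  using minimal unfolding minimal_free_wrt_def matrix_of_def by blast

lemma diff_closed: "x \<in> carrier (obj G i) \<Longrightarrow> diff G i x \<in> carrier (obj G (i + 1))"
  using left_module_homD(1)[OF cochain(2)] .

lemma diff_entry:
  assumes "b \<in> B i"
  shows "gcoord (i + 1) (diff G i b) b' \<in> carrier EA" "phi (gcoord (i + 1) (diff G i b) b') {} = 0"
proof -
  interpret M: based_module EA "obj G i" "B i" by (rule based)
  interpret N: based_module EA "obj G (i + 1)" "B (i + 1)" by (rule based)
  have c: "diff G i b \<in> carrier (obj G (i + 1))" using diff_closed M.B_closed assms by blast
  show "gcoord (i + 1) (diff G i b) b' \<in> carrier EA" using N.coord_closed[OF c] .
  show "phi (gcoord (i + 1) (diff G i b) b') {} = 0"
    using phi_max_ideal[OF diff_minimal[OF assms]] N.coord_outside[OF c] phi_zero by (cases "b' \<in> B (i + 1)") auto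
qed

text \<open>The maximal ideal times the i-th term, recognised by the constant terms of the
  coordinates.\<close>

definition rad :: "int \<Rightarrow> 'c set" where
  "rad i = {x \<in> carrier (obj G i). \<forall>b. phi (gcoord i x b) {} = 0}"

text \<open>Constant terms are multiplicative. The product in the assumption vanishes in two
  situations: the entries of f lack constant terms, as for the differential, or the coordinates of x
  do, for arbitrary f.\<close>

lemma hom_rad:
  assumes f: "f \<in> left_module_hom EA (obj G i) (obj G j)" and x: "x \<in> carrier (obj G i)"
    and 0: "\<And>b b'. b \<in> B i \<Longrightarrow> phi (gcoord i x b) {} * phi (gcoord j (f b) b') {} = 0"
  shows "f x \<in> rad j"
proof -
  interpret M: based_module EA "obj G i" "B i" by (rule based)
  interpret N: based_module EA "obj G j" "B j" by (rule based)
  note c = M.finite_coeffsD[OF M.coord_props(1)[OF x]]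
  have fb: "f b \<in> carrier (obj G j)" if "b \<in> B i" for b using that M.B_closed left_module_homD(1)[OF f] by blast
  let ?S = "{b. gcoord i x b \<noteq> \<zero>\<^bsub>EA\<^esub>}"
  have "phi (gcoord j (f x) b') {} = 0" for b'
  proof -
    have "phi (gcoord j (f x) b') {} = (\<Sum>b\<in>?S. phi (gcoord i x b) {} * phi (gcoord j (f b) b') {})"
      unfolding coord_hom[OF based based f c(1,2) order_refl x]
      using c(1-3) N.coord_closed[OF fb] by (intro phi_finsum_empty) auto
    also have "\<dots> = 0" using 0 c(2) by (intro sum.neutral ballI) blast
    finally show ?thesis .
  qed
  then show ?thesis unfolding rad_def using left_module_homD(1)[OF f x] by blast
qed

lemma diff_rad: "x \<in> carrier (obj G i) \<Longrightarrow> diff G i x \<in> rad (i + 1)"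
  using diff_entry(2) by (intro hom_rad[OF cochain(2)]) auto

lemma hom_rad_rad: "f \<in> left_module_hom EA (obj G i) (obj G j) \<Longrightarrow> x \<in> rad i \<Longrightarrow> f x \<in> rad j"
  by (intro hom_rad) (auto simp: rad_def)

lemma carrier_of_empty_basis: "B i = {} \<Longrightarrow> carrier (obj G i) = {\<zero>\<^bsub>obj G i\<^esub>}"
proof -
  assume B: "B i = {}"
  interpret M: based_module EA "obj G i" "B i" by (rule based)
  have "x = \<zero>\<^bsub>obj G i\<^esub>" if "x \<in> carrier (obj G i)" for x
    using that M.coord_outside[OF that] B M.coord_zero by (intro M.coord_inj) auto
  then show ?thesis by auto
qed

lemma coord_scal_sum:
  assumes J: "finite J" "J \<subseteq> B i" and a: "\<And>b. b \<in> J \<Longrightarrow> a b \<in> carrier EA" and b: "b \<in> J"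
  shows "gcoord i (\<Oplus>\<^bsub>obj G i\<^esub>b\<in>J. a b \<odot>\<^bsub>obj G i\<^esub> b) b = a b"
proof -
  interpret M: based_module EA "obj G i" "B i" by (rule based)
  have JM: "x \<in> carrier (obj G i)" if "x \<in> J" for x using that J(2) M.B_closed by blast
  have "gcoord i (\<Oplus>\<^bsub>obj G i\<^esub>b\<in>J. a b \<odot>\<^bsub>obj G i\<^esub> b) b = (\<Oplus>\<^bsub>EA\<^esub>x\<in>J. gcoord i (a x \<odot>\<^bsub>obj G i\<^esub> x) b)"
    using J(1) M.smult_closed a JM by (intro M.coord_finsum) auto
  also have "\<dots> = (\<Oplus>\<^bsub>EA\<^esub>x\<in>J. if b = x then a x else \<zero>\<^bsub>EA\<^esub>)"
  proof (rule EA.finsum_cong')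
    fix x assume x: "x \<in> J"
    have "gcoord i x = M.delta x" using M.coord_basis x J(2) by blast
    then show "gcoord i (a x \<odot>\<^bsub>obj G i\<^esub> x) b = (if b = x then a x else \<zero>\<^bsub>EA\<^esub>)"
      using M.coord_smult[OF a[OF x] JM[OF x]] a[OF x] by (simp add: M.delta_def)
  qed (use a in auto)
  also have "\<dots> = a b" using J(1) b a by (intro EA.add.finprod_singleton) auto
  finally show ?thesis .
qed

text \<open>The coordinate of the sum at b is the scalar \<open>c b\<close>, which equals its own
  constant term. In other words, a basis stays independent over K modulo the radical.\<close>

lemma coord_scal_sum_rad:
  assumes "finite J" "J \<subseteq> B i" "(\<Oplus>\<^bsub>obj G i\<^esub>b\<in>J. scal (c b) \<odot>\<^bsub>obj G i\<^esub> b) \<in> rad i"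
  shows "\<forall>b\<in>J. c b = 0"
proof
  fix b assume b: "b \<in> J"
  have "gcoord i (\<Oplus>\<^bsub>obj G i\<^esub>b\<in>J. scal (c b) \<odot>\<^bsub>obj G i\<^esub> b) b = scal (c b)"
    by (rule coord_scal_sum[OF assms(1,2) _ b, of "\<lambda>b. scal (c b)"]) simp
  moreover have "phi (gcoord i (\<Oplus>\<^bsub>obj G i\<^esub>b\<in>J. scal (c b) \<odot>\<^bsub>obj G i\<^esub> b) b) {} = 0"
    using assms(3) unfolding rad_def by simp
  ultimately have "phi (scal (c b)) {} = 0" by (rule subst)
  moreover have "phi (scal (c b)) = (\<lambda>I. c b * vacuum I)" using phi_scal[OF EA.one_closed, of "c b"] phi_one by simp
  ultimately show "c b = 0" by (simp add: vacuum_def)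
qed

lemma coord_top_sum_zero:
  assumes "finite J" "J \<subseteq> B i"
    "(\<Oplus>\<^bsub>obj G i\<^esub>b\<in>J. scal (c b) \<odot>\<^bsub>obj G i\<^esub> (top_elem \<odot>\<^bsub>obj G i\<^esub> b)) = \<zero>\<^bsub>obj G i\<^esub>"
  shows "\<forall>b\<in>J. c b = 0"
proof
  fix b assume b: "b \<in> J"
  interpret M: based_module EA "obj G i" "B i" by (rule based)
  have JM: "x \<in> carrier (obj G i)" if "x \<in> J" for x using that assms(2) M.B_closed by blast
  have "(\<Oplus>\<^bsub>obj G i\<^esub>b\<in>J. (scal (c b) \<otimes>\<^bsub>EA\<^esub> top_elem) \<odot>\<^bsub>obj G i\<^esub> b) =
      (\<Oplus>\<^bsub>obj G i\<^esub>b\<in>J. scal (c b) \<odot>\<^bsub>obj G i\<^esub> (top_elem \<odot>\<^bsub>obj G i\<^esub> b))"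
    using JM by (intro M.M.finsum_cong') (auto simp: M.smult_assoc1 M.smult_closed)
  then have "scal (c b) \<otimes>\<^bsub>EA\<^esub> top_elem = \<zero>\<^bsub>EA\<^esub>"
    using coord_scal_sum[OF assms(1,2) _ b, of "\<lambda>b. scal (c b) \<otimes>\<^bsub>EA\<^esub> top_elem"] assms(3) M.coord_zero by simp
  then have "phi (scal (c b) \<otimes>\<^bsub>EA\<^esub> top_elem) {..<n} = 0" using phi_zero by simp
  then show "c b = 0" using phi_scal[OF top_elem_closed] phi_top_elem by simp
qed

lemma top_elem_rad: assumes "x \<in> rad i" shows "top_elem \<odot>\<^bsub>obj G i\<^esub> x = \<zero>\<^bsub>obj G i\<^esub>"
proof -
  interpret M: based_module EA "obj G i" "B i" by (rule based)
  have x: "x \<in> carrier (obj G i)" "\<And>b. phi (gcoord i x b) {} = 0" using assms unfolding rad_def by auto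
  show ?thesis
    using M.coord_smult[OF top_elem_closed x(1)] top_elem_mult[OF M.coord_closed[OF x(1)] x(2)] M.coord_zero x(1) M.smult_closed
    by (intro M.coord_inj) auto
qed

lemma diff_top: assumes "b \<in> B i" shows "diff G i (top_elem \<odot>\<^bsub>obj G i\<^esub> b) = \<zero>\<^bsub>obj G (i + 1)\<^esub>"
proof -
  interpret M: based_module EA "obj G i" "B i" by (rule based)
  have b: "b \<in> carrier (obj G i)" using assms M.B_closed by blast
  show ?thesis using left_module_homD(3)[OF cochain(2) top_elem_closed b] top_elem_rad[OF diff_rad[OF b]] by simp
qed

lemma carrier_span: "carrier (obj G i) \<subseteq> lin_comb EA (obj G i) ` finite_coeffs EA (B i)"
proof
  interpret M: based_module EA "obj G i" "B i" by (rule based)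
  fix x assume "x \<in> carrier (obj G i)"
  then show "x \<in> lin_comb EA (obj G i) ` finite_coeffs EA (B i)" using M.coord_props by (metis imageI)
qed

text \<open>The images \<open>diff G i b\<close> are independent over K: a vanishing combination is
  the image of a cocycle, which by exactness is a coboundary and so lies in the radical, where basis
  combinations are trivial.\<close>

lemma finite_basis_pred:
  assumes fin: "finite (B (i + 1))" and ex: "cocycles G i \<subseteq> coboundaries G i"
  shows "finite (B i)"
proof -
  interpret M: based_module EA "obj G i" "B i" by (rule based)
  interpret N: based_module EA "obj G (i + 1)" "B (i + 1)" by (rule based)
  show ?thesis
  proof (rule finite_of_no_dependency[OF cochain(1) fin N.B_closed, of "B i" "diff G i"])
    show "diff G i b \<in> lin_comb EA (obj G (i + 1)) ` finite_coeffs EA (B (i + 1))" if "b \<in> B i" for b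
      using carrier_span diff_closed M.B_closed that by blast
    show "\<forall>b\<in>J. c b = 0" if J: "finite J" "J \<subseteq> B i"
      and 0: "(\<Oplus>\<^bsub>obj G (i + 1)\<^esub>b\<in>J. scal (c b) \<odot>\<^bsub>obj G (i + 1)\<^esub> diff G i b) = \<zero>\<^bsub>obj G (i + 1)\<^esub>" for J c
    proof -
      have JM: "b \<in> carrier (obj G i)" if "b \<in> J" for b using that J(2) M.B_closed by blast
      let ?z = "\<Oplus>\<^bsub>obj G i\<^esub>b\<in>J. scal (c b) \<odot>\<^bsub>obj G i\<^esub> b"
      have cl: "scal (c b) \<odot>\<^bsub>obj G i\<^esub> b \<in> carrier (obj G i)" if "b \<in> J" for b using M.smult_closed JM[OF that] by simp
      have "diff G i ?z = (\<Oplus>\<^bsub>obj G (i + 1)\<^esub>b\<in>J. diff G i (scal (c b) \<odot>\<^bsub>obj G i\<^esub> b))"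
        by (rule left_module_hom_finsum[OF cochain(1) cochain(1) cochain(2) J(1) cl])
      also have "\<dots> = \<zero>\<^bsub>obj G (i + 1)\<^esub>"
        unfolding 0[symmetric] using JM diff_closed N.smult_closed left_module_homD(3)[OF cochain(2)]
        by (intro N.M.finsum_cong') auto
      finally have "?z \<in> cocycles G i" unfolding cocycles_def using cl by (auto intro: M.M.finsum_closed)
      then obtain w where w: "w \<in> carrier (obj G (i - 1))" "?z = diff G (i - 1) w" using ex unfolding coboundaries_def by blast
      then have "?z \<in> rad i" using diff_rad[OF w(1)] by simp
      then show ?thesis by (rule coord_scal_sum_rad[OF J])
    qed
  qed
qed

text \<open>The socle elements \<open>top_elem\<close> b are cocycles, since the differential of b
  lies in the radical, which \<open>top_elem\<close> kills. By exactness they have preimages y b,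
  and a relation between the preimages is mapped to one between the socle elements.\<close>

lemma finite_basis_succ:
  assumes fin: "finite (B i)" and ex: "cocycles G (i + 1) \<subseteq> coboundaries G (i + 1)"
  shows "finite (B (i + 1))"
proof -
  interpret M: based_module EA "obj G i" "B i" by (rule based)
  interpret N: based_module EA "obj G (i + 1)" "B (i + 1)" by (rule based)
  have "\<exists>y\<in>carrier (obj G i). diff G i y = top_elem \<odot>\<^bsub>obj G (i + 1)\<^esub> b" if b: "b \<in> B (i + 1)" for b
  proof -
    have "top_elem \<odot>\<^bsub>obj G (i + 1)\<^esub> b \<in> cocycles G (i + 1)"
      unfolding cocycles_def using diff_top[OF b] N.smult_closed[OF top_elem_closed] N.B_closed b by auto
    then have "top_elem \<odot>\<^bsub>obj G (i + 1)\<^esub> b \<in> diff G i ` carrier (obj G i)"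
      using ex unfolding coboundaries_def by auto
    then show ?thesis by (metis imageE)
  qed
  then obtain y where y: "\<And>b. b \<in> B (i + 1) \<Longrightarrow> y b \<in> carrier (obj G i)"
    "\<And>b. b \<in> B (i + 1) \<Longrightarrow> diff G i (y b) = top_elem \<odot>\<^bsub>obj G (i + 1)\<^esub> b" by metis
  show ?thesis
  proof (rule finite_of_no_dependency[OF cochain(1) fin M.B_closed, of "B (i + 1)" y])
    show "y b \<in> lin_comb EA (obj G i) ` finite_coeffs EA (B i)" if "b \<in> B (i + 1)" for b
      using carrier_span y(1)[OF that] by blast
    show "\<forall>b\<in>J. c b = 0" if J: "finite J" "J \<subseteq> B (i + 1)"
      and 0: "(\<Oplus>\<^bsub>obj G i\<^esub>b\<in>J. scal (c b) \<odot>\<^bsub>obj G i\<^esub> y b) = \<zero>\<^bsub>obj G i\<^esub>" for J c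
    proof -
      have yJ: "y b \<in> carrier (obj G i)" "diff G i (y b) = top_elem \<odot>\<^bsub>obj G (i + 1)\<^esub> b" if "b \<in> J" for b
        using y that J(2) by auto
      have cl: "scal (c b) \<odot>\<^bsub>obj G i\<^esub> y b \<in> carrier (obj G i)" if "b \<in> J" for b using M.smult_closed yJ(1)[OF that] by simp
      have "(\<Oplus>\<^bsub>obj G (i + 1)\<^esub>b\<in>J. scal (c b) \<odot>\<^bsub>obj G (i + 1)\<^esub> (top_elem \<odot>\<^bsub>obj G (i + 1)\<^esub> b)) =
          (\<Oplus>\<^bsub>obj G (i + 1)\<^esub>b\<in>J. diff G i (scal (c b) \<odot>\<^bsub>obj G i\<^esub> y b))"
        using cl diff_closed left_module_homD(3)[OF cochain(2) scal_closed yJ(1)] yJ(2)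
        by (intro N.M.finsum_cong') auto
      also have "\<dots> = diff G i (\<Oplus>\<^bsub>obj G i\<^esub>b\<in>J. scal (c b) \<odot>\<^bsub>obj G i\<^esub> y b)"
        by (rule left_module_hom_finsum[OF cochain(1) cochain(1) cochain(2) J(1) cl, symmetric])
      also have "\<dots> = \<zero>\<^bsub>obj G (i + 1)\<^esub>"
        unfolding 0 by (rule left_module_hom_zero[OF cochain(1) cochain(1) cochain(2)])
      finally show ?thesis by (rule coord_top_sum_zero[OF J])
    qed
  qed
qed

end

section \<open>Transfer along homotopy equivalences\<close>

context minimal_complex
begin

lemma rad_add:
  assumes "x \<in> rad i" "y \<in> rad i" shows "x \<oplus>\<^bsub>obj G i\<^esub> y \<in> rad i"
proof -
  interpret M: based_module EA "obj G i" "B i" by (rule based)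
  have xy: "x \<in> carrier (obj G i)" "y \<in> carrier (obj G i)" using assms unfolding rad_def by auto
  have "phi (gcoord i (x \<oplus>\<^bsub>obj G i\<^esub> y) b) {} = 0" for b
    using assms M.coord_add[OF xy] phi_add[OF M.coord_closed[OF xy(1)] M.coord_closed[OF xy(2)], of b b]
    unfolding rad_def by simp
  then show ?thesis unfolding rad_def using xy by simp
qed

lemma homotopyE:
  assumes "homotopy_equivalent EA F G"
  obtains f g h where "chain_map EA F G f" "chain_map EA G F g"
    "\<And>i. h i \<in> left_module_hom EA (obj G i) (obj G (i - 1))"
    "\<And>i x. x \<in> carrier (obj G i) \<Longrightarrow>
      f i (g i x) = x \<oplus>\<^bsub>obj G i\<^esub> (diff G (i - 1) (h i x) \<oplus>\<^bsub>obj G i\<^esub> h (i + 1) (diff G i x))"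
proof -
  obtain f g where fg: "chain_map EA F G f" "chain_map EA G F g" "homotopic_to_id EA G (\<lambda>i. f i \<circ> g i)"
    using assms unfolding homotopy_equivalent_def by blast
  obtain h where "\<And>i. h i \<in> left_module_hom EA (obj G i) (obj G (i - 1))"
    "\<And>i x. x \<in> carrier (obj G i) \<Longrightarrow>
      f i (g i x) = x \<oplus>\<^bsub>obj G i\<^esub> (diff G (i - 1) (h i x) \<oplus>\<^bsub>obj G i\<^esub> h (i + 1) (diff G i x))"
    using fg(3) unfolding homotopic_to_id_def by auto
  then show thesis using that fg(1,2) by blast
qed

lemma hom_pred:
  assumes "h \<in> left_module_hom EA (obj G (i + 1)) (obj G (i + 1 - 1))"
  shows "h \<in> left_module_hom EA (obj G (i + 1)) (obj G i)"
  using assms by simp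

lemma diff_pred_rad: "x \<in> carrier (obj G (i - 1)) \<Longrightarrow> diff G (i - 1) x \<in> rad i"
  using diff_rad[of x "i - 1"] by simp

text \<open>Where F vanishes the homotopy reads 0 = b + d h b + h d b. By minimality both correction
  terms lie in the radical, but the coordinate of b at itself is 1, with nonzero constant
  term.\<close>

lemma empty_basis:
  assumes eqv: "homotopy_equivalent EA F G" and F: "is_cochain EA F" and 0: "carrier (obj F i) = {\<zero>\<^bsub>obj F i\<^esub>}"
  shows "B i = {}"
proof (rule ccontr)
  assume "B i \<noteq> {}"
  then obtain b where b: "b \<in> B i" by blast
  interpret M: based_module EA "obj G i" "B i" by (rule based)
  obtain f g h where fg: "chain_map EA F G f" "chain_map EA G F g"
    and h: "\<And>i. h i \<in> left_module_hom EA (obj G i) (obj G (i - 1))"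
    and hom: "\<And>i x. x \<in> carrier (obj G i) \<Longrightarrow>
      f i (g i x) = x \<oplus>\<^bsub>obj G i\<^esub> (diff G (i - 1) (h i x) \<oplus>\<^bsub>obj G i\<^esub> h (i + 1) (diff G i x))"
    using homotopyE[OF eqv] by metis
  have bc: "b \<in> carrier (obj G i)" using b M.B_closed by blast
  have gh: "g i \<in> left_module_hom EA (obj G i) (obj F i)" and fh: "f i \<in> left_module_hom EA (obj F i) (obj G i)"
    using fg unfolding chain_map_def by auto
  have Fi: "left_module EA (obj F i)" using F unfolding is_cochain_def by blast
  have "g i b = \<zero>\<^bsub>obj F i\<^esub>" using left_module_homD(1)[OF gh bc] 0 by simp
  then have fgb: "f i (g i b) = \<zero>\<^bsub>obj G i\<^esub>" using left_module_hom_zero[OF Fi cochain(1) fh] by simp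
  define r where "r = diff G (i - 1) (h i b) \<oplus>\<^bsub>obj G i\<^esub> h (i + 1) (diff G i b)"
  have "diff G (i - 1) (h i b) \<in> rad i" using diff_pred_rad left_module_homD(1)[OF h bc] .
  moreover have "h (i + 1) (diff G i b) \<in> rad i" using hom_rad_rad[OF hom_pred[OF h] diff_rad[OF bc]] .
  ultimately have r: "r \<in> rad i" unfolding r_def by (rule rad_add)
  then have rc: "r \<in> carrier (obj G i)" unfolding rad_def by blast
  have "gcoord i (b \<oplus>\<^bsub>obj G i\<^esub> r) b = \<zero>\<^bsub>EA\<^esub>" using hom[OF bc] fgb M.coord_zero unfolding r_def by simp
  then have "\<one>\<^bsub>EA\<^esub> \<oplus>\<^bsub>EA\<^esub> gcoord i r b = \<zero>\<^bsub>EA\<^esub>"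
    using M.coord_add[OF bc rc] M.coord_basis[OF b] by (simp add: M.delta_def)
  then have "phi \<one>\<^bsub>EA\<^esub> {} + phi (gcoord i r b) {} = 0"
    using phi_add[OF EA.one_closed M.coord_closed[OF rc, of b]] phi_zero by (metis plus_fun_apply zero_fun_apply)
  then show False using r phi_one unfolding rad_def by (simp add: vacuum_def)
qed

lemma homotopy_cocycle:
  assumes h: "\<And>i. h i \<in> left_module_hom EA (obj G i) (obj G (i - 1))"
    and hom: "\<And>i x. x \<in> carrier (obj G i) \<Longrightarrow>
      k i x = x \<oplus>\<^bsub>obj G i\<^esub> (diff G (i - 1) (h i x) \<oplus>\<^bsub>obj G i\<^esub> h (i + 1) (diff G i x))"
    and z: "z \<in> cocycles G i"
  shows "h i z \<in> carrier (obj G (i - 1))" "k i z = z \<oplus>\<^bsub>obj G i\<^esub> diff G (i - 1) (h i z)"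
proof -
  interpret M: based_module EA "obj G i" "B i" by (rule based)
  have zc: "z \<in> carrier (obj G i)" "diff G i z = \<zero>\<^bsub>obj G (i + 1)\<^esub>" using z unfolding cocycles_def by auto
  show hz: "h i z \<in> carrier (obj G (i - 1))" using left_module_homD(1)[OF h zc(1)] .
  then have "diff G (i - 1) (h i z) \<in> carrier (obj G i)" using diff_closed[of _ "i - 1"] by simp
  moreover have "h (i + 1) \<zero>\<^bsub>obj G (i + 1)\<^esub> = \<zero>\<^bsub>obj G i\<^esub>" by (rule left_module_hom_zero[OF cochain(1) cochain(1) hom_pred[OF h]])
  ultimately show "k i z = z \<oplus>\<^bsub>obj G i\<^esub> diff G (i - 1) (h i z)" using hom[OF zc(1)] zc(2) by simp
qed

text \<open>If g z = d y, the homotopy gives z + d (h z) = f (g z) = d (f y), hence z = d (f y - h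
  z).\<close>

lemma coboundary_transfer:
  assumes fg: "chain_map EA F G f" "chain_map EA G F g"
    and h: "\<And>i. h i \<in> left_module_hom EA (obj G i) (obj G (i - 1))"
    and hom: "\<And>i x. x \<in> carrier (obj G i) \<Longrightarrow>
      f i (g i x) = x \<oplus>\<^bsub>obj G i\<^esub> (diff G (i - 1) (h i x) \<oplus>\<^bsub>obj G i\<^esub> h (i + 1) (diff G i x))"
    and z: "z \<in> cocycles G i" and gz: "g i z \<in> coboundaries F i"
  shows "z \<in> coboundaries G i"
proof -
  interpret M: based_module EA "obj G i" "B i" by (rule based)
  interpret N: based_module EA "obj G (i - 1)" "B (i - 1)" by (rule based)
  note k = homotopy_cocycle[where k = "\<lambda>i x. f i (g i x)", OF h hom z]
  have zc: "z \<in> carrier (obj G i)" using z unfolding cocycles_def by auto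
  obtain y where y: "y \<in> carrier (obj F (i - 1))" "g i z = diff F (i - 1) y" using gz unfolding coboundaries_def by blast
  have fy: "f (i - 1) y \<in> carrier (obj G (i - 1))"
    using fg(1) left_module_homD(1)[OF _ y(1)] unfolding chain_map_def by blast
  have "f (i - 1 + 1) (diff F (i - 1) y) = diff G (i - 1) (f (i - 1) y)"
    using fg(1) y(1) unfolding chain_map_def by blast
  then have eq: "diff G (i - 1) (f (i - 1) y) = z \<oplus>\<^bsub>obj G i\<^esub> diff G (i - 1) (h i z)" using y(2) k(2) by simp
  have dh: "diff G (i - 1) \<in> left_module_hom EA (obj G (i - 1)) (obj G i)" using cochain(2)[of "i - 1"] by simp
  note d = left_module_homD[OF dh]
  define w where "w = f (i - 1) y \<ominus>\<^bsub>obj G (i - 1)\<^esub> h i z"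
  have w: "w \<in> carrier (obj G (i - 1))" "w \<oplus>\<^bsub>obj G (i - 1)\<^esub> h i z = f (i - 1) y"
    unfolding w_def using fy k(1) by (simp_all add: a_minus_def N.M.add.m_assoc N.M.l_neg)
  have "diff G (i - 1) w \<oplus>\<^bsub>obj G i\<^esub> diff G (i - 1) (h i z) = z \<oplus>\<^bsub>obj G i\<^esub> diff G (i - 1) (h i z)"
    using d(2)[OF w(1) k(1)] w(2) eq by simp
  then have "diff G (i - 1) w = z" using d(1)[OF w(1)] d(1)[OF k(1)] zc by simp
  then show ?thesis unfolding coboundaries_def using w(1) by blast
qed

lemma chain_map_cocycles:
  assumes "chain_map EA G F g" "is_cochain EA F" "z \<in> cocycles G i"
  shows "g i z \<in> cocycles F i"
proof -
  have z: "z \<in> carrier (obj G i)" "diff G i z = \<zero>\<^bsub>obj G (i + 1)\<^esub>" using assms(3) unfolding cocycles_def by auto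
  have g: "\<And>i. g i \<in> left_module_hom EA (obj G i) (obj F i)" and gd: "g (i + 1) (diff G i z) = diff F i (g i z)"
    using assms(1) z(1) unfolding chain_map_def by auto
  have Fi: "left_module EA (obj F (i + 1))" using assms(2) unfolding is_cochain_def by blast
  show ?thesis unfolding cocycles_def
    using left_module_homD(1)[OF g z(1)] gd z(2) left_module_hom_zero[OF cochain(1) Fi g] by simp
qed

lemma exact_transfer:
  assumes eqv: "homotopy_equivalent EA F G" and F: "is_cochain EA F" and ex: "exact_at F i"
  shows "cocycles G i \<subseteq> coboundaries G i"
proof
  fix z assume z: "z \<in> cocycles G i"
  obtain f g h where fg: "chain_map EA F G f" "chain_map EA G F g"
    and h: "\<And>i. h i \<in> left_module_hom EA (obj G i) (obj G (i - 1))"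
    and hom: "\<And>i x. x \<in> carrier (obj G i) \<Longrightarrow>
      f i (g i x) = x \<oplus>\<^bsub>obj G i\<^esub> (diff G (i - 1) (h i x) \<oplus>\<^bsub>obj G i\<^esub> h (i + 1) (diff G i x))"
    using homotopyE[OF eqv] by metis
  have "g i z \<in> coboundaries F i" using chain_map_cocycles[OF fg(2) F z] ex unfolding exact_at_def by blast
  then show "z \<in> coboundaries G i" using coboundary_transfer[of F f g h z i, OF fg h hom z] by blast
qed

text \<open>The elements \<epsilon> (g b) of the finitely generated module M are independent over K:
  a relation makes the combination z of basis elements a cocycle, because degree 1 vanishes, with g
  z a coboundary. Then z is a coboundary and lies in the radical.\<close>

lemma finite_basis_free:
  assumes M: "fin_gen_module EA M" and eqv: "homotopy_equivalent EA F G" and res: "free_resolution EA M F"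
  shows "finite (B 0)"
proof -
  interpret G0: based_module EA "obj G 0" "B 0" by (rule based)
  have F: "is_cochain EA F" using res unfolding free_resolution_def by blast
  obtain \<epsilon> where e: "\<epsilon> \<in> left_module_hom EA (obj F 0) M"
    "{x \<in> carrier (obj F 0). \<epsilon> x = \<zero>\<^bsub>M\<^esub>} = coboundaries F 0"
    using res unfolding free_resolution_def by blast
  obtain S where S: "left_module EA M" "finite S" "S \<subseteq> carrier M" "carrier M = lin_comb EA M ` finite_coeffs EA S"
    using M unfolding fin_gen_module_def by blast
  interpret M: left_module EA M by (rule S(1))
  obtain f g h where fg: "chain_map EA F G f" "chain_map EA G F g"
    and h: "\<And>i. h i \<in> left_module_hom EA (obj G i) (obj G (i - 1))"
    and hom: "\<And>i x. x \<in> carrier (obj G i) \<Longrightarrow>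
      f i (g i x) = x \<oplus>\<^bsub>obj G i\<^esub> (diff G (i - 1) (h i x) \<oplus>\<^bsub>obj G i\<^esub> h (i + 1) (diff G i x))"
    using homotopyE[OF eqv] by metis
  have g: "g 0 \<in> left_module_hom EA (obj G 0) (obj F 0)" using fg(2) unfolding chain_map_def by blast
  have F0: "left_module EA (obj F 0)" using F unfolding is_cochain_def by blast
  have "B 1 = {}" using empty_basis[OF eqv F, of 1] res unfolding free_resolution_def by simp
  then have G1: "carrier (obj G 1) = {\<zero>\<^bsub>obj G 1\<^esub>}" by (rule carrier_of_empty_basis)
  note eD = left_module_homD[OF e(1)] and gD = left_module_homD[OF g]
  show ?thesis
  proof (rule finite_of_no_dependency[OF S(1-3), of "B 0" "\<lambda>b. \<epsilon> (g 0 b)"])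
    show "\<epsilon> (g 0 b) \<in> lin_comb EA M ` finite_coeffs EA S" if "b \<in> B 0" for b
      using eD(1)[OF gD(1)] G0.B_closed that unfolding S(4)[symmetric] by blast
    show "\<forall>b\<in>J. c b = 0" if J: "finite J" "J \<subseteq> B 0"
      and 0: "(\<Oplus>\<^bsub>M\<^esub>b\<in>J. scal (c b) \<odot>\<^bsub>M\<^esub> \<epsilon> (g 0 b)) = \<zero>\<^bsub>M\<^esub>" for J c
    proof -
      have JM: "b \<in> carrier (obj G 0)" if "b \<in> J" for b using that J(2) G0.B_closed by blast
      let ?z = "\<Oplus>\<^bsub>obj G 0\<^esub>b\<in>J. scal (c b) \<odot>\<^bsub>obj G 0\<^esub> b"
      have cl: "scal (c b) \<odot>\<^bsub>obj G 0\<^esub> b \<in> carrier (obj G 0)" if "b \<in> J" for b using G0.smult_closed JM[OF that] by simp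
      have z: "?z \<in> carrier (obj G 0)" using cl by (auto intro: G0.M.finsum_closed)
      have "g 0 ?z = (\<Oplus>\<^bsub>obj F 0\<^esub>b\<in>J. g 0 (scal (c b) \<odot>\<^bsub>obj G 0\<^esub> b))"
        by (rule left_module_hom_finsum[OF cochain(1) F0 g J(1) cl])
      then have "\<epsilon> (g 0 ?z) = \<epsilon> (\<Oplus>\<^bsub>obj F 0\<^esub>b\<in>J. g 0 (scal (c b) \<odot>\<^bsub>obj G 0\<^esub> b))" by simp
      also have "\<dots> = (\<Oplus>\<^bsub>M\<^esub>b\<in>J. \<epsilon> (g 0 (scal (c b) \<odot>\<^bsub>obj G 0\<^esub> b)))"
        by (rule left_module_hom_finsum[OF F0 S(1) e(1) J(1) gD(1)[OF cl]])
      also have "\<dots> = (\<Oplus>\<^bsub>M\<^esub>b\<in>J. scal (c b) \<odot>\<^bsub>M\<^esub> \<epsilon> (g 0 b))"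
        using JM eD gD M.smult_closed by (intro M.M.finsum_cong') auto
      finally have "\<epsilon> (g 0 ?z) = \<zero>\<^bsub>M\<^esub>" unfolding 0 .
      then have gz: "g 0 ?z \<in> coboundaries F 0" unfolding e(2)[symmetric] using gD(1)[OF z] by simp
      have zc: "?z \<in> cocycles G 0" unfolding cocycles_def using z diff_closed[OF z] G1 by simp
      have "?z \<in> coboundaries G 0" by (rule coboundary_transfer[of F f g h ?z 0, OF fg h hom zc gz])
      then have "?z \<in> rad 0" unfolding coboundaries_def using diff_pred_rad[where i = 0] by auto
      then show ?thesis by (rule coord_scal_sum_rad[OF J])
    qed
  qed
qed

text \<open>The socle elements \<open>top_elem\<close> b are cocycles, so their images under g come
  from elements y b of M. A relation between the y b gives f (g z) = 0 for the same combination z of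
  socle elements; as degree - 1 vanishes, the homotopy term does too and z = 0.\<close>

lemma finite_basis_injective:
  assumes M: "fin_gen_module EA M" and eqv: "homotopy_equivalent EA F G" and res: "injective_resolution EA M F"
  shows "finite (B 0)"
proof -
  interpret G0: based_module EA "obj G 0" "B 0" by (rule based)
  have F: "is_cochain EA F" using res unfolding injective_resolution_def by blast
  obtain \<eta> where e: "\<eta> \<in> left_module_hom EA M (obj F 0)" "\<eta> ` carrier M = cocycles F 0"
    using res unfolding injective_resolution_def by blast
  obtain S where S: "left_module EA M" "finite S" "S \<subseteq> carrier M" "carrier M = lin_comb EA M ` finite_coeffs EA S"
    using M unfolding fin_gen_module_def by blast
  interpret M: left_module EA M by (rule S(1))
  obtain f g h where fg: "chain_map EA F G f" "chain_map EA G F g"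
    and h: "\<And>i. h i \<in> left_module_hom EA (obj G i) (obj G (i - 1))"
    and hom: "\<And>i x. x \<in> carrier (obj G i) \<Longrightarrow>
      f i (g i x) = x \<oplus>\<^bsub>obj G i\<^esub> (diff G (i - 1) (h i x) \<oplus>\<^bsub>obj G i\<^esub> h (i + 1) (diff G i x))"
    using homotopyE[OF eqv] by metis
  have g: "g 0 \<in> left_module_hom EA (obj G 0) (obj F 0)" and f: "f 0 \<in> left_module_hom EA (obj F 0) (obj G 0)"
    using fg unfolding chain_map_def by blast+
  have F0: "left_module EA (obj F 0)" using F unfolding is_cochain_def by blast
  interpret F0: left_module EA "obj F 0" by (rule F0)
  have "B (- 1) = {}" using empty_basis[OF eqv F, of "- 1"] res unfolding injective_resolution_def by simp
  then have G1: "carrier (obj G (- 1)) = {\<zero>\<^bsub>obj G (- 1)\<^esub>}" by (rule carrier_of_empty_basis)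
  note eD = left_module_homD[OF e(1)] and gD = left_module_homD[OF g]
  let ?t = "\<lambda>b. top_elem \<odot>\<^bsub>obj G 0\<^esub> b"
  have t: "?t b \<in> cocycles G 0" if "b \<in> B 0" for b
    unfolding cocycles_def using diff_top[OF that] G0.smult_closed[OF top_elem_closed] G0.B_closed that by auto
  have "\<exists>y\<in>carrier M. \<eta> y = g 0 (?t b)" if "b \<in> B 0" for b
    using chain_map_cocycles[OF fg(2) F t[OF that]] unfolding e(2)[symmetric] by (metis imageE)
  then obtain y where y: "\<And>b. b \<in> B 0 \<Longrightarrow> y b \<in> carrier M" "\<And>b. b \<in> B 0 \<Longrightarrow> \<eta> (y b) = g 0 (?t b)" by metis
  show ?thesis
  proof (rule finite_of_no_dependency[OF S(1-3), of "B 0" y])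
    show "y b \<in> lin_comb EA M ` finite_coeffs EA S" if "b \<in> B 0" for b
      using y(1)[OF that] S(4) by simp
    show "\<forall>b\<in>J. c b = 0" if J: "finite J" "J \<subseteq> B 0"
      and 0: "(\<Oplus>\<^bsub>M\<^esub>b\<in>J. scal (c b) \<odot>\<^bsub>M\<^esub> y b) = \<zero>\<^bsub>M\<^esub>" for J c
    proof -
      have yJ: "y b \<in> carrier M" "\<eta> (y b) = g 0 (?t b)" "?t b \<in> carrier (obj G 0)" "diff G 0 (?t b) = \<zero>\<^bsub>obj G (0 + 1)\<^esub>" if "b \<in> J" for b
        using y t that J(2) unfolding cocycles_def by auto
      let ?z = "\<Oplus>\<^bsub>obj G 0\<^esub>b\<in>J. scal (c b) \<odot>\<^bsub>obj G 0\<^esub> ?t b"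
      have cl: "scal (c b) \<odot>\<^bsub>obj G 0\<^esub> ?t b \<in> carrier (obj G 0)" if "b \<in> J" for b
        using G0.smult_closed[OF scal_closed yJ(3)[OF that]] .
      have z: "?z \<in> carrier (obj G 0)" using cl by (auto intro: G0.M.finsum_closed)
      interpret G1: left_module EA "obj G (0 + 1)" by (rule cochain(1))
      have "diff G 0 ?z = (\<Oplus>\<^bsub>obj G (0 + 1)\<^esub>b\<in>J. diff G 0 (scal (c b) \<odot>\<^bsub>obj G 0\<^esub> ?t b))"
        by (rule left_module_hom_finsum[OF cochain(1) cochain(1) cochain(2) J(1) cl])
      also have "\<dots> = (\<Oplus>\<^bsub>obj G (0 + 1)\<^esub>b\<in>J. \<zero>\<^bsub>obj G (0 + 1)\<^esub>)"
        using left_module_homD(3)[OF cochain(2) scal_closed yJ(3)] yJ(4) G1.smult_zero_right[OF scal_closed] G1.M.zero_closed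
        by (intro G1.M.finsum_cong') auto
      also have "\<dots> = \<zero>\<^bsub>obj G (0 + 1)\<^esub>" by (rule G1.M.finsum_zero)
      finally have zco: "?z \<in> cocycles G 0" unfolding cocycles_def using z by blast
      have "g 0 ?z = (\<Oplus>\<^bsub>obj F 0\<^esub>b\<in>J. g 0 (scal (c b) \<odot>\<^bsub>obj G 0\<^esub> ?t b))"
        by (rule left_module_hom_finsum[OF cochain(1) F0 g J(1) cl])
      also have "\<dots> = (\<Oplus>\<^bsub>obj F 0\<^esub>b\<in>J. \<eta> (scal (c b) \<odot>\<^bsub>M\<^esub> y b))"
        using yJ gD(3)[OF scal_closed yJ(3)] eD(3)[OF scal_closed yJ(1)] gD(1)[OF yJ(3)] F0.smult_closed
        by (intro F0.M.finsum_cong') auto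
      also have "\<dots> = \<eta> (\<Oplus>\<^bsub>M\<^esub>b\<in>J. scal (c b) \<odot>\<^bsub>M\<^esub> y b)"
        using M.smult_closed yJ(1) by (intro left_module_hom_finsum[OF S(1) F0 e(1) J(1), symmetric]) auto
      also have "\<dots> = \<zero>\<^bsub>obj F 0\<^esub>" unfolding 0 by (rule left_module_hom_zero[OF S(1) F0 e(1)])
      finally have fgz: "f 0 (g 0 ?z) = \<zero>\<^bsub>obj G 0\<^esub>" using left_module_hom_zero[OF F0 cochain(1) f] by simp
      note k = homotopy_cocycle[where k = "\<lambda>i x. f i (g i x)", OF h hom zco]
      have d: "diff G (- 1) \<in> left_module_hom EA (obj G (- 1)) (obj G 0)" using cochain(2)[of "- 1"] by simp
      have "h 0 ?z = \<zero>\<^bsub>obj G (- 1)\<^esub>" using k(1) G1 by simp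
      then have "?z = \<zero>\<^bsub>obj G 0\<^esub>" using k(2) fgz left_module_hom_zero[OF cochain(1) cochain(1) d] z by simp
      then show ?thesis by (rule coord_top_sum_zero[OF J])
    qed
  qed
qed

text \<open>The module M bounds the rank in degree 0, exactness passes finiteness down one degree at
  a time, and positive degrees vanish.\<close>

lemma free_case:
  assumes M: "fin_gen_module EA M" and eqv: "homotopy_equivalent EA F G" and res: "free_resolution EA M F"
  shows "finite (B i)" "i > 0 \<Longrightarrow> B i = {}" "i < 0 \<Longrightarrow> cocycles G i \<subseteq> coboundaries G i"
proof -
  have F: "is_cochain EA F" using res unfolding free_resolution_def by blast
  show empty: "B i = {}" if "i > 0" for i using empty_basis[OF eqv F, of i] that res unfolding free_resolution_def by blast
  show ex: "cocycles G i \<subseteq> coboundaries G i" if "i < 0" for i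
    using exact_transfer[OF eqv F, of i] that res unfolding free_resolution_def by blast
  have neg: "finite (B (- int k))" for k
  proof (induction k)
    case 0 then show ?case using finite_basis_free[OF M eqv res] by simp
  next
    case (Suc k)
    have "- int (Suc k) + 1 = - int k" by simp
    then show ?case using finite_basis_pred[of "- int (Suc k)"] ex[of "- int (Suc k)"] Suc by simp
  qed
  show "finite (B i)"
    using neg[of "nat (- i)"] empty[of i] by (cases "i > 0") auto
qed

lemma injective_case:
  assumes M: "fin_gen_module EA M" and eqv: "homotopy_equivalent EA F G" and res: "injective_resolution EA M F"
  shows "finite (B i)" "i > 0 \<Longrightarrow> cocycles G i \<subseteq> coboundaries G i"
proof -
  have F: "is_cochain EA F" using res unfolding injective_resolution_def by blast
  have empty: "B i = {}" if "i < 0" for i using empty_basis[OF eqv F, of i] that res unfolding injective_resolution_def by blast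
  show ex: "cocycles G i \<subseteq> coboundaries G i" if "i > 0" for i
    using exact_transfer[OF eqv F, of i] that res unfolding injective_resolution_def by blast
  have pos: "finite (B (int k))" for k
  proof (induction k)
    case 0 then show ?case using finite_basis_injective[OF M eqv res] by simp
  next
    case (Suc k)
    then show ?case using finite_basis_succ[of "int k"] ex[of "int k + 1"] by (simp add: add.commute)
  qed
  show "finite (B i)"
    using pos[of "nat i"] empty[of i] by (cases "i < 0") auto
qed

end

section \<open>The linear part of a minimal complex in coordinates\<close>

context exterior_model
begin

lemma model_mult_add_left: "model_mult (g + g') h = model_mult g h + model_mult g' h"
  by (simp add: model_mult_def fun_eq_iff algebra_simps sum.distrib)

lemma model_mult_scale_left: "model_mult (\<lambda>I. a * g I) h = (\<lambda>I. a * model_mult g h I)"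
  by (simp add: model_mult_def fun_eq_iff sum_distrib_left algebra_simps)

lemma model_mult_zero_left: "model_mult 0 h = 0"
  by (simp add: model_mult_def fun_eq_iff)

lemma model_mult_zero_right: "model_mult g 0 = 0"
  by (simp add: model_mult_def fun_eq_iff act_0)

lemma act_diff: "act w (f - g) = act w f - act w g"
proof -
  have "act w f = act w ((f - g) + g)" by (simp del: plus_fun_apply minus_apply)
  then show ?thesis by (simp only: act_add) simp
qed

lemma model_mult_diff_right: "model_mult g (h - h') = model_mult g h - model_mult g h'"
  by (simp add: model_mult_def act_diff fun_eq_iff algebra_simps sum_subtractf)

text \<open>Associativity of the exterior algebra, transported by \<open>phi\<close>. The left
  factor is first cut off to subsets of \<open>{..<n}\<close>, which changes neither side and makes
  it the image of an algebra element.\<close>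

lemma model_mult_wedge:
  assumes j: "j < n" and h: "deg_in n UNIV h"
  shows "model_mult (wedge j g) h = wedge j (model_mult g h)"
proof -
  define g' where "g' I = (if I \<subseteq> {..<n} then g I else 0)" for I
  have g': "deg_in n UNIV g'" unfolding deg_in_UNIV g'_def by simp
  have "model_mult (wedge j g) h = model_mult (wedge j g') h"
    unfolding model_mult_def by (intro HOL.ext sum.cong) (auto simp: wedge_def g'_def)
  also have "\<dots> = wedge j (model_mult g' h)"
  proof -
    define a b where "a = cls (std g')" and "b = cls (std h)"
    have cl: "a \<in> carrier EA" "b \<in> carrier EA" unfolding a_def b_def by (simp_all add: exterior_class_closed std_closed)
    have ph: "phi a = g'" "phi b = h" unfolding a_def b_def using phi_std g' h by auto
    have "model_mult (wedge j g') h = phi ((gen j \<otimes>\<^bsub>EA\<^esub> a) \<otimes>\<^bsub>EA\<^esub> b)"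
      using phi_mult[of "gen j \<otimes>\<^bsub>EA\<^esub> a" b] cl phi_gen[OF j cl(1)] ph by simp
    also have "\<dots> = phi (gen j \<otimes>\<^bsub>EA\<^esub> (a \<otimes>\<^bsub>EA\<^esub> b))" using cl by (simp add: EA.m_assoc)
    also have "\<dots> = wedge j (model_mult g' h)" by (simp only: phi_gen[OF j EA.m_closed[OF cl]] phi_mult[OF cl] ph)
    finally show ?thesis .
  qed
  also have "model_mult g' h = model_mult g h" unfolding model_mult_def g'_def by (intro HOL.ext sum.cong) auto
  finally show ?thesis .
qed

end

lemma deg_in_contract: "deg_in n S f \<Longrightarrow> deg_in n {s. Suc s \<in> S} (contract j f)"
proof -
  assume f: "deg_in n S f"
  have "I \<subseteq> {..<n} \<and> Suc (card I) \<in> S" if I: "contract j f I \<noteq> 0" for I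
  proof -
    have *: "j \<notin> I" "f (insert j I) \<noteq> 0" using I by (auto simp: contract_def split: if_splits)
    then have ins: "insert j I \<subseteq> {..<n}" "card (insert j I) \<in> S" using f unfolding deg_in_def by auto
    then have "finite I" using finite_subset by auto
    then show ?thesis using ins * by simp
  qed
  then show ?thesis unfolding deg_in_def by blast
qed

text \<open>All terms of a complex are placed into one vector space: the value at \<open>(i, b)\<close> and \<open>J\<close> is the
  coefficient of \<open>e\<^sub>J b\<close> for a basis element \<open>b\<close> of the \<open>i\<close>-th term.\<close>

type_synonym ('c, 'k) model = "int \<times> 'c \<Rightarrow> nat set \<Rightarrow> 'k"

definition scaleW :: "'k::field \<Rightarrow> ('c, 'k) model \<Rightarrow> ('c, 'k) model" where
  "scaleW a F = (\<lambda>x I. a * F x I)"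

definition eW :: "nat \<Rightarrow> ('c, 'k::field) model \<Rightarrow> ('c, 'k) model" where
  "eW j F = (\<lambda>x. wedge j (F x))"

definition cW :: "nat \<Rightarrow> ('c, 'k::field) model \<Rightarrow> ('c, 'k) model" where
  "cW j F = (\<lambda>x. contract j (F x))"

lemma vector_space_scaleW: "vector_space scaleW"
  by unfold_locales (simp_all add: scaleW_def fun_eq_iff algebra_simps)

lemma scaleW_homI:
  assumes "\<And>F G. f (F + G) = f F + f G" "\<And>a F. f (scaleW a F) = scaleW a (f F)"
  shows "module_hom scaleW scaleW f"
proof -
  interpret vector_space scaleW by (rule vector_space_scaleW)
  show ?thesis by unfold_locales (simp_all only: assms)
qed

locale finite_minimal_complex = minimal_complex scale Basis n bas G B
  for scale :: "'k::field \<Rightarrow> 'v::ab_group_add \<Rightarrow> 'v" and Basis n bas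
    and G :: "(('v list \<Rightarrow> 'k) set, 'c) cochain" and B +
  assumes finite_basis: "finite (B i)"
begin

section \<open>Matrices acting on the common vector space\<close>

definition grW :: "int \<Rightarrow> ('c, 'k) model set" where
  "grW i = {F. \<forall>k b. (F (k, b) \<noteq> 0 \<longrightarrow> k = i \<and> b \<in> B i) \<and> deg_in n UNIV (F (k, b))}"

definition degW :: "nat set \<Rightarrow> ('c, 'k) model \<Rightarrow> bool" where
  "degW S F \<longleftrightarrow> (\<forall>x. deg_in n S (F x))"

lemma degW_zero: "degW S F \<Longrightarrow> card I \<notin> S \<Longrightarrow> F x I = 0"
  unfolding degW_def deg_in_def by blast

text \<open>\<open>A k\<close> is the matrix out of degree k, so values in degree k use index k - 1.
  Coordinates stand to the left of the entries, following the row convention for left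
  modules.\<close>

definition matrix_op :: "(int \<Rightarrow> 'c \<Rightarrow> 'c \<Rightarrow> nat set \<Rightarrow> 'k) \<Rightarrow> ('c, 'k) model \<Rightarrow> ('c, 'k) model" where
  "matrix_op A F = (\<lambda>(k, b') I. \<Sum>b\<in>B (k - 1). model_mult (F (k - 1, b)) (A (k - 1) b b') I)"

text \<open>T bounds the exterior degrees of the entries: \<open>{1..}\<close> for the differential,
  \<open>{1}\<close> for its linear part and \<open>{2..}\<close> for the difference of the
  two.\<close>

definition admissible :: "nat set \<Rightarrow> (int \<Rightarrow> 'c \<Rightarrow> 'c \<Rightarrow> nat set \<Rightarrow> 'k) \<Rightarrow> bool" where
  "admissible T A \<longleftrightarrow> (\<forall>k. \<forall>b\<in>B k. \<forall>b'. deg_in n T (A k b b') \<and> (b' \<notin> B (k + 1) \<longrightarrow> A k b b' = 0))"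

lemma matrix_op_add: "matrix_op A (F + F') = matrix_op A F + matrix_op A F'"
  by (simp add: matrix_op_def fun_eq_iff model_mult_add_left sum.distrib split: prod.split)

lemma matrix_op_scale: "matrix_op A (scaleW a F) = scaleW a (matrix_op A F)"
  by (simp add: matrix_op_def scaleW_def fun_eq_iff model_mult_scale_left sum_distrib_left)

lemma matrix_op_hom: "module_hom scaleW scaleW (matrix_op A)"
  by (rule scaleW_homI[OF matrix_op_add matrix_op_scale])

lemma matrix_op_diff: "matrix_op (\<lambda>k b b'. A k b b' - A' k b b') F = matrix_op A F - matrix_op A' F"
  by (simp add: matrix_op_def fun_eq_iff model_mult_diff_right sum_subtractf)

lemma degW_matrix_op:
  assumes "degW S F" "admissible T A" "\<And>s t. s \<in> S \<Longrightarrow> t \<in> T \<Longrightarrow> s + t \<in> U"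
  shows "degW U (matrix_op A F)"
  unfolding degW_def
proof
  fix x :: "int \<times> 'c"
  obtain k b' where x: "x = (k, b')" by (cases x)
  have "deg_in n U (\<lambda>I. \<Sum>b\<in>B (k - 1). model_mult (F (k - 1, b)) (A (k - 1) b b') I)"
  proof (rule deg_in_sum)
    fix b assume "b \<in> B (k - 1)"
    then have "deg_in n T (A (k - 1) b b')" using assms(2) unfolding admissible_def by blast
    then show "deg_in n U (model_mult (F (k - 1, b)) (A (k - 1) b b'))"
      using deg_in_model_mult assms(1,3) unfolding degW_def by blast
  qed
  then show "deg_in n U (matrix_op A F x)" unfolding x matrix_op_def by simp
qed

lemma grW_degW: "F \<in> grW i \<Longrightarrow> degW UNIV F"
  unfolding grW_def degW_def by auto

lemma matrix_op_grW:
  assumes "F \<in> grW i" "admissible T A" shows "matrix_op A F \<in> grW (i + 1)"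
proof -
  have deg: "degW UNIV (matrix_op A F)" by (rule degW_matrix_op[OF grW_degW[OF assms(1)] assms(2)]) simp
  have "k = i + 1 \<and> b' \<in> B (i + 1)" if nz: "matrix_op A F (k, b') \<noteq> 0" for k b'
  proof (rule ccontr)
    assume neg: "\<not> (k = i + 1 \<and> b' \<in> B (i + 1))"
    have "model_mult (F (k - 1, b)) (A (k - 1) b b') = 0" if b: "b \<in> B (k - 1)" for b
    proof (cases "k - 1 = i")
      case True
      then have k: "k = i + 1" by simp
      then have "b' \<notin> B (k - 1 + 1)" using neg by simp
      then have "A (k - 1) b b' = 0" using assms(2) b unfolding admissible_def by blast
      then show ?thesis by (simp add: model_mult_zero_right)
    next
      case False
      then have "F (k - 1, b) = 0" using assms(1) unfolding grW_def by blast
      then show ?thesis by (simp add: model_mult_zero_left)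
    qed
    then have "matrix_op A F (k, b') = 0" unfolding matrix_op_def by (simp add: fun_eq_iff)
    then show False using nz by simp
  qed
  then show ?thesis unfolding grW_def using deg unfolding degW_def by blast
qed

text \<open>Entries multiply from the right and \<open>eW j\<close> from the left, so the two
  operations commute without a sign.\<close>

lemma matrix_op_eW:
  assumes "admissible T A" "j < n" shows "matrix_op A (eW j F) = eW j (matrix_op A F)"
proof
  fix x :: "int \<times> 'c"
  obtain k b' where x: "x = (k, b')" by (cases x)
  have "matrix_op A (eW j F) (k, b') = (\<lambda>I. \<Sum>b\<in>B (k - 1). wedge j (model_mult (F (k - 1, b)) (A (k - 1) b b')) I)"
    unfolding matrix_op_def eW_def prod.case
  proof (intro HOL.ext sum.cong refl)
    fix I b assume "b \<in> B (k - 1)"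
    then have "deg_in n UNIV (A (k - 1) b b')" using assms(1) deg_in_mono unfolding admissible_def by blast
    then show "model_mult (wedge j (F (k - 1, b))) (A (k - 1) b b') I = wedge j (model_mult (F (k - 1, b)) (A (k - 1) b b')) I"
      using model_mult_wedge[OF assms(2)] by simp
  qed
  also have "\<dots> = eW j (matrix_op A F) (k, b')" unfolding matrix_op_def eW_def by (simp add: wedge_sum)
  finally show "matrix_op A (eW j F) x = eW j (matrix_op A F) x" unfolding x .
qed

sublocale W: vector_space scaleW by (rule vector_space_scaleW)

lemma eW_hom: "module_hom scaleW scaleW (eW j)"
  by (rule scaleW_homI) (simp_all add: eW_def scaleW_def fun_eq_iff wedge_def algebra_simps)

lemma cW_hom: "module_hom scaleW scaleW (cW j)"
  by (rule scaleW_homI) (simp_all add: cW_def scaleW_def fun_eq_iff contract_def algebra_simps)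

lemma subspace_grW: "W.subspace (grW i)"
proof (rule W.subspaceI)
  show "0 \<in> grW i" unfolding grW_def by (simp add: deg_in_0)
next
  fix F F' :: "('c, 'k) model" assume F: "F \<in> grW i" and F': "F' \<in> grW i"
  have "F (k, b) \<noteq> 0 \<or> F' (k, b) \<noteq> 0" if "(F + F') (k, b) \<noteq> 0" for k b using that by auto
  moreover have "deg_in n UNIV ((F + F') (k, b))" for k b
    using F F' deg_in_add[of n UNIV "F (k, b)" "F' (k, b)"] unfolding grW_def by (simp add: plus_fun_def)
  ultimately show "F + F' \<in> grW i" using F F' unfolding grW_def by blast
next
  fix a and F :: "('c, 'k) model" assume F: "F \<in> grW i"
  have "scaleW a F (k, b) = 0" if "F (k, b) = 0" for k b using that by (simp add: scaleW_def fun_eq_iff)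
  moreover have "deg_in n UNIV (scaleW a F (k, b))" for k b
    using F deg_in_scale[of n UNIV "F (k, b)" a] unfolding grW_def scaleW_def by simp
  ultimately show "scaleW a F \<in> grW i" using F unfolding grW_def by blast
qed

lemma eW_grW: "j < n \<Longrightarrow> F \<in> grW i \<Longrightarrow> eW j F \<in> grW i"
proof -
  assume j: "j < n" and F: "F \<in> grW i"
  have "eW j F (k, b) = 0" if "F (k, b) = 0" for k b using that by (simp add: eW_def wedge_def fun_eq_iff)
  moreover have "deg_in n UNIV (eW j F (k, b))" for k b
    using F deg_in_mono[OF deg_in_wedge[OF _ j], of UNIV "F (k, b)" UNIV] unfolding grW_def eW_def by simp
  ultimately show ?thesis using F unfolding grW_def by blast
qed

lemma cW_grW: "F \<in> grW i \<Longrightarrow> cW j F \<in> grW i"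
proof -
  assume F: "F \<in> grW i"
  have "cW j F (k, b) = 0" if "F (k, b) = 0" for k b using that by (simp add: cW_def contract_def fun_eq_iff)
  moreover have "deg_in n UNIV (cW j F (k, b))" for k b
    using F deg_in_mono[OF deg_in_contract, of n UNIV "F (k, b)" UNIV j] unfolding grW_def cW_def by simp
  ultimately show ?thesis using F unfolding grW_def by blast
qed

sublocale CM: clifford_module scaleW n eW cW grW
proof (intro clifford_module.intro clifford_module_axioms.intro vector_space_scaleW)
  show "module_hom scaleW scaleW (eW j)" "module_hom scaleW scaleW (cW j)" for j by (rule eW_hom cW_hom)+
  show "W.subspace (grW i)" for i by (rule subspace_grW)
  show "j < n \<Longrightarrow> x \<in> grW i \<Longrightarrow> eW j x \<in> grW i" "j < n \<Longrightarrow> x \<in> grW i \<Longrightarrow> cW j x \<in> grW i" for j x i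
    by (rule eW_grW cW_grW; assumption)+
  show "eW j (eW k x) = - eW k (eW j x)" for j k and x :: "('c, 'k) model"
  proof
    fix y show "eW j (eW k x) y = (- eW k (eW j x)) y" unfolding eW_def using wedge_wedge[of j k "x y"] by simp
  qed
  show "eW j (eW j x) = 0" for j and x :: "('c, 'k) model"
    unfolding eW_def by (simp add: wedge_square fun_eq_iff)
  show "cW j (eW k x) = (if j = k then x else 0) - eW k (cW j x)" for j k and x :: "('c, 'k) model"
  proof
    fix y show "cW j (eW k x) y = ((if j = k then x else 0) - eW k (cW j x)) y"
      unfolding eW_def cW_def using contract_wedge[of j k "x y"] by simp
  qed
qed

text \<open>Split F into the monomials containing m, which are \<open>eW m (cW m F)\<close>, and the
  others, which are \<open>cW m (eW m F)\<close>. The second part still has no coefficients at sets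
  disjoint from \<open>{..<m}\<close>, so the induction hypothesis applies to it.\<close>

lemma ideal_part_vanishing:
  assumes "m \<le> n" "F \<in> grW i" "\<And>x I. I \<inter> {..<m} = {} \<Longrightarrow> F x I = 0"
  shows "F \<in> CM.ideal_part m i"
  using assms
proof (induction m arbitrary: F)
  case 0
  then have "F = 0" by (simp add: fun_eq_iff)
  then show ?case by (simp only: CM.ideal_part.simps singleton_iff)
next
  case (Suc m)
  have m: "m < n" using Suc.prems(1) by simp
  let ?H = "cW m (eW m F)"
  have "?H x I = 0" if I: "I \<inter> {..<m} = {}" for x I
  proof (cases "m \<in> I")
    case False
    then have "I \<inter> {..<Suc m} = {}" using I by (auto simp: less_Suc_eq)
    then show ?thesis using Suc.prems(3)[of I x] False
      by (simp add: cW_def eW_def contract_def wedge_def)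
  qed (simp add: cW_def contract_def)
  moreover have "?H \<in> grW i" using eW_grW[OF m] cW_grW Suc.prems(2) by blast
  ultimately have "?H \<in> CM.ideal_part m i" using Suc.IH[of ?H] m by simp
  moreover have "F = eW m (cW m F) + ?H" using CM.c_e[OF m m, of F] by simp
  moreover have "cW m F \<in> grW i" using cW_grW Suc.prems(2) by blast
  ultimately show ?case by auto
qed

lemma ideal_part_full:
  assumes "F \<in> grW i" "degW {1..} F" shows "F \<in> CM.ideal_part n i"
proof (rule ideal_part_vanishing[OF order_refl assms(1)])
  fix x and I :: "nat set" assume I: "I \<inter> {..<n} = {}"
  have "deg_in n {1..} (F x)" using assms(2) unfolding degW_def by blast
  then have "F x I \<noteq> 0 \<longrightarrow> I \<subseteq> {..<n} \<and> card I \<ge> 1" unfolding deg_in_def by simp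
  moreover have "I \<subseteq> {..<n} \<Longrightarrow> I = {}" using I by blast
  ultimately show "F x I = 0" by auto
qed

lemma finite_dim_grW: "W.finite_dim (grW i)"
proof -
  define u where "u b J = (\<lambda>x I. if x = (i, b) \<and> I = J then 1 else 0 :: 'k)" for b :: 'c and J :: "nat set"
  define S where "S = (\<lambda>(b, J). u b J) ` (B i \<times> Pow {..<n})"
  have fin: "finite S" unfolding S_def using finite_basis by simp
  have "F \<in> W.span S" if F: "F \<in> grW i" for F
  proof -
    have "F = (\<Sum>p\<in>B i \<times> Pow {..<n}. scaleW (F (i, fst p) (snd p)) (u (fst p) (snd p)))"
    proof (intro HOL.ext)
      fix x I
      have 1: "(\<Sum>p\<in>B i \<times> Pow {..<n}. scaleW (F (i, fst p) (snd p)) (u (fst p) (snd p))) x I =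
        (\<Sum>p\<in>B i \<times> Pow {..<n}. if p = (snd x, I) then (if fst x = i then F x I else 0) else 0)"
        unfolding sum_fun_apply by (intro sum.cong) (auto simp: scaleW_def u_def)
      have 2: "\<dots> = (if (snd x, I) \<in> B i \<times> Pow {..<n} then (if fst x = i then F x I else 0) else 0)"
        using finite_basis by simp
      have 3: "F x I = 0" if "\<not> (fst x = i \<and> snd x \<in> B i \<and> I \<subseteq> {..<n})"
      proof -
        have "F (fst x, snd x) = 0 \<or> deg_in n UNIV (F (fst x, snd x)) \<and> \<not> I \<subseteq> {..<n}"
          using F that unfolding grW_def by blast
        then show ?thesis by (auto simp: deg_in_UNIV)
      qed
      show "F x I = (\<Sum>p\<in>B i \<times> Pow {..<n}. scaleW (F (i, fst p) (snd p)) (u (fst p) (snd p))) x I"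
        unfolding 1 2 using 3 by auto
    qed
    also have "\<dots> \<in> W.span S"
      by (intro W.span_sum W.span_scale W.span_base) (auto simp: S_def)
    finally show ?thesis .
  qed
  then show ?thesis unfolding W.finite_dim_def using fin by blast
qed

section \<open>The differential and its linear part as operators\<close>

definition dA :: "int \<Rightarrow> 'c \<Rightarrow> 'c \<Rightarrow> nat set \<Rightarrow> 'k" where
  "dA k b b' = phi (gcoord (k + 1) (diff G k b) b')"

definition lA :: "int \<Rightarrow> 'c \<Rightarrow> 'c \<Rightarrow> nat set \<Rightarrow> 'k" where
  "lA k b b' = (\<lambda>I. if card I = 1 then dA k b b' I else 0)"

lemma admissible_dA: "admissible {1..} dA"
proof -
  have "deg_in n {1..} (dA k b b') \<and> (b' \<notin> B (k + 1) \<longrightarrow> dA k b b' = 0)" if b: "b \<in> B k" for k b b'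
  proof -
    interpret M: based_module EA "obj G k" "B k" by (rule based)
    interpret N: based_module EA "obj G (k + 1)" "B (k + 1)" by (rule based)
    have "diff G k b \<in> carrier (obj G (k + 1))" using diff_closed M.B_closed b by blast
    then show ?thesis unfolding dA_def
      using deg_in_of_phi_empty[OF diff_entry[OF b]] N.coord_outside phi_zero by simp
  qed
  then show ?thesis unfolding admissible_def by blast
qed

lemma admissible_lA: "admissible {1} lA"
  using admissible_dA unfolding admissible_def lA_def deg_in_def by (auto simp: fun_eq_iff)

lemma admissible_rest: "admissible {2..} (\<lambda>k b b'. dA k b b' - lA k b b')"
proof -
  have "deg_in n {2..} (dA k b b' - lA k b b') \<and> (b' \<notin> B (k + 1) \<longrightarrow> dA k b b' - lA k b b' = 0)" if "b \<in> B k" for k b b'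
  proof -
    have *: "deg_in n {1..} (dA k b b')" "b' \<notin> B (k + 1) \<longrightarrow> dA k b b' = 0" using admissible_dA that unfolding admissible_def by auto
    have "I \<subseteq> {..<n} \<and> card I \<ge> 2" if nz: "(dA k b b' - lA k b b') I \<noteq> 0" for I
    proof -
      have "dA k b b' I \<noteq> 0" "card I \<noteq> 1" using nz by (auto simp: lA_def split: if_splits)
      then show ?thesis using *(1) unfolding deg_in_def by fastforce
    qed
    then show ?thesis using *(2) unfolding deg_in_def by (auto simp: lA_def fun_eq_iff)
  qed
  then show ?thesis unfolding admissible_def by blast
qed

abbreviation "dW \<equiv> matrix_op dA"
abbreviation "lW \<equiv> matrix_op lA"
abbreviation "rW \<equiv> matrix_op (\<lambda>k b b'. dA k b b' - lA k b b')"

lemma rW: "rW F = dW F - lW F" by (rule matrix_op_diff)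

definition embed :: "int \<Rightarrow> 'c \<Rightarrow> ('c, 'k) model" where
  "embed i x = (\<lambda>(k, b). if k = i then phi (gcoord i x b) else 0)"

lemma embed_grW: assumes "x \<in> carrier (obj G i)" shows "embed i x \<in> grW i"
proof -
  interpret M: based_module EA "obj G i" "B i" by (rule based)
  show ?thesis unfolding grW_def embed_def
    using M.coord_outside[OF assms] deg_in_phi[OF M.coord_closed[OF assms]] phi_zero by (auto simp: deg_in_0)
qed

lemma embed_inj:
  assumes "x \<in> carrier (obj G i)" "y \<in> carrier (obj G i)" "embed i x = embed i y" shows "x = y"
proof -
  interpret M: based_module EA "obj G i" "B i" by (rule based)
  have "phi (gcoord i x b) = phi (gcoord i y b)" for b
    using fun_cong[OF assms(3), of "(i, b)"] unfolding embed_def by simp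
  then have "gcoord i x = gcoord i y" using phi_inj M.coord_closed assms(1,2) by blast
  then show ?thesis using M.coord_inj assms(1,2) by blast
qed

lemma embed_surj:
  assumes F: "F \<in> grW i" shows "\<exists>x\<in>carrier (obj G i). F = embed i x"
proof -
  interpret M: based_module EA "obj G i" "B i" by (rule based)
  define u where "u b = cls (std (F (i, b)))" for b
  have out: "u b = \<zero>\<^bsub>EA\<^esub>" if "b \<notin> B i" for b
  proof -
    have "F (i, b) = 0" using F that unfolding grW_def by blast
    then have "std (F (i, b)) = 0" by (simp add: std_def fun_eq_iff sum_fun_apply)
    then show ?thesis unfolding u_def by (simp add: exterior_class_zero)
  qed
  then have sub: "{b. u b \<noteq> \<zero>\<^bsub>EA\<^esub>} \<subseteq> B i" by auto
  have fin: "finite {b. u b \<noteq> \<zero>\<^bsub>EA\<^esub>}" by (rule finite_subset[OF sub finite_basis])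
  have u: "u \<in> finite_coeffs EA (B i)"
    unfolding finite_coeffs_def using out fin by (simp add: u_def exterior_class_closed std_closed)
  define x where "x = lin_comb EA (obj G i) u"
  have x: "x \<in> carrier (obj G i)" "gcoord i x = u"
    unfolding x_def using M.lin_comb_closed[OF u M.B_closed] M.coord_unique[OF u refl] by auto
  have "F = embed i x"
  proof
    fix p :: "int \<times> 'c"
    obtain k b where p: "p = (k, b)" by (cases p)
    show "F p = embed i x p"
    proof (cases "k = i")
      case True
      have "deg_in n UNIV (F (i, b))" using F unfolding grW_def by blast
      then show ?thesis using True x(2) phi_std unfolding p embed_def u_def by simp
    next
      case False
      then show ?thesis using F unfolding p embed_def grW_def by auto
    qed
  qed
  then show ?thesis using x(1) by blast
qed

text \<open>Covers the differential and its linear part alike: \<open>phi\<close> turns the product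
  of a coordinate with an entry into \<open>model_mult\<close>, and finite bases allow summation
  over all of \<open>B i\<close>.\<close>

lemma embed_matrix_op:
  assumes x: "x \<in> carrier (obj G i)"
    and A: "\<And>b b'. b \<in> B i \<Longrightarrow> a b b' \<in> carrier EA" "\<And>b b'. b \<in> B i \<Longrightarrow> phi (a b b') = A i b b'"
    and y: "\<And>b'. gcoord (i + 1) y b' = (\<Oplus>\<^bsub>EA\<^esub>b\<in>B i. gcoord i x b \<otimes>\<^bsub>EA\<^esub> a b b')"
  shows "matrix_op A (embed i x) = embed (i + 1) y"
proof
  interpret M: based_module EA "obj G i" "B i" by (rule based)
  fix p :: "int \<times> 'c"
  obtain k b' where p: "p = (k, b')" by (cases p)
  show "matrix_op A (embed i x) p = embed (i + 1) y p"
  proof (cases "k = i + 1")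
    case True
    have "phi (gcoord (i + 1) y b') = (\<lambda>I. \<Sum>b\<in>B i. phi (gcoord i x b \<otimes>\<^bsub>EA\<^esub> a b b') I)"
      unfolding y using A(1) M.coord_closed[OF x] by (intro phi_finsum finite_basis) auto
    also have "\<dots> = (\<lambda>I. \<Sum>b\<in>B i. model_mult (phi (gcoord i x b)) (A i b b') I)"
      using A phi_mult[OF M.coord_closed[OF x]] by (intro HOL.ext sum.cong) auto
    finally show ?thesis unfolding p True matrix_op_def embed_def by simp
  next
    case False
    then have "k - 1 \<noteq> i" by simp
    then show ?thesis unfolding p matrix_op_def embed_def using False by (simp add: model_mult_zero_left fun_eq_iff)
  qed
qed

lemma embed_diff: assumes "x \<in> carrier (obj G i)" shows "dW (embed i x) = embed (i + 1) (diff G i x)"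
proof (rule embed_matrix_op[OF assms])
  interpret M: based_module EA "obj G i" "B i" by (rule based)
  note c = M.finite_coeffsD[OF M.coord_props(1)[OF assms]]
  show "gcoord (i + 1) (diff G i b) b' \<in> carrier EA" if "b \<in> B i" for b b' using diff_entry(1)[OF that] .
  show "phi (gcoord (i + 1) (diff G i b) b') = dA i b b'" for b b' unfolding dA_def ..
  show "gcoord (i + 1) (diff G i x) b' = (\<Oplus>\<^bsub>EA\<^esub>b\<in>B i. gcoord i x b \<otimes>\<^bsub>EA\<^esub> gcoord (i + 1) (diff G i b) b')" for b'
    by (rule coord_hom[OF based based cochain(2) finite_basis order_refl c(2) assms])
qed

lemma
  assumes x: "x \<in> carrier (obj G i)"
  shows lin_diff_closed: "diff (lin_wrt scale B G) i x \<in> carrier (obj G (i + 1))"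
    and embed_lin_diff: "lW (embed i x) = embed (i + 1) (diff (lin_wrt scale B G) i x)"
proof -
  interpret M: based_module EA "obj G i" "B i" by (rule based)
  interpret N: based_module EA "obj G (i + 1)" "B (i + 1)" by (rule based)
  define a where "a b b' = exterior_component scale 1 (gcoord (i + 1) (diff G i b) b')" for b b'
  have diff: "diff (lin_wrt scale B G) i x = map_of_matrix EA (obj G i) (B i) (obj G (i + 1)) a x"
    unfolding lin_wrt_def a_def[abs_def] matrix_of_def by simp
  have a: "a b b' \<in> carrier EA" "phi (a b b') = lA i b b'" if "b \<in> B i" for b b'
    unfolding a_def lA_def dA_def using component_closed[OF diff_entry(1)[OF that]] by auto
  have coeffs: "a b \<in> finite_coeffs EA (B (i + 1))" if b: "b \<in> B i" for b
  proof -
    have out: "a b b' = \<zero>\<^bsub>EA\<^esub>" if "b' \<notin> B (i + 1)" for b'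
    proof (rule phi_inj[OF a(1)[OF b] EA.zero_closed])
      show "phi (a b b') = phi \<zero>\<^bsub>EA\<^esub>"
        using a(2)[OF b] admissible_lA b that phi_zero unfolding admissible_def by simp
    qed
    then have sub: "{b'. a b b' \<noteq> \<zero>\<^bsub>EA\<^esub>} \<subseteq> B (i + 1)" by auto
    have "finite {b'. a b b' \<noteq> \<zero>\<^bsub>EA\<^esub>}" by (rule finite_subset[OF sub finite_basis])
    then show ?thesis unfolding finite_coeffs_def using out a(1)[OF b] by simp
  qed
  note m = coord_map_of_matrix[where A = a, OF based based coeffs finite_basis x]
  show "diff (lin_wrt scale B G) i x \<in> carrier (obj G (i + 1))" unfolding diff using m(1) by blast
  show "lW (embed i x) = embed (i + 1) (diff (lin_wrt scale B G) i x)"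
    unfolding diff by (rule embed_matrix_op[where a = a and A = lA, OF x a m(2)])
qed

lemma embed_zero: "embed i \<zero>\<^bsub>obj G i\<^esub> = 0"
proof -
  interpret M: based_module EA "obj G i" "B i" by (rule based)
  show ?thesis unfolding embed_def using M.coord_zero phi_zero by (auto simp: fun_eq_iff)
qed

lemma dW_dW: assumes "F \<in> grW i" shows "dW (dW F) = 0"
proof -
  obtain x where x: "x \<in> carrier (obj G i)" "F = embed i x" using embed_surj[OF assms] by blast
  have "dW (dW F) = embed (i + 1 + 1) (diff G (i + 1) (diff G i x))"
    using embed_diff[OF x(1)] embed_diff[OF diff_closed[OF x(1)]] x(2) by simp
  then show ?thesis using cochain(3)[OF x(1)] embed_zero[of "i + 2"] by (simp add: add.assoc)
qed

text \<open>Comparison of the components of degree \<open>m + 2\<close> of \<open>dW (dW F) = 0\<close> for \<open>F\<close> homogeneous of degree \<open>m\<close>.\<close>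

lemma lW_lW: assumes F: "F \<in> grW i" shows "lW (lW F) = 0"
proof (intro HOL.ext)
  interpret d: module_hom scaleW scaleW dW by (rule matrix_op_hom)
  interpret l: module_hom scaleW scaleW lW by (rule matrix_op_hom)
  fix x I
  have ll: "degW {s + 2 |s. s \<in> S} (lW (lW F))" if "degW S F" for S and F :: "('c, 'k) model"
  proof -
    have "degW {s + 1 |s. s \<in> S} (lW F)" by (rule degW_matrix_op[OF that admissible_lA]) auto
    then show ?thesis by (rule degW_matrix_op[OF _ admissible_lA]) auto
  qed
  show "lW (lW F) x I = 0 x I"
  proof (rule ccontr)
    assume "\<not> lW (lW F) x I = 0 x I"
    then have nz: "lW (lW F) x I \<noteq> 0" by simp
    then have "card I \<in> {s + 2 |s. s \<in> UNIV}" using ll[OF grW_degW[OF F]] unfolding degW_def deg_in_def by blast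
    then obtain m where m: "card I = m + 2" by blast
    \<comment> \<open>Since l raises the degree by exactly 1, only the degree-m component of F can
      contribute to degree m + 2.\<close>
    define F1 where "F1 = (\<lambda>y J. if card J = m then F y J else 0)"
    have F1: "F1 \<in> grW i" "degW {m} F1" "degW (- {m}) (F - F1)"
      using F unfolding grW_def degW_def F1_def deg_in_def by (auto simp: fun_eq_iff)
    have "m + 2 \<notin> {s + 2 |s. s \<in> - {m}}" by auto
    then have "lW (lW (F - F1)) x I = 0" by (intro degW_zero[OF ll[OF F1(3)]]) (simp add: m)
    moreover have "lW (lW (F - F1)) = lW (lW F) - lW (lW F1)" by (simp only: l.diff)
    ultimately have "lW (lW F) x I = lW (lW F1) x I" by simp
    \<comment> \<open>With d = l + r one has l l = d d - (l r + r d). The first term is zero and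
      both products with r start in degree m + 3, so neither is seen at I.\<close>
    moreover have "lW (lW F1) = dW (dW F1) - (lW (rW F1) + rW (dW F1))"
    proof -
      have "a = b - ((c - a) + (b - c))" for a b c :: "('c, 'k) model" by simp
      then show ?thesis by (simp only: rW l.diff)
    qed
    moreover have "degW {m + 3..} (lW (rW F1))"
    proof -
      have "degW {m + 2..} (rW F1)" by (rule degW_matrix_op[OF F1(2) admissible_rest]) auto
      then show ?thesis by (rule degW_matrix_op[OF _ admissible_lA]) auto
    qed
    then have "lW (rW F1) x I = 0" by (rule degW_zero) (simp add: m)
    moreover have "degW {m + 3..} (rW (dW F1))"
    proof -
      have "degW {m + 1..} (dW F1)" by (rule degW_matrix_op[OF F1(2) admissible_dA]) auto
      then show ?thesis by (rule degW_matrix_op[OF _ admissible_rest]) auto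
    qed
    then have "rW (dW F1) x I = 0" by (rule degW_zero) (simp add: m)
    ultimately have "lW (lW F) x I = 0" using dW_dW[OF F1(1)] by simp
    then show False using nz by simp
  qed
qed

lemma degW_above: "degW {m..} F \<Longrightarrow> n < m \<Longrightarrow> F = 0"
proof
  fix x assume "degW {m..} F" "n < m"
  then have "F x = 0" unfolding degW_def using deg_in_above_eq_0[of m "F x"] by blast
  then show "F x = 0 x" by simp
qed

text \<open>If j were missing from I, the coefficient of F at I would reappear up to sign in
  \<open>eW j F\<close> at \<open>insert j I\<close>.\<close>

lemma socle_degW: assumes F: "F \<in> grW i" and e: "\<forall>j<n. eW j F = 0" shows "degW {n} F"
  unfolding degW_def deg_in_def
proof (intro allI impI)
  fix x I assume nz: "F x I \<noteq> 0"
  have "deg_in n UNIV (F x)" using grW_degW[OF F] unfolding degW_def by blast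
  then have I: "I \<subseteq> {..<n}" using nz unfolding deg_in_UNIV by blast
  have "j \<in> I" if j: "j < n" for j
  proof (rule ccontr)
    assume "j \<notin> I"
    then have "eW j F x (insert j I) = sign_below j (insert j I) * F x I" by (simp add: eW_def wedge_def)
    then have "sign_below j (insert j I) * F x I = 0" using e j by simp
    then show False using nz by (simp add: sign_below_def)
  qed
  then have "I = {..<n}" using I by auto
  then show "I \<subseteq> {..<n} \<and> card I \<in> {n}" by simp
qed

sublocale CC: clifford_complex scaleW n eW cW grW dW lW
proof (intro clifford_complex.intro clifford_complex_axioms.intro CM.clifford_module_axioms)
  show "W.finite_dim (grW i)" for i by (rule finite_dim_grW)
  show "module_hom scaleW scaleW dW" "module_hom scaleW scaleW lW" by (rule matrix_op_hom)+
  show "dW F \<in> grW (i + 1)" "lW F \<in> grW (i + 1)" if "F \<in> grW i" for F i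
    using matrix_op_grW[OF that] admissible_dA admissible_lA by blast+
  show "dW (eW j F) = eW j (dW F)" "lW (eW j F) = eW j (lW F)" if "j < n" for j F
    using matrix_op_eW that admissible_dA admissible_lA by blast+
  show "dW (dW F) = 0" "lW (lW F) = 0" if "F \<in> grW i" for F i using dW_dW lW_lW that by blast+
  \<comment> \<open>A socle element has degree n and is killed by anything that raises the degree.
    Its contractions have degree n - 1, which d - l, raising the degree by at least 2, kills as
    well.\<close>
  show "dW F = 0 \<and> lW F = 0 \<and> (\<forall>j<n. dW (cW j F) = lW (cW j F))"
    if F: "F \<in> grW i" and e: "\<forall>j<n. eW j F = 0" for F i
  proof (intro conjI allI impI)
    note s = socle_degW[OF F e]
    show "dW F = 0" by (rule degW_above[of "n + 1"], rule degW_matrix_op[OF s admissible_dA]) auto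
    show "lW F = 0" by (rule degW_above[of "n + 1"], rule degW_matrix_op[OF s admissible_lA]) auto
    fix j assume "j < n"
    have "degW {s. Suc s \<in> {n}} (cW j F)" using s deg_in_contract unfolding degW_def cW_def by blast
    then have "rW (cW j F) = 0" by (intro degW_above[of "n + 1"] degW_matrix_op[OF _ admissible_rest]) auto
    then show "dW (cW j F) = lW (cW j F)" unfolding rW by simp
  qed
  show "dW F \<in> CM.ideal_part n (i + 1) \<and> lW F \<in> CM.ideal_part n (i + 1) \<and>
      (\<forall>j<n. cW j (dW F - lW F) \<in> CM.ideal_part n (i + 1))" if F: "F \<in> grW i" for F i
  proof (intro conjI allI impI)
    have dg: "dW F \<in> grW (i + 1)" "lW F \<in> grW (i + 1)" "rW F \<in> grW (i + 1)"
      using matrix_op_grW[OF F] admissible_dA admissible_lA admissible_rest by blast+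
    note u = grW_degW[OF F]
    show "dW F \<in> CM.ideal_part n (i + 1)" by (rule ideal_part_full[OF dg(1)], rule degW_matrix_op[OF u admissible_dA]) auto
    show "lW F \<in> CM.ideal_part n (i + 1)" by (rule ideal_part_full[OF dg(2)], rule degW_matrix_op[OF u admissible_lA]) auto
    fix j assume "j < n"
    \<comment> \<open>The difference d - l has entries of degree at least 2, so one contraction
      still leaves degree at least 1, that is, membership in the ideal of all generators.\<close>
    have "degW {2..} (rW F)" by (rule degW_matrix_op[OF u admissible_rest]) auto
    then have "degW {s. Suc s \<in> {2..}} (cW j (rW F))" using deg_in_contract unfolding degW_def cW_def by blast
    then have "degW {1..} (cW j (rW F))" unfolding degW_def by (auto intro: deg_in_mono)
    then show "cW j (dW F - lW F) \<in> CM.ideal_part n (i + 1)"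
      using ideal_part_full cW_grW[OF dg(3)] unfolding rW by blast
  qed
qed

section \<open>Return from operators to complexes of modules\<close>

lemma exact_dW:
  assumes "cocycles G i \<subseteq> coboundaries G i" "F \<in> grW i" "dW F = 0" shows "F \<in> dW ` grW (i - 1)"
proof -
  obtain x where x: "x \<in> carrier (obj G i)" "F = embed i x" using embed_surj[OF assms(2)] by blast
  interpret N: based_module EA "obj G (i + 1)" "B (i + 1)" by (rule based)
  have "embed (i + 1) (diff G i x) = embed (i + 1) \<zero>\<^bsub>obj G (i + 1)\<^esub>"
    using embed_diff[OF x(1)] assms(3) x(2) embed_zero by simp
  then have "diff G i x = \<zero>\<^bsub>obj G (i + 1)\<^esub>" using embed_inj diff_closed[OF x(1)] by blast
  then have "x \<in> coboundaries G i" using assms(1) x(1) unfolding cocycles_def by blast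
  then obtain y where y: "y \<in> carrier (obj G (i - 1))" "x = diff G (i - 1) y" unfolding coboundaries_def by blast
  then have "F = dW (embed (i - 1) y)" using embed_diff[OF y(1)] x(2) by simp
  then show ?thesis using embed_grW[OF y(1)] by blast
qed

text \<open>\<open>embed\<close> identifies the modules with the spaces \<open>grW\<close> and
  carries the linear part to \<open>lW\<close>, so cocycles and coboundaries correspond. The
  inclusion of coboundaries in cocycles rests on \<open>lW_lW\<close>.\<close>

lemma exact_at_lin:
  assumes ex: "\<And>F. F \<in> grW i \<Longrightarrow> lW F = 0 \<Longrightarrow> F \<in> lW ` grW (i - 1)"
  shows "exact_at (lin_wrt scale B G) i"
proof -
  let ?L = "lin_wrt scale B G"
  have obj: "obj ?L = obj G" unfolding lin_wrt_def by simp
  interpret N: based_module EA "obj G (i + 1)" "B (i + 1)" by (rule based)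
  show ?thesis unfolding exact_at_def
  proof
    show "cocycles ?L i \<subseteq> coboundaries ?L i"
    proof
      fix x assume "x \<in> cocycles ?L i"
      then have x: "x \<in> carrier (obj G i)" "diff ?L i x = \<zero>\<^bsub>obj G (i + 1)\<^esub>" unfolding cocycles_def obj by auto
      then have "lW (embed i x) = 0" using embed_lin_diff[OF x(1)] embed_zero by simp
      then obtain F where F: "F \<in> grW (i - 1)" "embed i x = lW F" using ex[OF embed_grW[OF x(1)]] by blast
      obtain y where y: "y \<in> carrier (obj G (i - 1))" "F = embed (i - 1) y" using embed_surj[OF F(1)] by blast
      have "embed i x = embed i (diff ?L (i - 1) y)" using embed_lin_diff[OF y(1)] F(2) y(2) by simp
      then have "x = diff ?L (i - 1) y" using embed_inj[OF x(1)] lin_diff_closed[OF y(1)] by simp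
      then show "x \<in> coboundaries ?L i" unfolding coboundaries_def obj using y(1) by blast
    qed
    show "coboundaries ?L i \<subseteq> cocycles ?L i"
    proof
      fix x assume "x \<in> coboundaries ?L i"
      then obtain y where y: "y \<in> carrier (obj G (i - 1))" "x = diff ?L (i - 1) y" unfolding coboundaries_def obj by blast
      then have x: "x \<in> carrier (obj G i)" using lin_diff_closed[OF y(1)] by simp
      have "embed i x = lW (embed (i - 1) y)" using embed_lin_diff[OF y(1)] y(2) by simp
      then have "lW (embed i x) = 0" using lW_lW[OF embed_grW[OF y(1)]] by simp
      then have "embed (i + 1) (diff ?L i x) = embed (i + 1) \<zero>\<^bsub>obj G (i + 1)\<^esub>"
        using embed_lin_diff[OF x] embed_zero by simp
      then have "diff ?L i x = \<zero>\<^bsub>obj G (i + 1)\<^esub>" using embed_inj lin_diff_closed[OF x] by blast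
      then show "x \<in> cocycles ?L i" unfolding cocycles_def obj using x by blast
    qed
  qed
qed

lemma lin_eventually_exact_right:
  assumes "\<And>i. i > 0 \<Longrightarrow> cocycles G i \<subseteq> coboundaries G i"
  shows "\<exists>N. \<forall>i\<ge>N. exact_at (lin_wrt scale B G) i"
proof -
  have "F \<in> dW ` grW (int k)" if "F \<in> grW (int (Suc k))" "dW F = 0" for k F
    using exact_dW[OF assms, of "int (Suc k)" F] that by simp
  then obtain N where N: "\<forall>k\<ge>N. \<forall>F\<in>grW (int (Suc k)). lW F = 0 \<longrightarrow> F \<in> lW ` grW (int k)"
    using CC.linear_part_eventually_exact_right[of 0] by blast
  have "exact_at (lin_wrt scale B G) i" if i: "i \<ge> int (Suc N)" for i
  proof (rule exact_at_lin)
    fix F assume F: "F \<in> grW i" "lW F = 0"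
    define k where "k = nat (i - 1)"
    have k: "i = int (Suc k)" "i - 1 = int k" "k \<ge> N" using i unfolding k_def by auto
    show "F \<in> lW ` grW (i - 1)" using N k F by metis
  qed
  then show ?thesis by blast
qed

lemma lin_eventually_exact_left:
  assumes "\<And>i. i < 0 \<Longrightarrow> cocycles G i \<subseteq> coboundaries G i" and B1: "B 1 = {}"
  shows "\<exists>N. \<forall>i\<ge>N. exact_at (lin_wrt scale B G) (- i)"
proof -
  have ex: "F \<in> dW ` grW (- int (Suc k))" if "k \<ge> 1" "F \<in> grW (- int k)" "dW F = 0" for k F
  proof -
    have neg: "- int k < 0" and eq: "- int k - 1 = - int (Suc k)" using that(1) by simp_all
    show ?thesis using exact_dW[OF assms(1)[OF neg] that(2,3)] unfolding eq .
  qed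
  have gr1: "grW 1 = {0}"
  proof
    show "grW 1 \<subseteq> {0}" unfolding grW_def using B1 by (auto simp: fun_eq_iff)
    show "{0} \<subseteq> grW 1" using CM.gr_0 by blast
  qed
  obtain N where N: "\<forall>k\<ge>N. \<forall>F\<in>grW (- int k). lW F = 0 \<longrightarrow> F \<in> lW ` grW (- int (Suc k))"
    using CC.linear_part_eventually_exact_left[of 1, OF ex gr1] by blast
  have "exact_at (lin_wrt scale B G) (- i)" if i: "i \<ge> int N" for i
  proof (rule exact_at_lin)
    fix F assume F: "F \<in> grW (- i)" "lW F = 0"
    define k where "k = nat i"
    have k: "- i = - int k" "- i - 1 = - int (Suc k)" "k \<ge> N" using i unfolding k_def by auto
    show "F \<in> lW ` grW (- i - 1)" using N k F by metis
  qed
  then show ?thesis by blast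
qed

end

theorem theorem3p1:
  fixes scale :: "'k::field \<Rightarrow> 'v::ab_group_add \<Rightarrow> 'v" and Basis :: "'v set"
    and M :: "(('v list \<Rightarrow> 'k) set, 'a) module"
    and F :: "(('v list \<Rightarrow> 'k) set, 'b) cochain"
    and L :: "(('v list \<Rightarrow> 'k) set, 'c) cochain"
  assumes "finite_dimensional_vector_space scale Basis"
    and "fin_gen_module (exterior_algebra scale) M"
    and "is_linear_part scale F L"
  shows "(free_resolution (exterior_algebra scale) M F \<longrightarrow> (\<exists>N. \<forall>i\<ge>N. exact_at L (- i)))
       \<and> (injective_resolution (exterior_algebra scale) M F \<longrightarrow> (\<exists>N. \<forall>i\<ge>N. exact_at L i))"
proof -
  interpret V: finite_dimensional_vector_space scale Basis by fact
  obtain G B where G: "minimal_free_wrt scale G B" "homotopy_equivalent (exterior_algebra scale) F G" "L = lin_wrt scale B G"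
    using assms(3) unfolding is_linear_part_def by blast
  obtain bas where "bij_betw bas {0..<card Basis} Basis"
    using ex_bij_betw_nat_finite[OF V.finite_Basis] by blast
  then have "bij_betw bas {..<card Basis} Basis" by (simp add: atLeast0LessThan)
  then interpret minimal_complex scale Basis "card Basis" bas G B
    using G(1) by unfold_locales
  show ?thesis
  proof (intro conjI impI)
    assume res: "free_resolution (exterior_algebra scale) M F"
    note * = free_case[OF assms(2) G(2) res]
    \<comment> \<open>Finite rank depends on the kind of resolution, so the locale is interpreted
      separately in each of the two cases.\<close>
    interpret finite_minimal_complex scale Basis "card Basis" bas G B by unfold_locales (rule *(1))
    show "\<exists>N. \<forall>i\<ge>N. exact_at L (- i)" unfolding G(3) using lin_eventually_exact_left *(2,3) by simp
  next
    assume res: "injective_resolution (exterior_algebra scale) M F"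
    note * = injective_case[OF assms(2) G(2) res]
    interpret finite_minimal_complex scale Basis "card Basis" bas G B by unfold_locales (rule *(1))
    show "\<exists>N. \<forall>i\<ge>N. exact_at L i" unfolding G(3) using lin_eventually_exact_right *(2) by simp
  qed
qed

end
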